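(* Let $n\ge 1$ and $k\ge 0$ be integers. (1) If $\mathcal V=(V,\eta,\xi)$ is a left cyclic polarized arrangement of $n$ hyperplanes in $k$-space, then $\tilde B(\mathcal V)$ is isomorphic, as a $\mathbb Z$-algebra, to the Ozsváth–Szabó algebra $\mathcal B_l(n,k)$. (2) If $\mathcal V=(V,\eta,\xi)$ is a right cyclic polarized arrangement of $n$ hyperplanes in $k$-space, then $\tilde B(\mathcal V)$ is isomorphic, as a $\mathbb Z$-algebra, to the Ozsváth–Szabó algebra $\mathcal B_r(n,k)$. (3) If $(V,\eta)$ is a cyclic arrangement of $n$ hyperplanes in $k$-space, then $\tilde B'(V,\eta)$ is isomorphic, as a $\mathbb Z$-algebra, to the Ozsváth–Szabó algebra $\mathcal B'(n,k)$.
   Context: **Arrangements.** An arrangement of $n$ hyperplanes in $k$-space is a pair $(V,\eta)$ with $V\subset\mathbb R^n$ a linear subspace of dimension $k$ and $\eta\in\mathbb R^n/V$ such that every representative of $\eta$ in $\mathbb R^n$ has at least $n-k$ nonzero entries. View $V+\eta$ as an affine subspace of $\mathbb R^n$. Put $H_i=\{x\in V+\eta: x_i=0\}$, $H_S=\bigcap_{i\in S}H_i$ for $S\subset\{1,\dots,n\}$ ($H_\emptyset=V+\eta$), and for $\alpha\in\{+,-\}^n$ put $\Delta_\alpha=\{x\in V+\eta:\alpha(i)x_i\ge0\ \forall i\}$. A polarized arrangement is $(V,\eta,\xi)$ with $(V,\eta)$ an arrangement and $\xi\in V^*=(\mathbb R^n)^*/V^\perp$ such that every representative of $\xi$ in $(\mathbb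 R^n)^*$ has at least $k$ nonzero entries. $\alpha$ is feasible if $\Delta_\alpha\ne\emptyset$, and bounded if an affine function on $V+\eta$ with linear part $\xi$ is bounded above on $\Delta_\alpha$. $\mathcal P$ is the set of bounded feasible sign sequences; $\mathcal K$ is the set of feasible $\alpha$ with $\Delta_\alpha$ compact. **Cyclicity.** $\mathrm{Gr}^{>0}_{k,n}$ is the set of $k$-dimensional subspaces of $\mathbb R^n$ whose Plücker coordinates are all nonzero and of the same sign. $\eta$ is positively oriented with respect to $V$ if the first coordinate of the orthogonal projection onto $V^\perp\subset\mathbb R^n$ of a representative of $\eta$ is positive. $(V,\eta)$ is cyclic if $V\in\mathrm{Gr}^{>0}_{k,n}$, $V+\langle\eta\rangle\in\mathrm{Gr}^{>0}_{k+1,n}$, and $\eta$ is positively oriented with respect to $V$. $(V,\eta,\xi)$ is left cyclic (resp. right cyclic) if $V+\langle\eta\rangle\in\mathrm{Gr}^{>0}_{k+1,n}$, $(\xi,\mathrm{id})(V)\in\mathrm{Gr}^{>0}_{k,n+1}$ (resp. $(\mathrm{id},(-1)^k\xi)(V)\in\mathrm{Gr}^{>0}_{k,n+1}$), and $\eta$ is positively oriented with respect to $V$. Here $(\xi,\mathrm{id})(v)=(\xi(v),v)$ and $(\mathrm{id},(-1)^k\xi)(v)=(v,(-1)^k\xi(v))$. **Hypertoric algebras.** For $\alpha,\beta\in\mathcal P$ let $\tilde R_{\alpha\beta}=\mathbb Z[u_1,\dots,u_n]/(u_S: S\subset\{1,\dots,n\},\ \Delta_\alpha\cap\Delta_\beta\cap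 H_S=\emptyset)$ with $u_S=\prod_{i\in S}u_i$, and let $f_{\alpha,\beta}$ be the class of $1$. Then $\tilde B(\mathcal V)=\bigoplus_{\alpha,\beta\in\mathcal P}\tilde R_{\alpha\beta}$ with $\mathbb Z[u_1,\dots,u_n]$-bilinear product $f_{\alpha,\beta}f_{\beta,\gamma}=u_{S(\alpha\beta\gamma)}f_{\alpha,\gamma}$, where $S(\alpha\beta\gamma)=\{i:\alpha(i)=\gamma(i)\neq\beta(i)\}$ (and $f_{\alpha,\beta}f_{\beta',\gamma}=0$ if $\beta\ne\beta'$). For unpolarized $(V,\eta)$, $\tilde B'(V,\eta)$ is defined in the same way using only $\alpha,\beta\in\mathcal K$; equivalently $\tilde B'(V,\eta)=e\,\tilde B(V,\eta,\xi)\,e$ with $e=\sum_{\alpha\in\mathcal K}f_{\alpha,\alpha}$ for any polarization $\xi$. **Ozsváth–Szabó algebras.** Let $V(n,k)$ be the set of $k$-element subsets of $\{0,\dots,n\}$. $\mathcal B(n,k)$ is the path algebra over $\mathbb Z$ (paths composed left to right) of the quiver with vertex set $V(n,k)$ and arrows: for $1\le i\le n$, $R_i:\mathbf x\to\mathbf y$ and $L_i:\mathbf y\to\mathbf x$ whenever $\mathbf x\cap\{i-1,i\}=\{i-1\}$ and $\mathbf y=(\mathbf x\setminus\{i-1\})\cup\{i\}$; and $U_i:\mathbf x\to\mathbf x$ for all $\mathbf x$ and $1\le i\le n$; modulo the relations (whenever the paths make sense): $R_iU_j=U_jR_i$, $L_iU_j=U_jL_i$, $U_iU_j=U_jU_i$;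 $R_iL_i=U_i$, $L_iR_i=U_i$; $R_iR_j=R_jR_i$, $L_iL_j=L_jL_i$, $L_iR_j=R_jL_i$ for $|i-j|>1$; $R_{i-1}R_i=0$, $L_iL_{i-1}=0$; $U_i\mathbf I_{\mathbf x}=0$ if $\mathbf x\cap\{i-1,i\}=\emptyset$, where $\mathbf I_{\mathbf x}$ is the trivial path at $\mathbf x$. Let $V_l(n,k),V_r(n,k),V'(n,k)$ be the sets of $k$-element subsets of $\{0,\dots,n-1\}$, $\{1,\dots,n\}$, $\{1,\dots,n-1\}$. Then $\mathcal B_l(n,k)$, $\mathcal B_r(n,k)$, $\mathcal B'(n,k)$ are $\bigoplus_{\mathbf x,\mathbf x'}\mathbf I_{\mathbf x}\mathcal B(n,k)\mathbf I_{\mathbf x'}$ with $\mathbf x,\mathbf x'$ ranging over $V_l(n,k)$, $V_r(n,k)$, $V'(n,k)$ respectively. (These are the algebras attached to the $k$-th symmetric product of the $n$-punctured disc.) *)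

theory Defs
  imports
    "HOL-Analysis.Analysis"
    "HOL-Analysis.Finite_Function_Topology"
    "HOL-Algebra.QuotRing"
    "Jordan_Normal_Form.Determinant"
    "Graph_Theory.Arc_Walk"
begin

section \<open>Coordinate spaces and positive Grassmannians\<close>

text \<open>
  For a finite set \<open>J\<close> of indices, \<open>coord_space J\<close> is the real vector space with coordinates indexed
  by \<open>J\<close>, realised inside the normed space of finitely supported functions. Thus
  \<open>coord_space {1..n}\<close> is the Euclidean space of dimension \<open>n\<close>.
\<close>

definition coord_space :: "nat set \<Rightarrow> (nat \<Rightarrow>\<^sub>0 real) set" where
  "coord_space J = {x. Poly_Mapping.keys x \<subseteq> J}"

definition dot :: "(nat \<Rightarrow>\<^sub>0 real) \<Rightarrow> (nat \<Rightarrow>\<^sub>0 real) \<Rightarrow> real" where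
  "dot x y = (\<Sum>i\<in>Poly_Mapping.keys x. Poly_Mapping.lookup x i * Poly_Mapping.lookup y i)"

definition orth_compl :: "nat \<Rightarrow> (nat \<Rightarrow>\<^sub>0 real) set \<Rightarrow> (nat \<Rightarrow>\<^sub>0 real) set" where
  "orth_compl n W = {x \<in> coord_space {1..n}. \<forall>w\<in>W. dot x w = 0}"

definition orth_proj :: "nat \<Rightarrow> (nat \<Rightarrow>\<^sub>0 real) set \<Rightarrow> (nat \<Rightarrow>\<^sub>0 real) \<Rightarrow> (nat \<Rightarrow>\<^sub>0 real)" where
  "orth_proj n W x = (THE p. p \<in> W \<and> x - p \<in> orth_compl n W)"

text \<open>
  The Pluecker coordinate at \<open>I\<close> with respect to the basis \<open>b 0, \<dots>, b (k - 1)\<close>: the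
  maximal minor of the matrix with rows \<open>b i\<close> on the columns \<open>I\<close>, taken in increasing order.
\<close>

definition plucker :: "nat \<Rightarrow> (nat \<Rightarrow> (nat \<Rightarrow>\<^sub>0 real)) \<Rightarrow> nat set \<Rightarrow> real" where
  "plucker k b I =
     Determinant.det (Matrix.mat k k (\<lambda>(i, j). Poly_Mapping.lookup (b i) (sorted_list_of_set I ! j)))"

text \<open>
  The index set is a parameter: \<open>Gr_pos k {1..n}\<close> is the usual positive Grassmannian, and the
  ambient space of dimension \<open>n + 1\<close> may be given by either of the index sets \<open>{0..n}\<close> and
  \<open>{1..n + 1}\<close>, as only the order of the coordinates matters.
\<close>

definition Gr_pos :: "nat \<Rightarrow> nat set \<Rightarrow> (nat \<Rightarrow>\<^sub>0 real) set set" where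
  "Gr_pos k J = {V. V \<subseteq> coord_space J \<and> Real_Vector_Spaces.subspace V \<and>
     Real_Vector_Spaces.dim V = k \<and>
     (\<exists>b. inj_on b {..<k} \<and> Real_Vector_Spaces.independent (b ` {..<k}) \<and>
          Real_Vector_Spaces.span (b ` {..<k}) = V \<and>
          ((\<forall>I. I \<subseteq> J \<and> card I = k \<longrightarrow> plucker k b I > 0) \<or>
           (\<forall>I. I \<subseteq> J \<and> card I = k \<longrightarrow> plucker k b I < 0)))}"

section \<open>Polarized arrangements\<close>

text \<open>
  A class \<open>\<eta>\<close> modulo \<open>V\<close> is the set of its representatives; so \<open>\<eta>\<close> itself is the affine subspace
  \<open>V + \<eta>\<close>, and \<open>V + \<langle>\<eta>\<rangle>\<close> is the linear span of \<open>V \<union> \<eta>\<close>.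
\<close>

definition arrangement :: "nat \<Rightarrow> nat \<Rightarrow> (nat \<Rightarrow>\<^sub>0 real) set \<Rightarrow> (nat \<Rightarrow>\<^sub>0 real) set \<Rightarrow> bool" where
  "arrangement n k V \<eta> \<longleftrightarrow>
     V \<subseteq> coord_space {1..n} \<and> Real_Vector_Spaces.subspace V \<and> Real_Vector_Spaces.dim V = k \<and>
     (\<exists>r\<in>coord_space {1..n}. \<eta> = (\<lambda>v. r + v) ` V) \<and>
     (\<forall>x\<in>\<eta>. n - k \<le> card (Poly_Mapping.keys x))"

text \<open>
  Elements of the dual of \<open>V\<close>; their values outside \<open>V\<close> are irrelevant. The vectors \<open>c\<close> in
  \<open>polarized_arrangement\<close> are the representatives of \<open>\<xi>\<close>, a linear form on the coordinate space
  being identified with its coefficient vector.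
\<close>

definition dual_space :: "(nat \<Rightarrow>\<^sub>0 real) set \<Rightarrow> ((nat \<Rightarrow>\<^sub>0 real) \<Rightarrow> real) set" where
  "dual_space V = {\<xi>. \<forall>u\<in>V. \<forall>v\<in>V. \<forall>a b. \<xi> (a *\<^sub>R u + b *\<^sub>R v) = a * \<xi> u + b * \<xi> v}"

definition polarized_arrangement ::
  "nat \<Rightarrow> nat \<Rightarrow> (nat \<Rightarrow>\<^sub>0 real) set \<Rightarrow> (nat \<Rightarrow>\<^sub>0 real) set \<Rightarrow> ((nat \<Rightarrow>\<^sub>0 real) \<Rightarrow> real) \<Rightarrow> bool" where
  "polarized_arrangement n k V \<eta> \<xi> \<longleftrightarrow>
     arrangement n k V \<eta> \<and> \<xi> \<in> dual_space V \<and>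
     (\<forall>c\<in>coord_space {1..n}. (\<forall>v\<in>V. \<xi> v = dot c v) \<longrightarrow> k \<le> card (Poly_Mapping.keys c))"

definition hyp_inter :: "(nat \<Rightarrow>\<^sub>0 real) set \<Rightarrow> nat set \<Rightarrow> (nat \<Rightarrow>\<^sub>0 real) set" where
  "hyp_inter \<eta> S = {x \<in> \<eta>. \<forall>i\<in>S. Poly_Mapping.lookup x i = 0}"

definition sign_seqs :: "nat \<Rightarrow> (nat \<Rightarrow> real) set" where
  "sign_seqs n = {1..n} \<rightarrow>\<^sub>E {1, -1}"

definition region :: "nat \<Rightarrow> (nat \<Rightarrow>\<^sub>0 real) set \<Rightarrow> (nat \<Rightarrow> real) \<Rightarrow> (nat \<Rightarrow>\<^sub>0 real) set" where
  "region n \<eta> \<alpha> = {x \<in> \<eta>. \<forall>i\<in>{1..n}. \<alpha> i * Poly_Mapping.lookup x i \<ge> 0}"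

definition feasible :: "nat \<Rightarrow> (nat \<Rightarrow>\<^sub>0 real) set \<Rightarrow> (nat \<Rightarrow> real) \<Rightarrow> bool" where
  "feasible n \<eta> \<alpha> \<longleftrightarrow> region n \<eta> \<alpha> \<noteq> {}"

definition bounded_sign ::
  "nat \<Rightarrow> (nat \<Rightarrow>\<^sub>0 real) set \<Rightarrow> ((nat \<Rightarrow>\<^sub>0 real) \<Rightarrow> real) \<Rightarrow> (nat \<Rightarrow> real) \<Rightarrow> bool" where
  "bounded_sign n \<eta> \<xi> \<alpha> \<longleftrightarrow>
     (\<exists>f. (\<forall>x\<in>\<eta>. \<forall>y\<in>\<eta>. f x - f y = \<xi> (x - y)) \<and> bdd_above (f ` region n \<eta> \<alpha>))"

definition bounded_feasible_signs ::
  "nat \<Rightarrow> (nat \<Rightarrow>\<^sub>0 real) set \<Rightarrow> ((nat \<Rightarrow>\<^sub>0 real) \<Rightarrow> real) \<Rightarrow> (nat \<Rightarrow> real) set" where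
  "bounded_feasible_signs n \<eta> \<xi> = {\<alpha> \<in> sign_seqs n. feasible n \<eta> \<alpha> \<and> bounded_sign n \<eta> \<xi> \<alpha>}"

definition compact_feasible_signs :: "nat \<Rightarrow> (nat \<Rightarrow>\<^sub>0 real) set \<Rightarrow> (nat \<Rightarrow> real) set" where
  "compact_feasible_signs n \<eta> = {\<alpha> \<in> sign_seqs n. feasible n \<eta> \<alpha> \<and> compact (region n \<eta> \<alpha>)}"

section \<open>Cyclicity\<close>

definition positively_oriented :: "nat \<Rightarrow> (nat \<Rightarrow>\<^sub>0 real) set \<Rightarrow> (nat \<Rightarrow>\<^sub>0 real) set \<Rightarrow> bool" where
  "positively_oriented n V \<eta> \<longleftrightarrow>
     (\<forall>x\<in>\<eta>. Poly_Mapping.lookup (orth_proj n (orth_compl n V) x) 1 > 0)"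

definition cyclic_arrangement ::
  "nat \<Rightarrow> nat \<Rightarrow> (nat \<Rightarrow>\<^sub>0 real) set \<Rightarrow> (nat \<Rightarrow>\<^sub>0 real) set \<Rightarrow> bool" where
  "cyclic_arrangement n k V \<eta> \<longleftrightarrow>
     arrangement n k V \<eta> \<and>
     V \<in> Gr_pos k {1..n} \<and>
     Real_Vector_Spaces.span (V \<union> \<eta>) \<in> Gr_pos (k + 1) {1..n} \<and>
     positively_oriented n V \<eta>"

text \<open>
  The vector \<open>(\<xi>(v), v)\<close> has the new coordinate at index \<open>0\<close>, in front of the coordinates
  \<open>1, \<dots>, n\<close> of \<open>v\<close>.
\<close>

definition left_cyclic ::
  "nat \<Rightarrow> nat \<Rightarrow> (nat \<Rightarrow>\<^sub>0 real) set \<Rightarrow> (nat \<Rightarrow>\<^sub>0 real) set \<Rightarrow> ((nat \<Rightarrow>\<^sub>0 real) \<Rightarrow> real) \<Rightarrow> bool" where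
  "left_cyclic n k V \<eta> \<xi> \<longleftrightarrow>
     polarized_arrangement n k V \<eta> \<xi> \<and>
     Real_Vector_Spaces.span (V \<union> \<eta>) \<in> Gr_pos (k + 1) {1..n} \<and>
     (\<lambda>v. Poly_Mapping.single 0 (\<xi> v) + v) ` V \<in> Gr_pos k {0..n} \<and>
     positively_oriented n V \<eta>"

definition right_cyclic ::
  "nat \<Rightarrow> nat \<Rightarrow> (nat \<Rightarrow>\<^sub>0 real) set \<Rightarrow> (nat \<Rightarrow>\<^sub>0 real) set \<Rightarrow> ((nat \<Rightarrow>\<^sub>0 real) \<Rightarrow> real) \<Rightarrow> bool" where
  "right_cyclic n k V \<eta> \<xi> \<longleftrightarrow>
     polarized_arrangement n k V \<eta> \<xi> \<and>
     Real_Vector_Spaces.span (V \<union> \<eta>) \<in> Gr_pos (k + 1) {1..n} \<and>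
     (\<lambda>v. v + Poly_Mapping.single (n + 1) ((-1) ^ k * \<xi> v)) ` V \<in> Gr_pos k {1..n + 1} \<and>
     positively_oriented n V \<eta>"

section \<open>Hypertoric convolution algebras\<close>

text \<open>
  Polynomials are finitely supported functions from monomials to coefficients, and monomials
  finitely supported functions from variables to exponents.
\<close>

definition poly_ring :: "nat \<Rightarrow> ((nat \<Rightarrow>\<^sub>0 nat) \<Rightarrow>\<^sub>0 int) ring" where
  "poly_ring n =
     \<lparr>carrier = {p. \<forall>m\<in>Poly_Mapping.keys p. Poly_Mapping.keys m \<subseteq> {1..n}},
      monoid.mult = (*), one = 1, zero = 0, add = (+)\<rparr>"

definition u_var :: "nat \<Rightarrow> (nat \<Rightarrow>\<^sub>0 nat) \<Rightarrow>\<^sub>0 int" where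
  "u_var i = Poly_Mapping.single (Poly_Mapping.single i 1) 1"

definition u_mon :: "nat set \<Rightarrow> (nat \<Rightarrow>\<^sub>0 nat) \<Rightarrow>\<^sub>0 int" where
  "u_mon S = (\<Prod>i\<in>S. u_var i)"

definition hyp_ideal ::
  "nat \<Rightarrow> (nat \<Rightarrow>\<^sub>0 real) set \<Rightarrow> (nat \<Rightarrow> real) \<Rightarrow> (nat \<Rightarrow> real) \<Rightarrow> ((nat \<Rightarrow>\<^sub>0 nat) \<Rightarrow>\<^sub>0 int) set" where
  "hyp_ideal n \<eta> \<alpha> \<beta> = genideal (poly_ring n)
     {u_mon S | S. S \<subseteq> {1..n} \<and> region n \<eta> \<alpha> \<inter> region n \<eta> \<beta> \<inter> hyp_inter \<eta> S = {}}"

definition hyp_R ::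
  "nat \<Rightarrow> (nat \<Rightarrow>\<^sub>0 real) set \<Rightarrow> (nat \<Rightarrow> real) \<Rightarrow> (nat \<Rightarrow> real) \<Rightarrow> ((nat \<Rightarrow>\<^sub>0 nat) \<Rightarrow>\<^sub>0 int) set ring" where
  "hyp_R n \<eta> \<alpha> \<beta> = poly_ring n Quot hyp_ideal n \<eta> \<alpha> \<beta>"

definition conv_set :: "nat \<Rightarrow> (nat \<Rightarrow> real) \<Rightarrow> (nat \<Rightarrow> real) \<Rightarrow> (nat \<Rightarrow> real) \<Rightarrow> nat set" where
  "conv_set n \<alpha> \<beta> \<gamma> = {i \<in> {1..n}. \<alpha> i = \<gamma> i \<and> \<alpha> i \<noteq> \<beta> i}"

text \<open>
  The product of a residue class \<open>X\<close> in \<open>hyp_R n \<eta> \<alpha> \<beta>\<close> and a residue class \<open>Y\<close> in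
  \<open>hyp_R n \<eta> \<beta> \<gamma>\<close>: the class in \<open>hyp_R n \<eta> \<alpha> \<gamma>\<close> of \<open>u_mon (conv_set n \<alpha> \<beta> \<gamma>) * x * y\<close>
  for representatives \<open>x\<close> and \<open>y\<close>. Being independent of these, it is the union over all choices,
  as in \<^const>\<open>rcoset_mult\<close>.
\<close>

definition conv_mult ::
  "nat \<Rightarrow> (nat \<Rightarrow>\<^sub>0 real) set \<Rightarrow> (nat \<Rightarrow> real) \<Rightarrow> (nat \<Rightarrow> real) \<Rightarrow> (nat \<Rightarrow> real) \<Rightarrow>
   ((nat \<Rightarrow>\<^sub>0 nat) \<Rightarrow>\<^sub>0 int) set \<Rightarrow> ((nat \<Rightarrow>\<^sub>0 nat) \<Rightarrow>\<^sub>0 int) set \<Rightarrow> ((nat \<Rightarrow>\<^sub>0 nat) \<Rightarrow>\<^sub>0 int) set" where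
  "conv_mult n \<eta> \<alpha> \<beta> \<gamma> X Y =
     (\<Union>x\<in>X. \<Union>y\<in>Y. hyp_ideal n \<eta> \<alpha> \<gamma> +>\<^bsub>poly_ring n\<^esub> (u_mon (conv_set n \<alpha> \<beta> \<gamma>) * x * y))"

text \<open>
  The convolution algebra on a finite set \<open>A\<close> of sign sequences. An element is the family of its
  components in the summands \<open>hyp_R n \<eta> \<alpha> \<beta>\<close>.
\<close>

definition conv_algebra ::
  "nat \<Rightarrow> (nat \<Rightarrow>\<^sub>0 real) set \<Rightarrow> (nat \<Rightarrow> real) set \<Rightarrow>
   ((nat \<Rightarrow> real) \<times> (nat \<Rightarrow> real) \<Rightarrow> ((nat \<Rightarrow>\<^sub>0 nat) \<Rightarrow>\<^sub>0 int) set) ring" where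
  "conv_algebra n \<eta> A =
     \<lparr>carrier = (\<Pi>\<^sub>E (\<alpha>, \<beta>)\<in>A \<times> A. carrier (hyp_R n \<eta> \<alpha> \<beta>)),
      monoid.mult = (\<lambda>X Y. \<lambda>(\<alpha>, \<gamma>)\<in>A \<times> A.
        finsum (hyp_R n \<eta> \<alpha> \<gamma>) (\<lambda>\<beta>. conv_mult n \<eta> \<alpha> \<beta> \<gamma> (X (\<alpha>, \<beta>)) (Y (\<beta>, \<gamma>))) A),
      one = (\<lambda>(\<alpha>, \<beta>)\<in>A \<times> A.
        if \<alpha> = \<beta> then \<one>\<^bsub>hyp_R n \<eta> \<alpha> \<beta>\<^esub> else \<zero>\<^bsub>hyp_R n \<eta> \<alpha> \<beta>\<^esub>),
      zero = (\<lambda>(\<alpha>, \<beta>)\<in>A \<times> A. \<zero>\<^bsub>hyp_R n \<eta> \<alpha> \<beta>\<^esub>),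
      add = (\<lambda>X Y. \<lambda>(\<alpha>, \<beta>)\<in>A \<times> A. X (\<alpha>, \<beta>) \<oplus>\<^bsub>hyp_R n \<eta> \<alpha> \<beta>\<^esub> Y (\<alpha>, \<beta>))\<rparr>"

text \<open>
  The algebras of a polarized arrangement \<open>(V, \<eta>, \<xi>)\<close> and of an unpolarized one \<open>(V, \<eta>)\<close>; the
  subspace \<open>V\<close> enters only through the coset \<open>\<eta>\<close>.
\<close>

definition hypertoric_B ::
  "nat \<Rightarrow> (nat \<Rightarrow>\<^sub>0 real) set \<Rightarrow> ((nat \<Rightarrow>\<^sub>0 real) \<Rightarrow> real) \<Rightarrow>
   ((nat \<Rightarrow> real) \<times> (nat \<Rightarrow> real) \<Rightarrow> ((nat \<Rightarrow>\<^sub>0 nat) \<Rightarrow>\<^sub>0 int) set) ring" where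
  "hypertoric_B n \<eta> \<xi> = conv_algebra n \<eta> (bounded_feasible_signs n \<eta> \<xi>)"

definition hypertoric_B' ::
  "nat \<Rightarrow> (nat \<Rightarrow>\<^sub>0 real) set \<Rightarrow>
   ((nat \<Rightarrow> real) \<times> (nat \<Rightarrow> real) \<Rightarrow> ((nat \<Rightarrow>\<^sub>0 nat) \<Rightarrow>\<^sub>0 int) set) ring" where
  "hypertoric_B' n \<eta> = conv_algebra n \<eta> (compact_feasible_signs n \<eta>)"

section \<open>Path algebras\<close>

text \<open>
  A path is a triple consisting of its source, its list of arrows and its target; the source and
  the target are only needed for the trivial paths.
\<close>

type_synonym ('v, 'e) path = "'v \<times> 'e list \<times> 'v"

definition quiver_paths :: "('v, 'e) pre_digraph \<Rightarrow> ('v, 'e) path set" where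
  "quiver_paths G = {(x, p, y). pre_digraph.awalk G x p y}"

definition path_algebra :: "('v, 'e) pre_digraph \<Rightarrow> (('v, 'e) path \<Rightarrow>\<^sub>0 int) ring" where
  "path_algebra G =
     \<lparr>carrier = {f. Poly_Mapping.keys f \<subseteq> quiver_paths G},
      monoid.mult = (\<lambda>f g. \<Sum>(x, p, y)\<in>Poly_Mapping.keys f. \<Sum>(x', q, z)\<in>Poly_Mapping.keys g.
        if y = x' then
          Poly_Mapping.single (x, p @ q, z)
            (Poly_Mapping.lookup f (x, p, y) * Poly_Mapping.lookup g (x', q, z))
        else 0),
      one = (\<Sum>x\<in>verts G. Poly_Mapping.single (x, [], x) 1),
      zero = 0,
      add = (+)\<rparr>"

section \<open>Ozsvath--Szabo algebras\<close>

datatype os_label = R_arr nat | L_arr nat | U_arr nat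

definition os_states :: "nat set \<Rightarrow> nat \<Rightarrow> nat set set" where
  "os_states J k = {x. x \<subseteq> J \<and> card x = k}"

definition os_step :: "nat \<Rightarrow> nat \<Rightarrow> nat \<Rightarrow> nat set \<Rightarrow> nat set \<Rightarrow> bool" where
  "os_step n k i x y \<longleftrightarrow> 1 \<le> i \<and> i \<le> n \<and> x \<in> os_states {0..n} k \<and>
     x \<inter> {i - 1, i} = {i - 1} \<and> y = (x - {i - 1}) \<union> {i}"

definition os_quiver :: "nat \<Rightarrow> nat \<Rightarrow> (nat set, nat set \<times> os_label \<times> nat set) pre_digraph" where
  "os_quiver n k =
     \<lparr>verts = os_states {0..n} k,
      arcs = {(x, R_arr i, y) | x i y. os_step n k i x y} \<union>
             {(y, L_arr i, x) | x i y. os_step n k i x y} \<union>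
             {(x, U_arr i, x) | x i. x \<in> os_states {0..n} k \<and> 1 \<le> i \<and> i \<le> n},
      tail = (\<lambda>(x, l, y). x),
      head = (\<lambda>(x, l, y). y)\<rparr>"

inductive os_eq_rel :: "os_label list \<Rightarrow> os_label list \<Rightarrow> bool" where
  RU: "os_eq_rel [R_arr i, U_arr j] [U_arr j, R_arr i]"
| LU: "os_eq_rel [L_arr i, U_arr j] [U_arr j, L_arr i]"
| UU: "os_eq_rel [U_arr i, U_arr j] [U_arr j, U_arr i]"
| RL: "os_eq_rel [R_arr i, L_arr i] [U_arr i]"
| LR: "os_eq_rel [L_arr i, R_arr i] [U_arr i]"
| RR: "\<bar>int i - int j\<bar> > 1 \<Longrightarrow> os_eq_rel [R_arr i, R_arr j] [R_arr j, R_arr i]"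
| LL: "\<bar>int i - int j\<bar> > 1 \<Longrightarrow> os_eq_rel [L_arr i, L_arr j] [L_arr j, L_arr i]"
| LR_far: "\<bar>int i - int j\<bar> > 1 \<Longrightarrow> os_eq_rel [L_arr i, R_arr j] [R_arr j, L_arr i]"

text \<open>The second argument is the source of the path.\<close>

inductive os_zero_rel :: "os_label list \<Rightarrow> nat set \<Rightarrow> bool" where
  RR0: "1 < i \<Longrightarrow> os_zero_rel [R_arr (i - 1), R_arr i] x"
| LL0: "1 < i \<Longrightarrow> os_zero_rel [L_arr i, L_arr (i - 1)] x"
| U0: "x \<inter> {i - 1, i} = {} \<Longrightarrow> os_zero_rel [U_arr i] x"

definition path_labels :: "(nat set \<times> os_label \<times> nat set) list \<Rightarrow> os_label list" where
  "path_labels p = map (\<lambda>(x, l, y). l) p"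

definition os_relations ::
  "nat \<Rightarrow> nat \<Rightarrow> ((nat set, nat set \<times> os_label \<times> nat set) path \<Rightarrow>\<^sub>0 int) set" where
  "os_relations n k =
     {Poly_Mapping.single (x, p, y) 1 - Poly_Mapping.single (x, q, y) 1 | x p q y.
        (x, p, y) \<in> quiver_paths (os_quiver n k) \<and> (x, q, y) \<in> quiver_paths (os_quiver n k) \<and>
        os_eq_rel (path_labels p) (path_labels q)} \<union>
     {Poly_Mapping.single (x, p, y) 1 | x p y.
        (x, p, y) \<in> quiver_paths (os_quiver n k) \<and> os_zero_rel (path_labels p) x}"

definition os_ideal ::
  "nat \<Rightarrow> nat \<Rightarrow> ((nat set, nat set \<times> os_label \<times> nat set) path \<Rightarrow>\<^sub>0 int) set" where
  "os_ideal n k = genideal (path_algebra (os_quiver n k)) (os_relations n k)"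

definition os_algebra ::
  "nat \<Rightarrow> nat \<Rightarrow> ((nat set, nat set \<times> os_label \<times> nat set) path \<Rightarrow>\<^sub>0 int) set ring" where
  "os_algebra n k = path_algebra (os_quiver n k) Quot os_ideal n k"

definition os_idem ::
  "nat \<Rightarrow> nat \<Rightarrow> nat set \<Rightarrow> ((nat set, nat set \<times> os_label \<times> nat set) path \<Rightarrow>\<^sub>0 int) set" where
  "os_idem n k x =
     os_ideal n k +>\<^bsub>path_algebra (os_quiver n k)\<^esub> Poly_Mapping.single (x, [], x) 1"

text \<open>
  The direct sum of the subgroups \<open>I\<^sub>x B I\<^sub>y\<close> of \<open>B = os_algebra n k\<close> over \<open>x\<close> and \<open>y\<close> in \<open>W\<close>, a
  (usually non-unital) subring of \<open>B\<close> with its own unit.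
\<close>

definition os_corner ::
  "nat \<Rightarrow> nat \<Rightarrow> nat set set \<Rightarrow>
   ((nat set, nat set \<times> os_label \<times> nat set) path \<Rightarrow>\<^sub>0 int) set ring" where
  "os_corner n k W = (os_algebra n k)
     \<lparr>carrier := {finsum (os_algebra n k)
          (\<lambda>(x, y). os_idem n k x \<otimes>\<^bsub>os_algebra n k\<^esub> b (x, y) \<otimes>\<^bsub>os_algebra n k\<^esub> os_idem n k y) (W \<times> W)
          | b. b \<in> W \<times> W \<rightarrow> carrier (os_algebra n k)},
      one := finsum (os_algebra n k) (os_idem n k) W\<rparr>"

definition os_algebra_l ::
  "nat \<Rightarrow> nat \<Rightarrow> ((nat set, nat set \<times> os_label \<times> nat set) path \<Rightarrow>\<^sub>0 int) set ring" where
  "os_algebra_l n k = os_corner n k (os_states {0..<n} k)"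

definition os_algebra_r ::
  "nat \<Rightarrow> nat \<Rightarrow> ((nat set, nat set \<times> os_label \<times> nat set) path \<Rightarrow>\<^sub>0 int) set ring" where
  "os_algebra_r n k = os_corner n k (os_states {1..n} k)"

definition os_algebra' ::
  "nat \<Rightarrow> nat \<Rightarrow> ((nat set, nat set \<times> os_label \<times> nat set) path \<Rightarrow>\<^sub>0 int) set ring" where
  "os_algebra' n k = os_corner n k (os_states {1..<n} k)"

end

theory Submission
  imports Defs
begin

text \<open>
  Both algebras have bases in which a product of basis elements is a basis element or zero. A state,
  i.e. a \<open>k\<close>-subset \<open>x\<close> of \<open>{0, \<dots>, n}\<close>, is sent to the sign sequence that changes sign exactly at the elements
  of \<open>x\<close> (starting from a plus sign in front of the first coordinate). Positivity fixes the signs of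
  every vertex \<open>H\<^sub>I\<close> of the arrangement, \<open>card I = k\<close>, and a polyhedron
  \<open>\<Delta>\<^sub>\<alpha> \<inter> \<Delta>\<^sub>\<beta> \<inter> H\<^sub>S\<close> is nonempty iff it contains a vertex; so \<open>u\<^sub>S f\<^bsub>\<alpha>,\<beta>\<^esub>\<close> is nonzero iff \<open>S\<close> is contained
  in a set \<open>I\<close> of gaps that can be matched with the points of both states.

  On the other side, every path has a weight in which \<open>R\<^sub>i\<close> and \<open>L\<^sub>i\<close> count once and \<open>U\<^sub>i\<close> counts twice.
  Modulo the relations, paths with the same endpoints and the same weight agree if the support of the
  weight is contained in a matched set of gaps, and vanish otherwise: when no matching exists, Hall's
  obstruction is an interval of gaps \<open>a, \<dots>, b\<close> whose points are occupied except for the two ends,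
  and it can be shrunk by commuting an arrow at \<open>a\<close> or \<open>b\<close> to the front. Since weights add under
  composition, sending a path of weight \<open>w\<close> to the monomial with exponents \<open>\<lfloor>w/2\<rfloor>\<close> is multiplicative
  and induces the isomorphism.
\<close>

section \<open>Path algebras are rings\<close>

text \<open>Neither algebra is mapped to the other directly. Both are quotients of the integral span
  of the paths with ends in the chosen set of states, so the isomorphism amounts to the equality of
  two kernels. The hard inclusion, that a combination of paths with vanishing image lies in the
  relation ideal, is what forces the study of rewriting paths. Halving the weight loses nothing,
  because its parity at a gap is determined by the two ends; when two odd weights are added, the
  carry is exactly the monomial that the convolution product inserts. Positivity alone fixes the
  signs at the vertices only up to one global sign, which is why the orientation of \<eta> enters.
  The three statements differ only in the set of states: a feasible sign sequence is excluded by a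
  direction in \<open>V\<close> with \<open>k - 1\<close> zeros and alternating signs, and is shown
  to be bounded or compact by the alternating linear relation among \<open>k + 1\<close> columns of
  a positive frame.\<close>

lemma frag_cmul_frag_of: "frag_cmul c (frag_of t) = Poly_Mapping.single t c"
  by (rule poly_mapping_eqI) (simp add: lookup_single)

lemma frag_extend_fun_add:
  "frag_extend (\<lambda>a. F a + G a) f = frag_extend F f + frag_extend G f"
  by (simp add: frag_extend_def sum.distrib frag_cmul_distrib2)

lemma frag_extend_fun_diff:
  "frag_extend (\<lambda>a. F a - G a) f = frag_extend F f - frag_extend G f"
  using frag_extend_fun_add[of "\<lambda>a. F a - G a" G f] by simp

lemma frag_extend_fun_zero: "frag_extend (\<lambda>a. 0) f = 0"
  by (simp add: frag_extend_def)

definition path_comp :: "('v, 'e) path \<Rightarrow> ('v, 'e) path \<Rightarrow> ('v, 'e) path \<Rightarrow>\<^sub>0 int" where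
  "path_comp s t = (case s of (x, p, y) \<Rightarrow> case t of (x', q, z) \<Rightarrow>
     if y = x' then frag_of (x, p @ q, z) else 0)"

text \<open>The product of \<open>path_algebra\<close> sums over the keys of both factors, where
  additivity is hidden because the key sets change. Extending \<open>path_comp\<close> bilinearly by
  \<open>frag_extend\<close> reduces every identity to single paths and removes the quiver from the
  formula.\<close>

definition path_mult ::
  "(('v, 'e) path \<Rightarrow>\<^sub>0 int) \<Rightarrow> (('v, 'e) path \<Rightarrow>\<^sub>0 int) \<Rightarrow> (('v, 'e) path \<Rightarrow>\<^sub>0 int)" where
  "path_mult f g = frag_extend (\<lambda>s. frag_extend (path_comp s) g) f"

lemma mult_path_algebra: "monoid.mult (path_algebra G) = path_mult"
proof (intro ext)
  fix f g :: "('a, 'b) path \<Rightarrow>\<^sub>0 int"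
  have "path_mult f g = (\<Sum>s\<in>Poly_Mapping.keys f. \<Sum>t\<in>Poly_Mapping.keys g.
      frag_cmul (Poly_Mapping.lookup f s) (frag_cmul (Poly_Mapping.lookup g t) (path_comp s t)))"
    by (simp add: path_mult_def frag_extend_def frag_cmul_sum)
  also have "\<dots> = (\<Sum>(x, p, y)\<in>Poly_Mapping.keys f. \<Sum>(x', q, z)\<in>Poly_Mapping.keys g.
        if y = x' then
          Poly_Mapping.single (x, p @ q, z)
            (Poly_Mapping.lookup f (x, p, y) * Poly_Mapping.lookup g (x', q, z))
        else 0)"
    by (intro sum.cong refl) (auto simp: path_comp_def frag_cmul_frag_of intro!: sum.cong)
  finally show "f \<otimes>\<^bsub>path_algebra G\<^esub> g = path_mult f g"
    by (simp add: path_algebra_def)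
qed

lemma path_mult_add_left: "path_mult (f + g) h = path_mult f h + path_mult g h"
  and path_mult_diff_left: "path_mult (f - g) h = path_mult f h - path_mult g h"
  and path_mult_zero_left [simp]: "path_mult 0 h = 0"
  by (simp_all add: path_mult_def frag_extend_add frag_extend_diff)

lemma path_mult_add_right: "path_mult h (f + g) = path_mult h f + path_mult h g"
  and path_mult_diff_right: "path_mult h (f - g) = path_mult h f - path_mult h g"
  and path_mult_zero_right [simp]: "path_mult h 0 = 0"
  by (simp_all add: path_mult_def frag_extend_add frag_extend_diff
      frag_extend_fun_add frag_extend_fun_diff frag_extend_fun_zero)

lemma path_mult_sum_left: "path_mult (sum f A) h = (\<Sum>a\<in>A. path_mult (f a) h)"
  by (induct A rule: infinite_finite_induct) (simp_all add: path_mult_add_left)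

lemma path_mult_sum_right: "path_mult h (sum f A) = (\<Sum>a\<in>A. path_mult h (f a))"
  by (induct A rule: infinite_finite_induct) (simp_all add: path_mult_add_right)

lemma path_mult_frag_of:
  "path_mult (frag_of (x, p, y)) (frag_of (x', q, z)) =
     (if y = x' then frag_of (x, p @ q, z) else 0)"
  by (simp add: path_mult_def path_comp_def)

lemma path_mult_assoc: "path_mult (path_mult f g) h = path_mult f (path_mult g h)"
proof (rule frag_induction[of f UNIV])
  fix s :: "('a, 'b) path"
  show "path_mult (path_mult (frag_of s) g) h = path_mult (frag_of s) (path_mult g h)"
  proof (rule frag_induction[of g UNIV])
    fix t :: "('a, 'b) path"
    show "path_mult (path_mult (frag_of s) (frag_of t)) h = path_mult (frag_of s) (path_mult (frag_of t) h)"
    proof (rule frag_induction[of h UNIV])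
      fix u :: "('a, 'b) path"
      show "path_mult (path_mult (frag_of s) (frag_of t)) (frag_of u) =
        path_mult (frag_of s) (path_mult (frag_of t) (frag_of u))"
        by (cases s, cases t, cases u) (simp add: path_mult_frag_of)
    qed (simp_all add: path_mult_diff_right)
  qed (simp_all add: path_mult_diff_right path_mult_diff_left)
qed (simp_all add: path_mult_diff_left)

lemma keys_path_mult:
  "Poly_Mapping.keys (path_mult f g) \<subseteq>
     {(x, p @ q, z) | x p y q z. (x, p, y) \<in> Poly_Mapping.keys f \<and> (y, q, z) \<in> Poly_Mapping.keys g}"
proof
  fix t assume "t \<in> Poly_Mapping.keys (path_mult f g)"
  then obtain s where s: "s \<in> Poly_Mapping.keys f"
    "t \<in> Poly_Mapping.keys (frag_extend (path_comp s) g)"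
    using subsetD[OF keys_frag_extend, of t "\<lambda>s. frag_extend (path_comp s) g" f]
    unfolding path_mult_def by auto
  then obtain u where "u \<in> Poly_Mapping.keys g" "t \<in> Poly_Mapping.keys (path_comp s u)"
    using subsetD[OF keys_frag_extend s(2)] by auto
  with s(1) show "t \<in> {(x, p @ q, z) | x p y q z.
      (x, p, y) \<in> Poly_Mapping.keys f \<and> (y, q, z) \<in> Poly_Mapping.keys g}"
    by (cases s, cases u) (auto simp: path_comp_def split: if_splits)
qed

lemma carrier_path_algebra: "carrier (path_algebra G) = {f. Poly_Mapping.keys f \<subseteq> quiver_paths G}"
  and zero_path_algebra: "\<zero>\<^bsub>path_algebra G\<^esub> = 0"
  and add_path_algebra: "add (path_algebra G) = (+)"
  and one_path_algebra: "\<one>\<^bsub>path_algebra G\<^esub> = (\<Sum>x\<in>verts G. frag_of (x, [], x))"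
  by (simp_all add: path_algebra_def)

lemma (in pre_digraph) cas_append:
  "cas x (p @ q) z \<longleftrightarrow> (\<exists>y. cas x p y \<and> cas y q z)"
  by (induct p arbitrary: x) auto

lemma quiver_paths_append:
  assumes "(x, p, y) \<in> quiver_paths G" "(y, q, z) \<in> quiver_paths G"
  shows "(x, p @ q, z) \<in> quiver_paths G"
  using assms by (auto simp: quiver_paths_def pre_digraph.awalk_def pre_digraph.cas_append)

lemma quiver_paths_ends:
  assumes "wf_digraph G" "(x, p, y) \<in> quiver_paths G"
  shows "x \<in> verts G" "y \<in> verts G"
proof -
  show "x \<in> verts G" using assms(2) by (simp add: quiver_paths_def pre_digraph.awalk_def)
  have *: "set p \<subseteq> arcs G \<Longrightarrow> pre_digraph.cas G x p y \<Longrightarrow> x \<in> verts G \<Longrightarrow> y \<in> verts G" for x p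
    by (induct p arbitrary: x) (auto simp: pre_digraph.cas.simps wf_digraph.head_in_verts[OF assms(1)])
  show "y \<in> verts G" using assms(2) * by (auto simp: quiver_paths_def pre_digraph.awalk_def)
qed

lemma path_mult_closed:
  assumes "Poly_Mapping.keys f \<subseteq> quiver_paths G" "Poly_Mapping.keys g \<subseteq> quiver_paths G"
  shows "Poly_Mapping.keys (path_mult f g) \<subseteq> quiver_paths G"
proof
  fix t assume "t \<in> Poly_Mapping.keys (path_mult f g)"
  then obtain x p y q z where "t = (x, p @ q, z)"
    "(x, p, y) \<in> Poly_Mapping.keys f" "(y, q, z) \<in> Poly_Mapping.keys g"
    using keys_path_mult[of f g] by blast
  with assms show "t \<in> quiver_paths G" by (auto intro: quiver_paths_append)
qed

text \<open>Needed for every finite \<open>W\<close> containing the sources: all vertices give the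
  unit of the path algebra, a smaller set gives the unit of a corner.\<close>

lemma path_one_left:
  assumes "finite W" "\<And>x p y. (x, p, y) \<in> Poly_Mapping.keys f \<Longrightarrow> x \<in> W"
  shows "path_mult (\<Sum>x\<in>W. frag_of (x, [], x)) f = f"
proof (rule frag_induction[of f "{(x, p, y). x \<in> W}"])
  show "Poly_Mapping.keys f \<subseteq> {(x, p, y). x \<in> W}" using assms(2) by auto
  fix t :: "('a, 'b) path" assume "t \<in> {(x, p, y). x \<in> W}"
  then show "path_mult (\<Sum>x\<in>W. frag_of (x, [], x)) (frag_of t) = frag_of t"
    using assms(1) by (cases t) (simp add: path_mult_sum_left path_mult_frag_of)
qed (simp_all add: path_mult_diff_right)

lemma path_one_right:
  assumes "finite W" "\<And>x p y. (x, p, y) \<in> Poly_Mapping.keys f \<Longrightarrow> y \<in> W"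
  shows "path_mult f (\<Sum>x\<in>W. frag_of (x, [], x)) = f"
proof (rule frag_induction[of f "{(x, p, y). y \<in> W}"])
  show "Poly_Mapping.keys f \<subseteq> {(x, p, y). y \<in> W}" using assms(2) by auto
  fix t :: "('a, 'b) path" assume "t \<in> {(x, p, y). y \<in> W}"
  then show "path_mult (frag_of t) (\<Sum>x\<in>W. frag_of (x, [], x)) = frag_of t"
    using assms(1) by (cases t) (simp add: path_mult_sum_right path_mult_frag_of)
qed (simp_all add: path_mult_diff_left)

lemma ring_path_algebra:
  assumes "wf_digraph G" "finite (verts G)"
  shows "ring (path_algebra G)"
proof (rule ringI)
  show "abelian_group (path_algebra G)"
  proof (rule abelian_groupI)
    show "x \<oplus>\<^bsub>path_algebra G\<^esub> y \<in> carrier (path_algebra G)"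
      if "x \<in> carrier (path_algebra G)" "y \<in> carrier (path_algebra G)" for x y
      using that keys_add[of x y] by (auto simp: carrier_path_algebra add_path_algebra)
    show "\<exists>y\<in>carrier (path_algebra G). y \<oplus>\<^bsub>path_algebra G\<^esub> x = \<zero>\<^bsub>path_algebra G\<^esub>"
      if "x \<in> carrier (path_algebra G)" for x
      using that by (intro bexI[of _ "- x"])
        (simp_all add: carrier_path_algebra add_path_algebra zero_path_algebra)
  qed (auto simp: carrier_path_algebra add_path_algebra zero_path_algebra)
  have 1: "Poly_Mapping.keys (\<Sum>x\<in>verts G. frag_of (x, [] :: 'b list, x)) \<subseteq> quiver_paths G"
    by (rule order_trans[OF keys_sum])
      (auto simp: quiver_paths_def pre_digraph.awalk_def pre_digraph.cas.simps)
  show "monoid (path_algebra G)"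
  proof (rule monoidI)
    fix f assume f: "f \<in> carrier (path_algebra G)"
    show "\<one>\<^bsub>path_algebra G\<^esub> \<otimes>\<^bsub>path_algebra G\<^esub> f = f"
      using f quiver_paths_ends(1)[OF assms(1)]
      by (auto simp: mult_path_algebra one_path_algebra carrier_path_algebra
          intro!: path_one_left assms)
    show "f \<otimes>\<^bsub>path_algebra G\<^esub> \<one>\<^bsub>path_algebra G\<^esub> = f"
      using f quiver_paths_ends(2)[OF assms(1)]
      by (auto simp: mult_path_algebra one_path_algebra carrier_path_algebra
          intro!: path_one_right assms)
    show "f \<otimes>\<^bsub>path_algebra G\<^esub> g \<in> carrier (path_algebra G)"
      if "g \<in> carrier (path_algebra G)" for g
      using f that path_mult_closed[of f G g] by (simp add: mult_path_algebra carrier_path_algebra)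
  qed (use 1 in \<open>simp_all add: mult_path_algebra carrier_path_algebra one_path_algebra path_mult_assoc\<close>)
qed (simp_all add: mult_path_algebra add_path_algebra path_mult_add_left path_mult_add_right)

section \<open>States and gaps\<close>

text \<open>Applied to a state, this counts the points to the left of coordinate \<open>j\<close>,
  whose sign in the region of the state is given by the parity of this number. Applied to a set of
  gaps, it counts the zeros of a vertex before coordinate \<open>j\<close>.\<close>

definition height :: "nat set \<Rightarrow> nat \<Rightarrow> nat" where
  "height x j = card {a \<in> x. a < j}"

lemma height_0 [simp]: "height x 0 = 0"
  by (simp add: height_def)

lemma height_Suc: "height x (Suc j) = height x j + of_bool (j \<in> x)"
proof (cases "j \<in> x")
  case True
  then have "{a \<in> x. a < Suc j} = insert j {a \<in> x. a < j}" by auto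
  then show ?thesis using True by (simp add: height_def)
next
  case False
  then have "{a \<in> x. a < Suc j} = {a \<in> x. a < j}" using less_Suc_eq by auto
  then show ?thesis using False by (simp add: height_def)
qed

lemma height_top: "x \<subseteq> {..<j} \<Longrightarrow> height x j = card x"
  unfolding height_def by (rule arg_cong[where f = card]) auto

lemma height_inj: "height x = height y \<Longrightarrow> x = y"
proof (rule Set.set_eqI)
  fix j assume "height x = height y"
  then have "height x (Suc j) = height y (Suc j)" "height x j = height y j" by simp_all
  then show "j \<in> x \<longleftrightarrow> j \<in> y" by (simp add: height_Suc of_bool_def split: if_splits)
qed

lemma height_add: "height x (j + m) = height x j + card (x \<inter> {j..<j + m})"
  by (induct m) (auto simp: height_Suc atLeastLessThanSuc)

text \<open>
  The gap \<open>i\<close> lies between the points \<open>i - 1\<close> and \<open>i\<close>. A set \<open>I\<close> of gaps matches the state \<open>x\<close> if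
  the points of \<open>x\<close> can be assigned bijectively to adjacent gaps in \<open>I\<close>; the parity condition below is
  the statement that the vertex \<open>H\<^sub>I\<close> of the arrangement lies in the region of \<open>x\<close>.
\<close>

definition matching :: "nat \<Rightarrow> nat set \<Rightarrow> nat set \<Rightarrow> bool" where
  "matching n x I \<longleftrightarrow> I \<subseteq> {1..n} \<and> card I = card x \<and>
     (\<forall>j\<in>{1..n} - I. even (height x j) \<longleftrightarrow> even (height I j))"

text \<open>Walking from left to right, \<open>height x\<close> rises by at most one per step. At a
  gap of \<open>I\<close> the bound rises as well; off \<open>I\<close> equal parities rule out a
  surplus of one. States and gap sets of different sizes can be compared in this way, which the
  criterion for feasibility relies on.\<close>

lemma parity_bound:
  assumes "height x 0 \<le> height I (Suc 0)"
    and par: "\<And>j. j \<in> {1..m} - I \<Longrightarrow> even (height x j) \<longleftrightarrow> even (height I j)"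
    and "j \<le> m"
  shows "height x j \<le> height I (Suc j)"
  using \<open>j \<le> m\<close>
proof (induct j)
  case 0 then show ?case using assms(1) by simp
next
  case (Suc j)
  then have IH: "height x j \<le> height I (Suc j)" by simp
  show ?case
  proof (cases "Suc j \<in> I")
    case True
    then show ?thesis using IH by (simp add: height_Suc)
  next
    case False
    then have "even (height x (Suc j)) \<longleftrightarrow> even (height I (Suc j))"
      using par[of "Suc j"] Suc.prems by simp
    moreover have "height x (Suc j) \<le> Suc (height I (Suc j))"
      using IH by (simp add: height_Suc[of x])
    ultimately have "height x (Suc j) \<le> height I (Suc j)"
      by (metis even_Suc le_SucE)
    then show ?thesis using False by (simp add: height_Suc[of I "Suc j"])
  qed
qed

text \<open>The upper bound propagates from the left end by \<open>parity_bound\<close>, the lower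
  one from the right end, where equal cardinalities make both heights agree. At a gap of
  \<open>I\<close> the difference tells on which side its point lies: 1 for the left, 0 for the
  right.\<close>

lemma matching_height:
  assumes x: "x \<subseteq> {0..n}" and m: "matching n x I" and j: "j \<le> Suc n"
  shows "height I j \<le> height x j" "height x j \<le> height I j + of_bool (j \<in> I)"
proof -
  have I: "I \<subseteq> {1..n}" and c: "card I = card x"
    and par: "\<And>j. j \<in> {1..n} - I \<Longrightarrow> even (height x j) \<longleftrightarrow> even (height I j)"
    using m by (auto simp: matching_def)
  have hx: "height x (Suc n) = card x" and hI: "height I (Suc n) = card I"
    using x I by (auto intro!: height_top)
  have nI: "Suc n \<notin> I" using I by auto
  show "height x j \<le> height I j + of_bool (j \<in> I)"
  proof (cases "j = Suc n")
    case True then show ?thesis using hx hI c by simp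
  next
    case False
    then have "height x j \<le> height I (Suc j)" using j by (intro parity_bound[where m = n and I = I and j = j] par) auto
    then show ?thesis by (simp add: height_Suc)
  qed
  show "height I j \<le> height x j"
    using j
  proof (induct rule: inc_induct)
    case base then show ?case using hx hI c by simp
  next
    case (step j)
    show ?case
    proof (cases "j \<in> I")
      case True
      then show ?thesis using step(3) by (simp add: height_Suc of_bool_def split: if_splits)
    next
      case False
      show ?thesis
      proof (cases "j = 0")
        case False
        then have "even (height x j) \<longleftrightarrow> even (height I j)"
          using par[of j] \<open>j \<notin> I\<close> step(1,2) by simp
        moreover have "height I j \<le> Suc (height x j)"
          using step(3) \<open>j \<notin> I\<close> by (simp add: height_Suc of_bool_def split: if_splits)
        ultimately show ?thesis by (metis even_Suc le_SucE)
      qed simp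
    qed
  qed
qed

lemma matchingI_height:
  assumes "I \<subseteq> {1..n}" "card I = card x"
    and "\<And>j. j \<in> {1..n} \<Longrightarrow> height I j \<le> height x j \<and> height x j \<le> height I j + of_bool (j \<in> I)"
  shows "matching n x I"
proof -
  have "height x j = height I j" if "j \<in> {1..n} - I" for j
    using assms(3)[of j] that by simp
  then show ?thesis using assms(1,2) by (simp add: matching_def)
qed

section \<open>Moving a point across a gap\<close>

definition flippable :: "nat \<Rightarrow> nat \<Rightarrow> nat set \<Rightarrow> bool" where
  "flippable n i x \<longleftrightarrow> 1 \<le> i \<and> i \<le> n \<and> (i - 1 \<in> x \<longleftrightarrow> i \<notin> x)"

text \<open>Exchanging the two memberships treats moves to the right and to the left alike and makes
  the move an involution; at a flippable gap exactly one point moves.\<close>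

definition flip :: "nat \<Rightarrow> nat set \<Rightarrow> nat set" where
  "flip i x = (x - {i - 1, i}) \<union> ({i - 1, i} - x)"

lemma in_flip: "a \<in> flip i x \<longleftrightarrow> (if a = i - 1 \<or> a = i then a \<notin> x else a \<in> x)"
  by (auto simp: flip_def)

lemma flip_flip [simp]: "flip i (flip i x) = x"
  by (auto simp: flip_def)

lemma flippable_flip [simp]: "flippable n i (flip i x) \<longleftrightarrow> flippable n i x"
  by (auto simp: flippable_def in_flip)

lemma flip_commute: "flip i (flip j x) = flip j (flip i x)"
  by (auto simp: in_flip)

lemma flippable_far:
  assumes "flippable n j x" "i \<noteq> j" "i \<noteq> j + 1" "j \<noteq> i + 1"
  shows "flippable n i (flip j x) \<longleftrightarrow> flippable n i x"
proof (cases "1 \<le> i")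
  case True
  moreover have "1 \<le> j" using assms(1) by (simp add: flippable_def)
  ultimately have "i - 1 \<noteq> j" "i - 1 \<noteq> j - 1" "i \<noteq> j - 1" using assms(2-4) by linarith+
  then show ?thesis using assms(2) by (simp add: flippable_def in_flip)
qed (simp add: flippable_def)

lemma card_flip: "flippable n i x \<Longrightarrow> finite x \<Longrightarrow> card (flip i x) = card x"
proof -
  assume f: "flippable n i x" "finite x"
  have "flip i x = insert i (x - {i - 1}) \<and> i - 1 \<in> x \<and> i \<notin> x \<or> flip i x = insert (i - 1) (x - {i}) \<and> i \<in> x \<and> i - 1 \<notin> x"
    using f(1) by (auto simp: flippable_def flip_def)
  moreover have "card x > 0" using f by (auto simp: flippable_def card_gt_0_iff)
  ultimately show ?thesis using f(2) by (auto simp: card_insert_if)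
qed

lemma flip_state: "flippable n i x \<Longrightarrow> x \<in> os_states {0..n} k \<Longrightarrow> flip i x \<in> os_states {0..n} k"
  using card_flip[of n i x] finite_subset[of x "{0..n}"]
  by (auto simp: os_states_def flippable_def flip_def)

lemma height_flip:
  assumes "flippable n i x"
  shows "j \<noteq> i \<Longrightarrow> height (flip i x) j = height x j"
    and "i \<in> x \<Longrightarrow> height (flip i x) i = Suc (height x i)"
    and "i \<notin> x \<Longrightarrow> Suc (height (flip i x) i) = height x i"
proof -
  obtain i' where i: "i = Suc i'" using assms by (cases i) (auto simp: flippable_def)
  have lt: "height (flip i x) j = height x j" if "j \<le> i'" for j
    using that by (induct j) (auto simp: height_Suc in_flip i)
  show 1: "i \<in> x \<Longrightarrow> height (flip i x) i = Suc (height x i)"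
    and 2: "i \<notin> x \<Longrightarrow> Suc (height (flip i x) i) = height x i"
    using lt[of i'] assms by (auto simp: height_Suc i in_flip flippable_def)
  have ge: "height (flip i x) (Suc i + m) = height x (Suc i + m)" for m
  proof (induct m)
    case 0 show ?case using 1 2 by (cases "i \<in> x") (auto simp: height_Suc in_flip)
  qed (auto simp: height_Suc in_flip)
  show "height (flip i x) j = height x j" if "j \<noteq> i"
  proof (cases "j \<le> i'")
    case False
    then have "j = Suc i + (j - Suc i)" using that i by simp
    then show ?thesis using ge[of "j - Suc i"] by simp
  qed (rule lt)
qed

lemma height_flip_parity:
  assumes "flippable n i x"
  shows "even (height (flip i x) j) \<longleftrightarrow> (even (height x j) \<longleftrightarrow> j \<noteq> i)"
proof (cases "j = i")
  case True
  show ?thesis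
  proof (cases "i \<in> x")
    case i: True
    show ?thesis using height_flip(2)[OF assms i] True by simp
  next
    case False
    show ?thesis using height_flip(3)[OF assms False] True by (metis even_Suc)
  qed
qed (simp add: height_flip(1)[OF assms])

text \<open>A move across \<open>i\<close> changes the height at \<open>i\<close> only, and a gap of
  \<open>I\<close> is exempt from the parity condition.\<close>

lemma matching_flip:
  assumes "flippable n i x" "finite x" "i \<in> I"
  shows "matching n (flip i x) I \<longleftrightarrow> matching n x I"
proof -
  have "even (height (flip i x) j) \<longleftrightarrow> even (height x j)" if "j \<in> {1..n} - I" for j
    using that assms(3) height_flip_parity[OF assms(1), of j] by auto
  then show ?thesis using card_flip[OF assms(1,2)] by (auto simp: matching_def)
qed

text \<open>Counting: the \<open>b - a + 1\<close> gaps of the interval touch only the points from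
  \<open>a - 1\<close> to \<open>b\<close>, and with both ends vacant at most \<open>b - a\<close>
  of these are occupied. The height bounds turn this into a contradiction.\<close>

lemma not_matching_block:
  assumes x: "x \<subseteq> {0..n}" and m: "matching n x I"
    and ab: "1 \<le> a" "a \<le> b" "b \<le> n" "{a..b} \<subseteq> I" and e: "a - 1 \<notin> x" "b \<notin> x"
  shows False
proof -
  obtain a' where a': "a = Suc a'" using ab(1) by (cases a) auto
  have 1: "height x a' \<le> height I (Suc a')"
    using matching_height(2)[OF x m, of a'] ab a' by (simp add: height_Suc)
  have 2: "height I (Suc b) \<le> height x (Suc b)"
    using matching_height(1)[OF x m, of "Suc b"] ab by simp
  have "height I (Suc b) = height I a + card (I \<inter> {a..<a + (Suc b - a)})"
    using height_add[of I a "Suc b - a"] ab by simp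
  moreover have "I \<inter> {a..<a + (Suc b - a)} = {a..b}" using ab by auto
  ultimately have 3: "height I (Suc b) = height I a + (Suc b - a)" by simp
  have "height x b = height x a + card (x \<inter> {a..<a + (b - a)})"
    using height_add[of x a "b - a"] ab by simp
  moreover have "card (x \<inter> {a..<a + (b - a)}) \<le> card {a..<a + (b - a)}" by (rule card_mono) auto
  ultimately have "height x (Suc b) \<le> height x a + (b - a)" using e by (simp add: height_Suc)
  moreover have "height x a = height x a'" using e a' by (simp add: height_Suc)
  ultimately show False using 1 2 3 ab a' by simp
qed

section \<open>Congruence of paths\<close>

abbreviation os_paths where "os_paths n k \<equiv> quiver_paths (os_quiver n k)"

text \<open>Occupation of the point \<open>i\<close> decides between \<open>R_arr\<close> and
  \<open>L_arr\<close>, so that later arguments need not distinguish the two directions.\<close>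

definition F_arc :: "nat \<Rightarrow> nat set \<Rightarrow> nat set \<times> os_label \<times> nat set" where
  "F_arc i x = (x, if i \<in> x then L_arr i else R_arr i, flip i x)"

definition U_arc :: "nat \<Rightarrow> nat set \<Rightarrow> nat set \<times> os_label \<times> nat set" where
  "U_arc i x = (x, U_arr i, x)"

lemma os_step_iff:
  "os_step n k i x y \<longleftrightarrow> x \<in> os_states {0..n} k \<and> flippable n i x \<and> i \<notin> x \<and> y = flip i x"
proof -
  have "x \<inter> {i - 1, i} = {i - 1} \<longleftrightarrow> i - 1 \<in> x \<and> i \<notin> x" if "1 \<le> i"
    using that by (cases i) (auto simp: set_eq_iff, metis n_not_Suc_n)
  moreover have "(x - {i - 1}) \<union> {i} = flip i x" if "i - 1 \<in> x" "i \<notin> x" using that by (auto simp: flip_def)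
  ultimately show ?thesis by (auto simp: os_step_def flippable_def)
qed

lemma finite_os_states [simp]: "finite J \<Longrightarrow> finite (os_states J k)"
  by (simp add: os_states_def)

lemma os_state_subset: "x \<in> os_states J k \<Longrightarrow> x \<subseteq> J"
  and os_state_card: "x \<in> os_states J k \<Longrightarrow> card x = k"
  by (simp_all add: os_states_def)

lemma os_state_finite: "x \<in> os_states {0..n} k \<Longrightarrow> finite x"
  using finite_subset[OF os_state_subset] by blast

lemma arcs_os_quiver:
  "arcs (os_quiver n k) =
     {F_arc i x | i x. x \<in> os_states {0..n} k \<and> flippable n i x} \<union>
     {U_arc i x | i x. x \<in> os_states {0..n} k \<and> 1 \<le> i \<and> i \<le> n}" (is "_ = ?F \<union> ?U")
proof -
  have "{(x, R_arr i, y) | x i y. os_step n k i x y} \<union> {(y, L_arr i, x) | x i y. os_step n k i x y} = ?F"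
  proof (intro equalityI subsetI)
    fix a assume "a \<in> ?F"
    then obtain i x where a: "a = F_arc i x" "x \<in> os_states {0..n} k" "flippable n i x" by blast
    show "a \<in> {(x, R_arr i, y) | x i y. os_step n k i x y} \<union> {(y, L_arr i, x) | x i y. os_step n k i x y}"
    proof (cases "i \<in> x")
      case True
      then have "os_step n k i (flip i x) x"
        using a flip_state by (auto simp: os_step_iff in_flip)
      then show ?thesis using a True by (auto simp: F_arc_def)
    next
      case False
      then show ?thesis using a by (auto simp: F_arc_def os_step_iff)
    qed
  next
    fix a assume "a \<in> {(x, R_arr i, y) | x i y. os_step n k i x y} \<union> {(y, L_arr i, x) | x i y. os_step n k i x y}"
    then consider x i where "a = (x, R_arr i, flip i x)" "x \<in> os_states {0..n} k" "flippable n i x" "i \<notin> x"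
      | x i where "a = (flip i x, L_arr i, x)" "x \<in> os_states {0..n} k" "flippable n i x" "i \<notin> x"
      by (auto simp: os_step_iff)
    then show "a \<in> ?F"
    proof cases
      case 1 then show ?thesis by (auto simp: F_arc_def)
    next
      case 2
      then have "a = F_arc i (flip i x)" "flip i x \<in> os_states {0..n} k" "flippable n i (flip i x)"
        using flip_state by (auto simp: F_arc_def in_flip)
      then show ?thesis by blast
    qed
  qed
  then show ?thesis by (auto simp: os_quiver_def U_arc_def)
qed

lemma os_quiver_simps [simp]:
  "verts (os_quiver n k) = os_states {0..n} k"
  "tail (os_quiver n k) a = fst a" "head (os_quiver n k) a = snd (snd a)"
  by (simp_all add: os_quiver_def split_beta)

lemma arc_simps [simp]:
  "fst (F_arc i x) = x" "snd (snd (F_arc i x)) = flip i x"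
  "fst (U_arc i x) = x" "snd (snd (U_arc i x)) = x"
  by (simp_all add: F_arc_def U_arc_def)

lemma wf_os_quiver: "wf_digraph (os_quiver n k)"
  by unfold_locales (auto simp: arcs_os_quiver intro: flip_state)

lemma os_paths_Nil [simp]: "(x, [], y) \<in> os_paths n k \<longleftrightarrow> x = y \<and> x \<in> os_states {0..n} k"
  by (auto simp: quiver_paths_def pre_digraph.awalk_def pre_digraph.cas.simps)

lemma os_paths_Cons:
  "(x, a # p, y) \<in> os_paths n k \<longleftrightarrow>
     x \<in> os_states {0..n} k \<and> a \<in> arcs (os_quiver n k) \<and> fst a = x \<and> (snd (snd a), p, y) \<in> os_paths n k"
  using wf_digraph.head_in_verts[OF wf_os_quiver, of a n k]
  by (auto simp: quiver_paths_def pre_digraph.awalk_def pre_digraph.cas.simps)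

lemma F_arc_in_arcs: "F_arc i x \<in> arcs (os_quiver n k) \<longleftrightarrow> x \<in> os_states {0..n} k \<and> flippable n i x"
proof
  assume "F_arc i x \<in> arcs (os_quiver n k)"
  then obtain j z where *: "z \<in> os_states {0..n} k" "flippable n j z" "F_arc i x = F_arc j z"
    by (auto simp: arcs_os_quiver F_arc_def U_arc_def split: if_splits)
  then show "x \<in> os_states {0..n} k \<and> flippable n i x"
    by (auto simp: F_arc_def split: if_splits)
qed (auto simp: arcs_os_quiver)

lemma U_arc_in_arcs: "U_arc i x \<in> arcs (os_quiver n k) \<longleftrightarrow> x \<in> os_states {0..n} k \<and> 1 \<le> i \<and> i \<le> n"
  by (auto simp: arcs_os_quiver F_arc_def U_arc_def split: if_splits)

lemma os_paths_F [simp]: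
  "(x, F_arc i z # p, y) \<in> os_paths n k \<longleftrightarrow> x \<in> os_states {0..n} k \<and> x = z \<and> flippable n i x \<and> (flip i x, p, y) \<in> os_paths n k"
  and os_paths_U [simp]:
  "(x, U_arc i z # p, y) \<in> os_paths n k \<longleftrightarrow> x = z \<and> 1 \<le> i \<and> i \<le> n \<and> (x, p, y) \<in> os_paths n k"
  using quiver_paths_ends[OF wf_os_quiver, of x p y n k]
  by (auto simp: os_paths_Cons F_arc_in_arcs U_arc_in_arcs)

lemma os_paths_Cons_cases:
  assumes "(x, a # p, y) \<in> os_paths n k"
  obtains (F) i where "a = F_arc i x" "flippable n i x" "(flip i x, p, y) \<in> os_paths n k" "x \<in> os_states {0..n} k"
    | (U) i where "a = U_arc i x" "1 \<le> i" "i \<le> n" "(x, p, y) \<in> os_paths n k" "x \<in> os_states {0..n} k"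
proof -
  have "x \<in> os_states {0..n} k" using quiver_paths_ends[OF wf_os_quiver assms] by simp
  moreover have "a \<in> arcs (os_quiver n k)" "fst a = x" "(snd (snd a), p, y) \<in> os_paths n k"
    using assms by (simp_all add: os_paths_Cons)
  ultimately show ?thesis using F U by (auto simp: arcs_os_quiver)
qed

text \<open>Twice the exponent of \<open>u\<^sub>j\<close>: the weight turns composition of paths into addition.\<close>

primrec label_weight :: "os_label \<Rightarrow> nat \<Rightarrow> nat" where
  "label_weight (R_arr i) j = of_bool (i = j)"
| "label_weight (L_arr i) j = of_bool (i = j)"
| "label_weight (U_arr i) j = 2 * of_bool (i = j)"

definition weight :: "(nat set \<times> os_label \<times> nat set) list \<Rightarrow> nat \<Rightarrow> nat" where
  "weight p j = (\<Sum>a\<leftarrow>p. label_weight (fst (snd a)) j)"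

lemma weight_simps [simp]:
  "weight [] j = 0"
  "weight (F_arc i x # p) j = of_bool (i = j) + weight p j"
  "weight (U_arc i x # p) j = 2 * of_bool (i = j) + weight p j"
  "weight (p @ q) j = weight p j + weight q j"
  by (simp_all add: weight_def F_arc_def U_arc_def)

lemma weight_supp:
  assumes "(x, p, y) \<in> os_paths n k" "weight p j \<noteq> 0"
  shows "j \<in> {1..n}"
  using assms
proof (induct p arbitrary: x)
  case (Cons a p)
  from Cons(2) show ?case
    by (cases rule: os_paths_Cons_cases) (use Cons in \<open>auto simp: flippable_def split: if_splits\<close>)
qed simp

text \<open>Each crossing of \<open>j\<close> changes the parity of the height at \<open>j\<close>,
  and \<open>U_arr j\<close> contributes 2. Hence the ends of a path already determine its weight
  modulo 2.\<close>

lemma weight_parity: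
  assumes "(x, p, y) \<in> os_paths n k"
  shows "even (weight p j) \<longleftrightarrow> (even (height x j) \<longleftrightarrow> even (height y j))"
  using assms
proof (induct p arbitrary: x)
  case (Cons a p)
  from Cons(2) show ?case
  proof (cases rule: os_paths_Cons_cases)
    case (F i)
    then show ?thesis using Cons(1)[of "flip i x"] height_flip_parity[of n i x j] by auto
  next
    case (U i)
    then show ?thesis using Cons(1)[of x] by auto
  qed
qed simp

section \<open>The ideal of relations and congruence modulo it\<close>

lemma ring_os_path_algebra: "ring (path_algebra (os_quiver n k))"
  by (rule ring_path_algebra) (simp_all add: wf_os_quiver)

lemma os_relations_carrier: "os_relations n k \<subseteq> carrier (path_algebra (os_quiver n k))"
proof
  fix f assume "f \<in> os_relations n k"
  then consider x p q y where "f = frag_of (x, p, y) - frag_of (x, q, y)"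
      "(x, p, y) \<in> os_paths n k" "(x, q, y) \<in> os_paths n k"
    | x p y where "f = frag_of (x, p, y)" "(x, p, y) \<in> os_paths n k"
    unfolding os_relations_def by blast
  then show "f \<in> carrier (path_algebra (os_quiver n k))"
  proof cases
    case 1
    then show ?thesis using keys_diff[of "frag_of (x, p, y)" "frag_of (x, q, y)"]
      by (auto simp: carrier_path_algebra)
  qed (auto simp: carrier_path_algebra)
qed

lemma ideal_os_ideal: "ideal (os_ideal n k) (path_algebra (os_quiver n k))"
  unfolding os_ideal_def by (rule ring.genideal_ideal[OF ring_os_path_algebra os_relations_carrier])

lemma os_ideal_add: "f \<in> os_ideal n k \<Longrightarrow> g \<in> os_ideal n k \<Longrightarrow> f + g \<in> os_ideal n k"
  using additive_subgroup.a_closed[OF ideal.axioms(1)[OF ideal_os_ideal], of f n k g]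
  by (simp add: add_path_algebra)

lemma os_ideal_zero: "0 \<in> os_ideal n k"
  using additive_subgroup.zero_closed[OF ideal.axioms(1)[OF ideal_os_ideal], of n k]
  by (simp add: zero_path_algebra)

lemma os_ideal_carrier: "f \<in> os_ideal n k \<Longrightarrow> Poly_Mapping.keys f \<subseteq> os_paths n k"
  using additive_subgroup.a_Hcarr[OF ideal.axioms(1)[OF ideal_os_ideal], of f n k]
  by (simp add: carrier_path_algebra)

lemma os_ideal_mult_left:
  "f \<in> os_ideal n k \<Longrightarrow> Poly_Mapping.keys g \<subseteq> os_paths n k \<Longrightarrow> path_mult g f \<in> os_ideal n k"
  and os_ideal_mult_right:
  "f \<in> os_ideal n k \<Longrightarrow> Poly_Mapping.keys g \<subseteq> os_paths n k \<Longrightarrow> path_mult f g \<in> os_ideal n k"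
  using ideal.I_l_closed[OF ideal_os_ideal, of f n k g] ideal.I_r_closed[OF ideal_os_ideal, of f n k g]
  by (simp_all add: carrier_path_algebra mult_path_algebra)

lemma os_ideal_uminus: "f \<in> os_ideal n k \<Longrightarrow> - f \<in> os_ideal n k"
proof -
  assume f: "f \<in> os_ideal n k"
  have 1: "Poly_Mapping.keys (\<Sum>x\<in>os_states {0..n} k. frag_of (x, [], x)) \<subseteq> os_paths n k"
    by (rule order_trans[OF keys_sum]) auto
  \<comment> \<open>Negation is multiplication by minus the unit.\<close>
  then have "path_mult (- (\<Sum>x\<in>os_states {0..n} k. frag_of (x, [], x))) f \<in> os_ideal n k"
    by (intro os_ideal_mult_left f) simp
  moreover have "path_mult (\<Sum>x\<in>os_states {0..n} k. frag_of (x, [], x)) f = f"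
    using os_ideal_carrier[OF f] quiver_paths_ends(1)[OF wf_os_quiver]
    by (intro path_one_left) (simp, force)
  ultimately show ?thesis
    using path_mult_diff_left[of 0 _ f] by simp
qed

text \<open>Equality of weights is carried along with the congruence, so that each rewriting step
  also delivers the weights of the remaining arrows.\<close>

definition path_eq ::
  "nat \<Rightarrow> nat \<Rightarrow> nat set \<Rightarrow> nat set \<Rightarrow> (nat set \<times> os_label \<times> nat set) list \<Rightarrow> (nat set \<times> os_label \<times> nat set) list \<Rightarrow> bool"
  where "path_eq n k x y p q \<longleftrightarrow> (x, p, y) \<in> os_paths n k \<and> (x, q, y) \<in> os_paths n k \<and> weight p = weight q \<and>
     frag_of (x, p, y) - frag_of (x, q, y) \<in> os_ideal n k"

definition path_null ::
  "nat \<Rightarrow> nat \<Rightarrow> nat set \<Rightarrow> (nat set \<times> os_label \<times> nat set) list \<Rightarrow> nat set \<Rightarrow> bool"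
  where "path_null n k x p y \<longleftrightarrow> (x, p, y) \<in> os_paths n k \<and> frag_of (x, p, y) \<in> os_ideal n k"

lemma path_eq_refl: "(x, p, y) \<in> os_paths n k \<Longrightarrow> path_eq n k x y p p"
  by (simp add: path_eq_def os_ideal_zero)

lemma path_eq_sym: "path_eq n k x y p q \<Longrightarrow> path_eq n k x y q p"
  using os_ideal_uminus by (fastforce simp: path_eq_def)

lemma path_eq_trans [trans]: "path_eq n k x y p q \<Longrightarrow> path_eq n k x y q r \<Longrightarrow> path_eq n k x y p r"
  using os_ideal_add[of "frag_of (x, p, y) - frag_of (x, q, y)" n k "frag_of (x, q, y) - frag_of (x, r, y)"]
  by (simp add: path_eq_def)

lemma path_null_eq: "path_eq n k x y p q \<Longrightarrow> path_null n k x q y \<Longrightarrow> path_null n k x p y"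
  using os_ideal_add[of "frag_of (x, p, y) - frag_of (x, q, y)" n k "frag_of (x, q, y)"]
  by (simp add: path_eq_def path_null_def)

lemma path_eq_prefix:
  assumes "(z, r, x) \<in> os_paths n k" "path_eq n k x y p q"
  shows "path_eq n k z y (r @ p) (r @ q)"
  using assms os_ideal_mult_left[of "frag_of (x, p, y) - frag_of (x, q, y)" n k "frag_of (z, r, x)"]
    quiver_paths_append[OF assms(1)]
  by (auto simp: path_eq_def path_mult_diff_right path_mult_frag_of fun_eq_iff)

lemma path_eq_suffix:
  assumes "(y, r, z) \<in> os_paths n k" "path_eq n k x y p q"
  shows "path_eq n k x z (p @ r) (q @ r)"
  using assms os_ideal_mult_right[of "frag_of (x, p, y) - frag_of (x, q, y)" n k "frag_of (y, r, z)"]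
    quiver_paths_append[OF _ assms(1)]
  by (auto simp: path_eq_def path_mult_diff_left path_mult_frag_of fun_eq_iff)

lemma path_null_prefix:
  assumes "(z, r, x) \<in> os_paths n k" "path_null n k x p y"
  shows "path_null n k z (r @ p) y"
  using assms os_ideal_mult_left[of "frag_of (x, p, y)" n k "frag_of (z, r, x)"]
    quiver_paths_append[OF assms(1)]
  by (auto simp: path_null_def path_mult_frag_of)

lemma path_null_suffix:
  assumes "(y, r, z) \<in> os_paths n k" "path_null n k x p y"
  shows "path_null n k x (p @ r) z"
  using assms os_ideal_mult_right[of "frag_of (x, p, y)" n k "frag_of (y, r, z)"]
    quiver_paths_append[OF _ assms(1)]
  by (auto simp: path_null_def path_mult_frag_of)

lemma path_eq_F: "path_eq n k (flip i x) y p q \<Longrightarrow> flippable n i x \<Longrightarrow> x \<in> os_states {0..n} k \<Longrightarrow>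
    path_eq n k x y (F_arc i x # p) (F_arc i x # q)"
  using path_eq_prefix[of x "[F_arc i x]" "flip i x" n k y p q] flip_state by simp

lemma path_eq_U: "path_eq n k x y p q \<Longrightarrow> 1 \<le> i \<Longrightarrow> i \<le> n \<Longrightarrow> x \<in> os_states {0..n} k \<Longrightarrow>
    path_eq n k x y (U_arc i x # p) (U_arc i x # q)"
  using path_eq_prefix[of x "[U_arc i x]" x n k y p q] by simp

lemma weight_labels: "weight p j = (\<Sum>l\<leftarrow>path_labels p. label_weight l j)"
  by (simp add: weight_def path_labels_def split_beta comp_def)

lemma weight_os_eq_rel:
  assumes "os_eq_rel (path_labels p) (path_labels q)"
  shows "weight p = weight q"
  unfolding fun_eq_iff weight_labels using assms by cases auto

lemma path_eqI_rel:
  assumes "(x, p, y) \<in> os_paths n k" "(x, q, y) \<in> os_paths n k"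
    "os_eq_rel (path_labels p) (path_labels q)" "(y, r, z) \<in> os_paths n k"
  shows "path_eq n k x z (p @ r) (q @ r)"
proof -
  have "frag_of (x, p, y) - frag_of (x, q, y) \<in> os_relations n k"
    using assms(1-3) unfolding os_relations_def by blast
  then have "frag_of (x, p, y) - frag_of (x, q, y) \<in> os_ideal n k"
    unfolding os_ideal_def
    using ring.genideal_self[OF ring_os_path_algebra os_relations_carrier] by blast
  then have "path_eq n k x y p q" using assms weight_os_eq_rel by (simp add: path_eq_def)
  then show ?thesis by (rule path_eq_suffix[OF assms(4)])
qed

lemma path_nullI_rel:
  assumes "(x, p, y) \<in> os_paths n k" "os_zero_rel (path_labels p) x" "(y, r, z) \<in> os_paths n k"
  shows "path_null n k x (p @ r) z"
proof -
  have "frag_of (x, p, y) \<in> os_relations n k"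
    using assms(1,2) unfolding os_relations_def by blast
  then have "frag_of (x, p, y) \<in> os_ideal n k"
    unfolding os_ideal_def
    using ring.genideal_self[OF ring_os_path_algebra os_relations_carrier] by blast
  then have "path_null n k x p y" using assms by (simp add: path_null_def)
  then show ?thesis by (rule path_null_suffix[OF assms(3)])
qed

lemma path_labels_arc [simp]:
  "path_labels (F_arc i x # p) = (if i \<in> x then L_arr i else R_arr i) # path_labels p"
  "path_labels (U_arc i x # p) = U_arr i # path_labels p"
  "path_labels [] = []"
  by (simp_all add: path_labels_def F_arc_def U_arc_def)

lemma path_eq_UU:
  assumes "x \<in> os_states {0..n} k" "1 \<le> i" "i \<le> n" "1 \<le> j" "j \<le> n" "(x, p, y) \<in> os_paths n k"
  shows "path_eq n k x y (U_arc i x # U_arc j x # p) (U_arc j x # U_arc i x # p)"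
  using path_eqI_rel[of x "[U_arc i x, U_arc j x]" x n k "[U_arc j x, U_arc i x]" p y] assms
  by (simp add: os_eq_rel.UU)

lemma path_eq_FU:
  assumes "x \<in> os_states {0..n} k" "flippable n i x" "1 \<le> j" "j \<le> n" "(flip i x, p, y) \<in> os_paths n k"
  shows "path_eq n k x y (F_arc i x # U_arc j (flip i x) # p) (U_arc j x # F_arc i x # p)"
  using path_eqI_rel[of x "[F_arc i x, U_arc j (flip i x)]" "flip i x" n k "[U_arc j x, F_arc i x]" p y]
    assms flip_state
  by (simp add: os_eq_rel.RU os_eq_rel.LU)

lemma path_eq_FF:
  assumes "x \<in> os_states {0..n} k" "flippable n i x" "(x, p, y) \<in> os_paths n k"
  shows "path_eq n k x y (F_arc i x # F_arc i (flip i x) # p) (U_arc i x # p)"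
  using path_eqI_rel[of x "[F_arc i x, F_arc i (flip i x)]" x n k "[U_arc i x]" p y]
    assms flip_state
  by (auto simp: os_eq_rel.RL os_eq_rel.LR in_flip flippable_def)

lemma path_eq_far:
  assumes x: "x \<in> os_states {0..n} k" and f: "flippable n i x" "flippable n j x"
    and ij: "i \<noteq> j" "i \<noteq> j + 1" "j \<noteq> i + 1" and p: "(flip j (flip i x), p, y) \<in> os_paths n k"
  shows "path_eq n k x y (F_arc i x # F_arc j (flip i x) # p) (F_arc j x # F_arc i (flip j x) # p)"
proof -
  have d: "\<bar>int i - int j\<bar> > 1" "\<bar>int j - int i\<bar> > 1" using ij by auto
  have m: "j \<in> flip i x \<longleftrightarrow> j \<in> x" "i \<in> flip j x \<longleftrightarrow> i \<in> x"
    using ij f by (auto simp: in_flip flippable_def)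
  have P: "(x, [F_arc i x, F_arc j (flip i x)], flip j (flip i x)) \<in> os_paths n k"
    "(x, [F_arc j x, F_arc i (flip j x)], flip j (flip i x)) \<in> os_paths n k"
    using x f ij flippable_far[of n i x j] flippable_far[of n j x i]
    by (auto simp: flip_state flip_commute[of j i])
  show ?thesis
  proof (cases "i \<notin> x \<and> j \<in> x")
    \<comment> \<open>This is \<open>R_i\<close> followed by \<open>L_j\<close>; the far relation is
      stated with \<open>L\<close> in front and is applied backwards.\<close>
    case True
    then show ?thesis
      using path_eqI_rel[OF P(2) P(1) _ p] by (simp add: m os_eq_rel.LR_far d path_eq_sym)
  next
    case False
    then have "os_eq_rel (path_labels [F_arc i x, F_arc j (flip i x)]) (path_labels [F_arc j x, F_arc i (flip j x)])"
      by (auto simp: m intro!: os_eq_rel.RR os_eq_rel.LL os_eq_rel.LR_far d)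
    from path_eqI_rel[OF P this p] show ?thesis by simp
  qed
qed

text \<open>A single point, at \<open>i + 1\<close>, is carried across two gaps in a row.\<close>

lemma path_null_LL:
  assumes "x \<in> os_states {0..n} k" "1 \<le> i" "i + 1 \<le> n" "i - 1 \<notin> x" "i \<notin> x" "i + 1 \<in> x"
    "(flip i (flip (i + 1) x), p, y) \<in> os_paths n k"
  shows "path_null n k x (F_arc (i + 1) x # F_arc i (flip (i + 1) x) # p) y"
proof -
  have "flippable n (i + 1) x" "flippable n i (flip (i + 1) x)" "i \<in> flip (i + 1) x"
    using assms by (auto simp: flippable_def in_flip)
  then show ?thesis
    using path_nullI_rel[of x "[F_arc (i + 1) x, F_arc i (flip (i + 1) x)]" "flip i (flip (i + 1) x)" n k p y]
      assms flip_state os_zero_rel.LL0[of "i + 1" x] by simp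
qed

lemma path_null_RR:
  assumes "x \<in> os_states {0..n} k" "1 \<le> i" "i + 1 \<le> n" "i - 1 \<in> x" "i \<notin> x" "i + 1 \<notin> x"
    "(flip (i + 1) (flip i x), p, y) \<in> os_paths n k"
  shows "path_null n k x (F_arc i x # F_arc (i + 1) (flip i x) # p) y"
proof -
  have "flippable n i x" "flippable n (i + 1) (flip i x)" "i + 1 \<notin> flip i x"
    using assms by (auto simp: flippable_def in_flip)
  then show ?thesis
    using path_nullI_rel[of x "[F_arc i x, F_arc (i + 1) (flip i x)]" "flip (i + 1) (flip i x)" n k p y]
      assms flip_state os_zero_rel.RR0[of "i + 1" x] by simp
qed

lemma path_null_U:
  assumes "x \<in> os_states {0..n} k" "1 \<le> i" "i \<le> n" "i - 1 \<notin> x" "i \<notin> x" "(x, p, y) \<in> os_paths n k"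
  shows "path_null n k x (U_arc i x # p) y"
  using path_nullI_rel[of x "[U_arc i x]" x n k p y] assms os_zero_rel.U0[of x i] by simp

section \<open>Existence of matchings\<close>

text \<open>
  The greedy assignment from left to right: the point \<open>c\<close> takes the gap to its left if that gap is in
  \<open>S\<close> and still free.
\<close>

primrec takes_left :: "nat set \<Rightarrow> nat set \<Rightarrow> nat \<Rightarrow> bool" where
  "takes_left S x 0 = False"
| "takes_left S x (Suc c) = (Suc c \<in> S \<and> \<not> (c \<in> x \<and> \<not> takes_left S x c))"

text \<open>An occupied point goes left only if its left neighbour is vacant or goes left itself.
  Following this run backwards ends at a vacant point, and every step of it uses a gap of
  \<open>S\<close>.\<close>

lemma takes_left_block:
  assumes "takes_left S x c" "c \<in> x"
  shows "\<exists>a\<ge>1. a \<le> c \<and> {a..c} \<subseteq> S \<and> a - 1 \<notin> x \<and> {a..c} \<subseteq> x"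
  using assms
proof (induct c)
  case (Suc c)
  show ?case
  proof (cases "c \<in> x")
    case True
    then obtain a where a: "a \<ge> 1" "a \<le> c" "{a..c} \<subseteq> S" "a - 1 \<notin> x" "{a..c} \<subseteq> x"
      using Suc by auto
    moreover have "{a..Suc c} = insert (Suc c) {a..c}" using a by auto
    ultimately show ?thesis using Suc(2,3) by (intro exI[of _ a]) auto
  next
    case False
    then show ?thesis using Suc by (intro exI[of _ "Suc c"]) auto
  qed
qed simp

text \<open>Hall's theorem along a line of gaps. If the greedy assignment misses a gap
  \<open>s\<close> of \<open>S\<close>, then the point \<open>s\<close> is vacant, and the point
  \<open>s - 1\<close>, if occupied, went left; the run that caused this starts at a vacant point,
  which is the other end of the block. The bound on the cardinality provides a vacancy among the
  \<open>n + 1\<close> points.\<close>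

lemma matching_or_block:
  assumes x: "x \<subseteq> {0..n}" "card x \<le> n" and S: "S \<subseteq> {1..n}"
    and no: "\<And>I. matching n x I \<Longrightarrow> \<not> S \<subseteq> I"
  obtains a b where "1 \<le> a" "a \<le> b" "b \<le> n" "{a..b} \<subseteq> S" "a - 1 \<notin> x" "b \<notin> x" "{a..<b} \<subseteq> x"
proof -
  have "{0..n} - x \<noteq> {}"
  proof
    assume "{0..n} - x = {}"
    then have "card {0..n} \<le> card x" using x finite_subset[OF x(1)] by (intro card_mono) auto
    then show False using x(2) by simp
  qed
  then have "Max ({0..n} - x) \<in> {0..n} - x" by (intro Max_in) auto
  then obtain e where e: "e \<in> {0..n}" "e \<notin> x" and emax: "\<And>c. c \<in> {0..n} \<Longrightarrow> c > e \<Longrightarrow> c \<in> x"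
    by (metis DiffD1 DiffD2 DiffI Max_ge finite_Diff finite_atLeastAtMost linorder_not_less)
  \<comment> \<open>Behind the last vacancy \<open>e\<close> every point is occupied, and the point
    \<open>n\<close> has no gap to its right, so all of these points go left.\<close>
  define g where "g c = (if c > e \<or> takes_left S x c then c else c + 1)" for c
  have g: "c \<le> g c" "g c \<le> Suc c" for c by (auto simp: g_def)
  have inj: "inj_on g x"
  proof (rule inj_onI)
    \<comment> \<open>Only neighbours could collide, with \<open>c\<close> going right and
      \<open>c + 1\<close> going left. The greedy rule forbids this except for \<open>c = e\<close>,
      which is vacant.\<close>
    have *: False if "c \<in> x" "g c = Suc c" "g (Suc c) = Suc c" for c
    proof -
      have "\<not> c > e" "\<not> takes_left S x c" using that(2) by (auto simp: g_def split: if_splits)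
      moreover have "Suc c > e \<or> takes_left S x (Suc c)" using that(3) by (auto simp: g_def split: if_splits)
      ultimately show False using that(1) e(2) by (auto simp: less_Suc_eq_le)
    qed
    fix c d assume cd: "c \<in> x" "d \<in> x" "g c = g d"
    show "c = d"
    proof (rule ccontr)
      assume "c \<noteq> d"
      then have "d = Suc c \<or> c = Suc d" using g[of c] g[of d] cd(3) by linarith
      then show False using * g[of c] g[of d] cd by (metis Suc_leI le_antisym le_SucE n_not_Suc_n)
    qed
  qed
  have fx: "finite x" using x finite_subset by blast
  have hg: "height (g ` x) j = card {c \<in> x. g c < j}" for j
  proof -
    have "{i \<in> g ` x. i < j} = g ` {c \<in> x. g c < j}" by auto
    moreover have "inj_on g {c \<in> x. g c < j}" by (rule inj_on_subset[OF inj]) auto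
    ultimately show ?thesis by (simp add: height_def card_image)
  qed
  have "matching n x (g ` x)"
  proof (rule matchingI_height)
    show "card (g ` x) = card x" by (rule card_image[OF inj])
    show "g ` x \<subseteq> {1..n}"
    proof
      fix i assume "i \<in> g ` x"
      then obtain c where c: "c \<in> x" "i = g c" by blast
      then have "c \<noteq> e" "c \<le> n" using e x by auto
      moreover have "c \<in> S" if "takes_left S x c" using that by (cases c) auto
      ultimately show "i \<in> {1..n}" using c e S by (auto simp: g_def)
    qed
    fix j assume "j \<in> {1..n}"
    have "height (g ` x) j \<le> height x j"
      unfolding hg unfolding height_def by (rule card_mono) (use fx g in \<open>auto intro: le_less_trans\<close>)
    moreover have "height x j \<le> height (g ` x) (Suc j)"
      unfolding hg unfolding height_def
      by (rule card_mono) (use fx g in \<open>auto simp: less_Suc_eq_le intro: order_trans[OF g(2)]\<close>)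
    ultimately show "height (g ` x) j \<le> height x j \<and> height x j \<le> height (g ` x) j + of_bool (j \<in> g ` x)"
      by (simp add: height_Suc)
  qed
  then obtain s where s: "s \<in> S" "s \<notin> g ` x" using no by blast
  have s1: "1 \<le> s" "s \<le> n" using s(1) S by auto
  have se: "s \<le> e"
  proof (rule ccontr)
    assume "\<not> s \<le> e"
    then have "s \<in> x" "g s = s" using emax s1 by (auto simp: g_def)
    then show False using s(2) by force
  qed
  obtain c where c: "s = Suc c" using s1 by (cases s) auto
  have cL: "takes_left S x c" if "c \<in> x"
  proof (rule ccontr)
    assume "\<not> takes_left S x c"
    then have "g c = s" using c se by (simp add: g_def)
    then show False using s(2) that by force
  qed
  have sx: "s \<notin> x"
  proof
    assume "s \<in> x"
    moreover have "takes_left S x s" using cL s(1) by (auto simp: c)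
    ultimately show False using s(2) by (force simp: g_def)
  qed
  show ?thesis
  proof (cases "c \<in> x")
    case True
    obtain a where a: "a \<ge> 1" "a \<le> c" "{a..c} \<subseteq> S" "a - 1 \<notin> x" "{a..c} \<subseteq> x"
      using takes_left_block[OF cL[OF True] True] by blast
    moreover have "{a..s} = insert s {a..c}" "{a..<s} = {a..c}" using a c by auto
    ultimately show ?thesis using that[of a s] s s1 sx c by auto
  next
    case False
    then show ?thesis using that[of s s] s s1 sx c by auto
  qed
qed

section \<open>Normal forms of paths\<close>

text \<open>Length is not invariant under the relations, since \<open>R_i L_i = U_i\<close>. The
  total weight is invariant, and it drops when the first arrow is removed.\<close>

definition total_weight :: "(nat set \<times> os_label \<times> nat set) list \<Rightarrow> nat \<Rightarrow> nat" where
  "total_weight p n = (\<Sum>j\<in>{1..n}. weight p j)"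

lemma total_weight_simps:
  "1 \<le> i \<Longrightarrow> i \<le> n \<Longrightarrow> total_weight (F_arc i x # p) n = Suc (total_weight p n)"
  "1 \<le> i \<Longrightarrow> i \<le> n \<Longrightarrow> total_weight (U_arc i x # p) n = Suc (Suc (total_weight p n))"
  by (simp_all add: total_weight_def sum.distrib flip: sum_distrib_left)

lemma total_weight_cong: "weight p = weight q \<Longrightarrow> total_weight p n = total_weight q n"
  by (simp add: total_weight_def)

lemma path_eqD:
  assumes "path_eq n k x y p q"
  shows "(x, p, y) \<in> os_paths n k" "(x, q, y) \<in> os_paths n k" "weight p = weight q"
  using assms by (simp_all add: path_eq_def)

text \<open>By the relations \<open>U_i\<close> commutes with every arrow, so it can travel past all
  earlier ones.\<close>

lemma path_eq_U_front:
  assumes "(x, p, y) \<in> os_paths n k" "U_arr i \<in> set (path_labels p)"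
  shows "\<exists>q. path_eq n k x y p (U_arc i x # q)"
  using assms
proof (induct p arbitrary: x)
  case (Cons a p)
  from Cons(2) show ?case
  proof (cases rule: os_paths_Cons_cases)
    case (F j)
    then have "U_arr i \<in> set (path_labels p)" using Cons(3) by (auto split: if_splits)
    from Cons(1)[OF F(3) this] obtain q where q: "path_eq n k (flip j x) y p (U_arc i (flip j x) # q)" by blast
    then have "path_eq n k x y (a # p) (F_arc j x # U_arc i (flip j x) # q)"
      using path_eq_F F by blast
    also have "path_eq n k x y \<dots> (U_arc i x # F_arc j x # q)"
      using path_eqD(2)[OF q] F by (intro path_eq_FU) auto
    finally show ?thesis by blast
  next
    case (U j)
    show ?thesis
    proof (cases "j = i")
      case True
      then show ?thesis using U Cons(2) path_eq_refl[OF Cons(2)] by blast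
    next
      case False
      then have "U_arr i \<in> set (path_labels p)" using Cons(3) U by auto
      from Cons(1)[OF U(4) this] obtain q where q: "path_eq n k x y p (U_arc i x # q)" by blast
      then have "path_eq n k x y (a # p) (U_arc j x # U_arc i x # q)"
        using path_eq_U U by blast
      also have "path_eq n k x y \<dots> (U_arc i x # U_arc j x # q)"
        using path_eqD(2)[OF q] U by (intro path_eq_UU) auto
      finally show ?thesis by blast
    qed
  qed
qed (simp add: path_labels_def)

text \<open>
  Two matched neighbouring gaps \<open>i\<close> and \<open>j\<close> whose points lie on the same side of their gaps: as long as
  the point of \<open>j\<close> stays, the point of \<open>i\<close> is blocked.
\<close>

definition blocked :: "nat set \<Rightarrow> nat set \<Rightarrow> nat \<Rightarrow> nat \<Rightarrow> bool" where
  "blocked I x i j \<longleftrightarrow> i \<in> I \<and> j \<in> I \<and>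
     (j = i + 1 \<and> height x j = height I j + 1 \<or> i = j + 1 \<and> height x j = height I j)"

text \<open>The height bounds leave no freedom next to a blocked gap: in both cases the points
  \<open>i - 1\<close> and \<open>i\<close> are occupied.\<close>

lemma blocked_not_flippable:
  assumes x: "x \<subseteq> {0..n}" and m: "matching n x I" and b: "blocked I x i j"
  shows "\<not> flippable n i x"
proof
  assume f: "flippable n i x"
  then obtain i' where i: "i = Suc i'" "Suc i' \<le> n" by (cases i) (auto simp: flippable_def)
  note h = matching_height[OF x m]
  have iI: "i \<in> I" and jI: "j \<in> I" using b by (auto simp: blocked_def)
  then have jn: "j \<le> n" using m by (auto simp: matching_def)
  from b consider "j = i + 1" "height x j = height I j + 1" | "i = j + 1" "height x j = height I j"
    by (auto simp: blocked_def)
  then show False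
  proof cases
    case 1
    have "height I j = height I i + 1" using iI 1 by (simp add: height_Suc)
    moreover have "height x i \<le> height I i + 1" using h(2)[of i] iI i by simp
    moreover have "height x j = height x i + of_bool (i \<in> x)" using 1 by (simp add: height_Suc)
    ultimately have "i \<in> x" "height x i = height I i + 1" using 1(2) by (auto split: if_splits simp: of_bool_def)
    moreover have "height x i' \<le> height I i" using h(2)[of i'] i by (simp add: height_Suc)
    ultimately have "i' \<in> x" using i by (auto simp: height_Suc of_bool_def split: if_splits)
    then show False using \<open>i \<in> x\<close> f i by (simp add: flippable_def)
  next
    case 2
    have 3: "height I i = height I j + 1" using jI 2 by (simp add: height_Suc)
    have "height I i \<le> height x i" using h(1)[of i] i by simp
    then have j: "j \<in> x" "height x i = height I i" using 2 3 by (auto simp: height_Suc of_bool_def split: if_splits)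
    have "height I i + 1 \<le> height x (Suc i)" using h(1)[of "Suc i"] i iI by (simp add: height_Suc)
    then have "i \<in> x" using j by (auto simp: height_Suc of_bool_def split: if_splits)
    then show False using \<open>j \<in> x\<close> f 2 by (simp add: flippable_def)
  qed
qed

lemma blocked_path:
  assumes "(x, p, y) \<in> os_paths n k" "matching n x I" "blocked I x i j"
    "{l. weight p l \<noteq> 0} \<subseteq> I" "weight p j = 0" "U_arr i \<notin> set (path_labels p)"
  shows "weight p i = 0"
  using assms
proof (induct p arbitrary: x)
  case (Cons a p)
  from Cons(2) show ?case
  proof (cases rule: os_paths_Cons_cases)
    case (F l)
    have x: "x \<subseteq> {0..n}" "finite x" using F(4) os_state_subset os_state_finite by blast+
    have "weight (a # p) l \<noteq> 0" using F by simp
    then have l: "l \<in> I" "l \<noteq> j" using Cons.prems(4,5) by auto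
    have "l \<noteq> i" using blocked_not_flippable[OF x(1) Cons.prems(2,3)] F by auto
    moreover have "weight p i = 0"
    proof (rule Cons(1)[OF F(3)])
      show "matching n (flip l x) I" using matching_flip F x l Cons.prems by blast
      show "blocked I (flip l x) i j"
        using Cons.prems(3) height_flip(1)[OF F(2), of j] l(2) by (auto simp: blocked_def)
      show "{l. weight p l \<noteq> 0} \<subseteq> I" "weight p j = 0" "U_arr i \<notin> set (path_labels p)"
        using Cons.prems(4,5,6) F by auto
    qed
    ultimately show ?thesis using F by simp
  next
    case (U l)
    have "l \<noteq> i" using Cons.prems(6) U by auto
    moreover have "weight p i = 0"
      using Cons.prems U by (intro Cons(1)[OF U(4)]) auto
    ultimately show ?thesis using U by simp
  qed
qed simp

text \<open>Two adjacent flippable gaps have the occupation pattern full-empty-full or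
  empty-full-empty on their three points. The second contradicts the matching; in the first, the
  move across \<open>j\<close> fills the points on both sides of \<open>i\<close>.\<close>

lemma adjacent_flip_blocked:
  assumes x: "x \<subseteq> {0..n}" and m: "matching n x I" and I: "i \<in> I" "j \<in> I" "i = j + 1 \<or> j = i + 1"
    and f: "flippable n i x" "flippable n j x"
  shows "blocked I (flip j x) i j"
proof -
  define l where "l = min i j"
  have l: "1 \<le> l" "l + 1 \<le> n" "l \<in> I" "l + 1 \<in> I" "flippable n l x" "flippable n (l + 1) x"
    using I f by (auto simp: l_def flippable_def min_def)
  have "l \<notin> x"
  proof
    assume "l \<in> x"
    then have "l - 1 \<notin> x" "l + 1 \<notin> x" using l(5,6) by (auto simp: flippable_def)
    then show False using not_matching_block[OF x m, of l "l + 1"] l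
      by (auto simp: atLeastAtMostSuc_conv)
  qed
  then have l1: "l - 1 \<in> x" "l + 1 \<in> x" using l(5,6) by (auto simp: flippable_def)
  note h = matching_height[OF x m]
  have "height x (l + 1) = height x l" using \<open>l \<notin> x\<close> by (simp add: height_Suc)
  moreover have "height I (l + 1) = height I l + 1" using l by (simp add: height_Suc)
  ultimately have hl: "height x l = height I l + 1" "height x (l + 1) = height I (l + 1)"
    using h(1)[of "l + 1"] h(2)[of l] l by auto
  show ?thesis
  proof (cases "j = l + 1")
    case True
    then have "i = l" using I(3) by (auto simp: l_def min_def split: if_splits)
    then show ?thesis using True I hl l1 height_flip(2)[OF f(2)] by (simp add: blocked_def)
  next
    case False
    then have "j = l" "i = l + 1" using I(3) by (auto simp: l_def min_def split: if_splits)
    then show ?thesis using I hl \<open>l \<notin> x\<close> height_flip(3)[OF f(2)] by (simp add: blocked_def)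
  qed
qed

text \<open>The exchange property behind all rewriting. \<open>U\<close> arrows and far crossings
  commute with the crossing of \<open>i\<close>, and \<open>U_i\<close> splits into two crossings.
  Only an initial crossing of a neighbour \<open>j\<close> resists: it blocks \<open>i\<close>, so
  \<open>j\<close> must occur again; bringing that occurrence forward turns the pair into
  \<open>U_j\<close>, which commutes.\<close>

lemma path_eq_F_front:
  assumes "(x, p, y) \<in> os_paths n k" "matching n x I" "{l. weight p l \<noteq> 0} \<subseteq> I"
    "flippable n i x" "weight p i \<noteq> 0"
  shows "\<exists>q. path_eq n k x y p (F_arc i x # q)"
  using assms
proof (induct "total_weight p n" arbitrary: p x i rule: less_induct)
  case less
  have x: "x \<in> os_states {0..n} k" using quiver_paths_ends(1)[OF wf_os_quiver less.prems(1)] by simp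
  have x': "x \<subseteq> {0..n}" "finite x" using x os_state_subset os_state_finite by blast+
  have i: "1 \<le> i" "i \<le> n" using less.prems(4) by (auto simp: flippable_def)
  have iI: "i \<in> I" using less.prems(3,5) by blast
  have U: "\<exists>q. path_eq n k x y p (F_arc i x # q)" if "path_eq n k x y p (U_arc i x # q)" for q
  proof -
    have "path_eq n k x y (F_arc i x # F_arc i (flip i x) # q) (U_arc i x # q)"
      using path_eqD(2)[OF that] x less.prems(4) by (intro path_eq_FF) auto
    then show ?thesis using path_eq_trans[OF that path_eq_sym] by blast
  qed
  show ?case
  proof (cases "U_arr i \<in> set (path_labels p)")
    case True
    then show ?thesis using path_eq_U_front[OF less.prems(1)] U by blast
  next
    case noU: False
    obtain a p1 where p: "p = a # p1" using less.prems(5) by (cases p) auto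
    from less.prems(1)[unfolded p] show ?thesis
    proof (cases rule: os_paths_Cons_cases)
      case (U j)
      have "j \<noteq> i" using noU U p by auto
      have "\<exists>q. path_eq n k x y p1 (F_arc i x # q)"
      proof (rule less.hyps[OF _ U(4) less.prems(2) _ less.prems(4)])
        show "total_weight p1 n < total_weight p n" using U p by (simp add: total_weight_simps)
        show "{l. weight p1 l \<noteq> 0} \<subseteq> I" "weight p1 i \<noteq> 0"
          using less.prems(3,5) p U \<open>j \<noteq> i\<close> by auto
      qed
      then obtain q where q: "path_eq n k x y p1 (F_arc i x # q)" by blast
      then have "path_eq n k x y p (U_arc j x # F_arc i x # q)"
        using path_eq_U U p by blast
      also have "path_eq n k x y \<dots> (F_arc i x # U_arc j (flip i x) # q)"
        using path_eqD(2)[OF q] x U less.prems(4) by (intro path_eq_sym[OF path_eq_FU]) auto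
      finally show ?thesis by blast
    next
      case (F j)
      note p1 = F(3)
      have tw: "total_weight p n = Suc (total_weight p1 n)"
        using F p by (auto simp: total_weight_simps flippable_def)
      have supp1: "{l. weight p1 l \<noteq> 0} \<subseteq> I" using less.prems(3) p F by auto
      have jI: "j \<in> I" using less.prems(3) p F by auto
      have m1: "matching n (flip j x) I" using matching_flip F x' jI less.prems(2) by blast
      show ?thesis
      proof (cases "j = i")
        case True
        then show ?thesis using F p path_eq_refl[OF less.prems(1)] by blast
      next
        case ij: False
        have w1: "weight p1 i \<noteq> 0" using less.prems(5) p F ij by simp
        show ?thesis
        proof (cases "i = j + 1 \<or> j = i + 1")
          case False
          have "flippable n i (flip j x)" using flippable_far[OF F(2)] ij False less.prems(4) by auto
          then obtain q where q: "path_eq n k (flip j x) y p1 (F_arc i (flip j x) # q)"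
            using less.hyps[OF _ p1 m1 supp1 _ w1] tw by auto
          then have "path_eq n k x y p (F_arc j x # F_arc i (flip j x) # q)"
            using path_eq_F F p by blast
          also have "path_eq n k x y \<dots> (F_arc i x # F_arc j (flip i x) # q)"
            using path_eqD(2)[OF q] x F less.prems(4) ij False by (intro path_eq_far) auto
          finally show ?thesis by blast
        next
          case True
          show ?thesis
          proof (cases "weight p1 j = 0")
            case True
            have "blocked I (flip j x) i j"
              by (rule adjacent_flip_blocked[OF x'(1) less.prems(2) iI jI \<open>i = j + 1 \<or> j = i + 1\<close> less.prems(4) F(2)])
            then have "U_arr i \<in> set (path_labels p1)"
              using blocked_path[OF p1 m1 _ supp1 True, of i] w1 by auto
            then show ?thesis using noU p by (simp add: path_labels_def)
          next
            case False
            then obtain q where q: "path_eq n k (flip j x) y p1 (F_arc j (flip j x) # q)"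
              using less.hyps[OF _ p1 m1 supp1, of j] F(2) tw by auto
            have q': "(x, q, y) \<in> os_paths n k" using path_eqD(2)[OF q] by simp
            have "path_eq n k x y p (F_arc j x # F_arc j (flip j x) # q)"
              using q path_eq_F F p by blast
            also have "path_eq n k x y \<dots> (U_arc j x # q)"
              using q' x F by (intro path_eq_FF) auto
            finally have pU: "path_eq n k x y p (U_arc j x # q)" .
            have jn: "1 \<le> j" "j \<le> n" using F(2) by (auto simp: flippable_def)
            have wq: "weight p l = 2 * of_bool (j = l) + weight q l" for l
              using path_eqD(3)[OF pU] by (simp add: fun_eq_iff)
            \<comment> \<open>The path \<open>q\<close> starts again at \<open>x\<close> and is
              lighter by two, so the induction hypothesis applies to it with the original
              \<open>i\<close>.\<close>
            have "\<exists>r. path_eq n k x y q (F_arc i x # r)"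
            proof (rule less.hyps[OF _ q' less.prems(2) _ less.prems(4)])
              show "total_weight q n < total_weight p n"
                using total_weight_cong[OF path_eqD(3)[OF pU], of n] jn by (simp add: total_weight_simps)
              show "{l. weight q l \<noteq> 0} \<subseteq> I" using less.prems(3) wq by auto
              show "weight q i \<noteq> 0" using less.prems(5) wq[of i] ij by simp
            qed
            then obtain r where r: "path_eq n k x y q (F_arc i x # r)" by blast
            note pU
            also have "path_eq n k x y (U_arc j x # q) (U_arc j x # F_arc i x # r)"
              using path_eq_U[OF r] jn x by blast
            also have "path_eq n k x y \<dots> (F_arc i x # U_arc j (flip i x) # r)"
              using path_eqD(2)[OF r] x jn less.prems(4) by (intro path_eq_sym[OF path_eq_FU]) auto
            finally show ?thesis by blast
          qed
        qed
      qed
    qed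
  qed
qed

text \<open>Once \<open>i\<close> has been crossed it can be crossed back, so a remaining use of
  \<open>i\<close> can be brought next to the crossing, and the two merge into
  \<open>U_i\<close>.\<close>

lemma path_eq_U_front_weight:
  assumes "(x, p, y) \<in> os_paths n k" "matching n x I" "{l. weight p l \<noteq> 0} \<subseteq> I" "2 \<le> weight p i"
  shows "\<exists>q. path_eq n k x y p (U_arc i x # q)"
  using assms
proof (induct p arbitrary: x)
  case (Cons a p)
  from Cons.prems(1) show ?case
  proof (cases rule: os_paths_Cons_cases)
    case (F j)
    have x: "finite x" using F(4) os_state_finite by blast
    have "j \<in> I" using Cons.prems(3) F by auto
    then have m: "matching n (flip j x) I" using matching_flip F(2) x Cons.prems(2) by blast
    have supp: "{l. weight p l \<noteq> 0} \<subseteq> I" using Cons.prems(3) F by auto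
    have jn: "1 \<le> j" "j \<le> n" using F(2) by (auto simp: flippable_def)
    show ?thesis
    proof (cases "j = i")
      case True
      then have "weight p i \<noteq> 0" using Cons.prems(4) F by auto
      then obtain q where q: "path_eq n k (flip i x) y p (F_arc i (flip i x) # q)"
        using path_eq_F_front[OF F(3) m supp, of i] F(2) True by auto
      then have "path_eq n k x y (a # p) (F_arc i x # F_arc i (flip i x) # q)"
        using path_eq_F F True by blast
      also have "path_eq n k x y \<dots> (U_arc i x # q)"
        using path_eqD(2)[OF q] F True by (intro path_eq_FF) auto
      finally show ?thesis by blast
    next
      case False
      then have "2 \<le> weight p i" using Cons.prems(4) F by auto
      then obtain q where q: "path_eq n k (flip j x) y p (U_arc i (flip j x) # q)"
        using Cons.hyps[OF F(3) m supp] by blast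
      then have "path_eq n k x y (a # p) (F_arc j x # U_arc i (flip j x) # q)"
        using path_eq_F F by blast
      also have "path_eq n k x y \<dots> (U_arc i x # F_arc j x # q)"
        using path_eqD(2)[OF q] F by (intro path_eq_FU) auto
      finally show ?thesis by blast
    qed
  next
    case (U j)
    show ?thesis
    proof (cases "j = i")
      case True
      then show ?thesis using U path_eq_refl[OF Cons.prems(1)] by blast
    next
      case False
      have "{l. weight p l \<noteq> 0} \<subseteq> I" "2 \<le> weight p i" using Cons.prems(3,4) False U by auto
      then obtain q where q: "path_eq n k x y p (U_arc i x # q)"
        using Cons.hyps[OF U(4) Cons.prems(2)] by blast
      then have "path_eq n k x y (a # p) (U_arc j x # U_arc i x # q)"
        using path_eq_U U by blast
      also have "path_eq n k x y \<dots> (U_arc i x # U_arc j x # q)"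
        using path_eqD(2)[OF q] U by (intro path_eq_UU) auto
      finally show ?thesis by blast
    qed
  qed
qed simp

text \<open>No normal form is chosen: the exchange lemmas bring the first arrow of \<open>p\<close>
  to the front of \<open>q\<close>, and the tails are compared by induction.\<close>

lemma path_eq_if_weight_eq:
  assumes "(x, p, y) \<in> os_paths n k" "(x, q, y) \<in> os_paths n k"
    "matching n x I" "{l. weight p l \<noteq> 0} \<subseteq> I" "weight p = weight q"
  shows "path_eq n k x y p q"
  using assms
proof (induct p arbitrary: x q)
  case Nil
  show ?case
  proof (cases q)
    case (Cons a q')
    from Nil(2)[unfolded Cons] obtain i where "weight q i \<noteq> 0"
    proof (cases rule: os_paths_Cons_cases)
      case (F i) then show ?thesis using that[of i] Cons by simp
    next
      case (U i) then show ?thesis using that[of i] Cons by simp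
    qed
    moreover have "weight q i = 0" for i using fun_cong[OF Nil(5), of i] by simp
    ultimately show ?thesis by simp
  qed (simp add: path_eq_refl[OF Nil(1)])
next
  case (Cons a p)
  have supp: "{l. weight q l \<noteq> 0} \<subseteq> I" using Cons.prems by simp
  from Cons.prems(1) show ?case
  proof (cases rule: os_paths_Cons_cases)
    case (F i)
    have iI: "i \<in> I" using Cons.prems(4) F by auto
    have wi: "weight q i \<noteq> 0" using fun_cong[OF Cons.prems(5), of i] F by auto
    obtain r where r: "path_eq n k x y q (F_arc i x # r)"
      using path_eq_F_front[OF Cons.prems(2,3) supp F(2) wi] by blast
    have "path_eq n k (flip i x) y p r"
    proof (rule Cons.hyps)
      show "(flip i x, p, y) \<in> os_paths n k" "(flip i x, r, y) \<in> os_paths n k"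
        using F path_eqD(2)[OF r] by auto
      show "matching n (flip i x) I" using matching_flip F os_state_finite iI Cons.prems(3) by blast
      show "{l. weight p l \<noteq> 0} \<subseteq> I" using Cons.prems(4) F by auto
      show "weight p = weight r"
        using Cons.prems(5) path_eqD(3)[OF r] F by (simp add: fun_eq_iff)
    qed
    then have "path_eq n k x y (a # p) (F_arc i x # r)" using path_eq_F F by blast
    then show ?thesis using path_eq_trans path_eq_sym r by blast
  next
    case (U i)
    have wi: "2 \<le> weight q i" using fun_cong[OF Cons.prems(5), of i] U by auto
    obtain r where r: "path_eq n k x y q (U_arc i x # r)"
      using path_eq_U_front_weight[OF Cons.prems(2,3) supp wi] by blast
    have "path_eq n k x y p r"
    proof (rule Cons.hyps[OF U(4) _ Cons.prems(3)])
      show "(x, r, y) \<in> os_paths n k" using path_eqD(2)[OF r] by auto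
      show "{l. weight p l \<noteq> 0} \<subseteq> I" using Cons.prems(4) U by auto
      show "weight p = weight r"
        using Cons.prems(5) path_eqD(3)[OF r] U by (simp add: fun_eq_iff)
    qed
    then have "path_eq n k x y (a # p) (U_arc i x # r)" using path_eq_U U by blast
    then show ?thesis using path_eq_trans path_eq_sym r by blast
  qed
qed

section \<open>Vanishing of paths whose support is not matched\<close>

lemma path_null_F: "path_null n k (flip i x) p y \<Longrightarrow> flippable n i x \<Longrightarrow> x \<in> os_states {0..n} k \<Longrightarrow>
    path_null n k x (F_arc i x # p) y"
  using path_null_prefix[of x "[F_arc i x]" "flip i x" n k p y] flip_state by simp

lemma path_null_U_prefix: "path_null n k x p y \<Longrightarrow> 1 \<le> i \<Longrightarrow> i \<le> n \<Longrightarrow> x \<in> os_states {0..n} k \<Longrightarrow>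
    path_null n k x (U_arc i x # p) y"
  using path_null_prefix[of x "[U_arc i x]" x n k p y] by simp

text \<open>If the tail \<open>p1\<close> is itself unmatched, induction applies to it. Otherwise
  each block obstructing the whole path contains the gap \<open>i\<close> of the first arrow. An end
  gap \<open>c\<close> of the block other than \<open>i\<close> can be crossed at once; moving this
  crossing to the front leaves a path that is obstructed by the block without \<open>c\<close> and
  vanishes by induction. The blocks too short for this are exactly those of the monomial
  relations.\<close>

lemma path_null_unmatched:
  assumes kn: "k \<le> n" and "(x, p, y) \<in> os_paths n k"
    and "\<And>I. matching n x I \<Longrightarrow> \<not> {l. weight p l \<noteq> 0} \<subseteq> I"
  shows "path_null n k x p y"
  using assms(2,3)
proof (induct "total_weight p n" arbitrary: x p rule: less_induct)
  case less
  have x: "x \<in> os_states {0..n} k" using quiver_paths_ends(1)[OF wf_os_quiver less.prems(1)] by simp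
  have x': "x \<subseteq> {0..n}" "finite x" "card x \<le> n"
    using x kn os_state_subset os_state_finite os_state_card by blast+
  have supp: "{l. weight p l \<noteq> 0} \<subseteq> {1..n}" using weight_supp[OF less.prems(1)] by blast
  have blk: False if "matching n z I" "z \<in> os_states {0..n} k" "{a..b} \<subseteq> I" "1 \<le> a" "a \<le> b" "b \<le> n" "a - 1 \<notin> z" "b \<notin> z" for z I a b
    using not_matching_block[OF os_state_subset[OF that(2)] that(1)] that by blast
  show ?case
  proof (cases p)
    case Nil
    \<comment> \<open>A block needs a gap of the support, so the empty path always has a
      matching.\<close>
    then show ?thesis
      using matching_or_block[OF x'(1,3) supp less.prems(2)] by (simp, metis order_refl)
  next
    case (Cons e p1)
    from less.prems(1)[unfolded Cons] show ?thesis
    proof (cases rule: os_paths_Cons_cases)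
      case (U i)
      have tw: "total_weight p n = Suc (Suc (total_weight p1 n))"
        using U Cons by (simp add: total_weight_simps)
      show ?thesis
      proof (cases "\<exists>I. matching n x I \<and> {l. weight p1 l \<noteq> 0} \<subseteq> I")
        case False
        then have "path_null n k x p1 y" using less.hyps[OF _ U(4)] tw by auto
        then show ?thesis using path_null_U_prefix U Cons by simp
      next
        case True
        then obtain J where J: "matching n x J" "{l. weight p1 l \<noteq> 0} \<subseteq> J" by blast
        \<comment> \<open>Here \<open>c\<close> is an end of the obstructing block and
          \<open>{a..b}\<close> is the block without it; crossing \<open>c\<close> vacates the new
          end.\<close>
        have step: "path_null n k x p y"
          if c: "flippable n c x" "weight p1 c \<noteq> 0"
            and ab: "1 \<le> a" "a \<le> b" "b \<le> n" "\<And>l. l \<in> {a..b} \<Longrightarrow> weight p l \<noteq> 0 \<and> l \<noteq> c" "a - 1 \<notin> flip c x" "b \<notin> flip c x" for c a b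
        proof -
          obtain q where q: "path_eq n k x y p1 (F_arc c x # q)"
            using path_eq_F_front[OF U(4) J c] by blast
          have cn: "1 \<le> c" "c \<le> n" using c(1) by (auto simp: flippable_def)
          have "path_eq n k x y p (U_arc i x # F_arc c x # q)"
            using path_eq_U[OF q] U Cons by simp
          also have "path_eq n k x y \<dots> (F_arc c x # U_arc i (flip c x) # q)"
            using path_eqD(2)[OF q] U c by (intro path_eq_sym[OF path_eq_FU]) auto
          finally have e: "path_eq n k x y p (F_arc c x # U_arc i (flip c x) # q)" .
          note w = fun_cong[OF path_eqD(3)[OF e]]
          have "path_null n k (flip c x) (U_arc i (flip c x) # q) y"
          proof (rule less.hyps)
            show "total_weight (U_arc i (flip c x) # q) n < total_weight p n"
              using total_weight_cong[OF path_eqD(3)[OF e], of n] cn by (simp add: total_weight_simps)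
            show "(flip c x, U_arc i (flip c x) # q, y) \<in> os_paths n k" using path_eqD(2)[OF e] by simp
            fix I assume I: "matching n (flip c x) I"
            show "\<not> {l. weight (U_arc i (flip c x) # q) l \<noteq> 0} \<subseteq> I"
            proof
              assume s: "{l. weight (U_arc i (flip c x) # q) l \<noteq> 0} \<subseteq> I"
              have "weight (U_arc i (flip c x) # q) l \<noteq> 0" if "l \<in> {a..b}" for l
                using w[of l] ab(4)[OF that] by auto
              then have "{a..b} \<subseteq> I" using s by blast
              then show False using blk[OF I flip_state[OF c(1) x]] ab by blast
            qed
          qed
          then show ?thesis using path_null_eq[OF e] path_null_F c(1) x by blast
        qed
        have no: "\<not> {l. weight p l \<noteq> 0} \<subseteq> I" if "matching n x I" for I using less.prems(2) that by blast
        obtain a b where ab: "1 \<le> a" "a \<le> b" "b \<le> n" "{a..b} \<subseteq> {l. weight p l \<noteq> 0}"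
          "a - 1 \<notin> x" "b \<notin> x" "{a..<b} \<subseteq> x"
          using matching_or_block[OF x'(1,3) supp no] by blast
        have abw: "weight p l \<noteq> 0" if "a \<le> l" "l \<le> b" for l using subsetD[OF ab(4), of l] that by simp
        have w: "weight p l = weight p1 l" if "l \<noteq> i" for l using that U Cons by simp
        \<comment> \<open>A block avoiding \<open>i\<close> would obstruct the tail as well.\<close>
        have i: "i \<in> {a..b}"
        proof (rule ccontr)
          assume "i \<notin> {a..b}"
          then have "weight p1 l \<noteq> 0" if "l \<in> {a..b}" for l using abw[of l] w[of l] that by (cases "l = i") auto
          then have "{a..b} \<subseteq> J" using J(2) by blast
          then show False using blk[OF J(1) x] ab by blast
        qed
        show ?thesis
        proof (cases "a = b")
          case True
          then show ?thesis using path_null_U[OF x U(2,3) _ _ U(4)] ab i U Cons by auto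
        next
          case False
          then have lt: "a < b" using ab(2) by simp
          then have "a \<in> x" "b - 1 \<in> x" using ab(7) by (auto simp: subset_iff)
          show ?thesis
          proof (cases "i = a")
            case True
            show ?thesis
              by (rule step[of b a "b - 1"])
                (use ab(1-3,5-7) abw lt \<open>b - 1 \<in> x\<close> True w[of b, symmetric] in \<open>auto simp: flippable_def in_flip\<close>)
          next
            case False
            show ?thesis
              by (rule step[of a "a + 1" b])
                (use ab(1-3,5-7) abw lt \<open>a \<in> x\<close> False w[of a, symmetric] in \<open>auto simp: flippable_def in_flip\<close>)
          qed
        qed
      qed
    next
      case (F i)
      \<comment> \<open>The obstruction is sought at the target \<open>z\<close> of the first arrow,
        where the tail begins. As \<open>i\<close> is in the support, the matchings containing the
        support are the same for \<open>x\<close> and for \<open>z\<close>.\<close>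
      define z where "z = flip i x"
      have z: "z \<in> os_states {0..n} k" using flip_state F z_def by blast
      have z': "z \<subseteq> {0..n}" "finite z" "card z \<le> n"
        using z kn os_state_subset os_state_finite os_state_card by blast+
      have xz: "x = flip i z" by (simp add: z_def)
      have fz: "flippable n i z" using F by (simp add: z_def)
      have p1: "(z, p1, y) \<in> os_paths n k" using F by (simp add: z_def)
      have tw: "total_weight p n = Suc (total_weight p1 n)"
        using F Cons by (auto simp: total_weight_simps flippable_def)
      show ?thesis
      proof (cases "\<exists>I. matching n z I \<and> {l. weight p1 l \<noteq> 0} \<subseteq> I")
        case False
        then have "path_null n k z p1 y" using less.hyps[OF _ p1] tw by auto
        then show ?thesis using path_null_F F Cons z_def by simp
      next
        case True
        then obtain J where J: "matching n z J" "{l. weight p1 l \<noteq> 0} \<subseteq> J" by blast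
        have wi: "weight p i \<noteq> 0" using F Cons by simp
        have w: "weight p l = weight p1 l" if "l \<noteq> i" for l using that F Cons by simp
        have front: "\<exists>q. path_eq n k x y p (F_arc i x # F_arc c z # q)"
          if c: "flippable n c z" "weight p1 c \<noteq> 0" for c
        proof -
          obtain q where q: "path_eq n k z y p1 (F_arc c z # q)"
            using path_eq_F_front[OF p1 J c] by blast
          then show ?thesis using path_eq_F[of n k i x y p1] F Cons z_def by blast
        qed
        have step: "path_null n k x p y"
          if c: "flippable n c z" "weight p1 c \<noteq> 0" "c \<noteq> i" "i \<noteq> c + 1" "c \<noteq> i + 1"
            and ab: "1 \<le> a" "a \<le> b" "b \<le> n" "\<And>l. l \<in> {a..b} \<Longrightarrow> weight p l \<noteq> 0 \<and> l \<noteq> c" "a - 1 \<notin> flip c z" "b \<notin> flip c z" for c a b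
        proof -
          obtain q where q: "path_eq n k x y p (F_arc i x # F_arc c z # q)" using front[OF c(1,2)] by blast
          have cx: "flippable n c x" using flippable_far[OF fz, of c] c by (simp add: xz)
          have cn: "1 \<le> c" "c \<le> n" using c(1) by (auto simp: flippable_def)
          note q
          also have "path_eq n k x y (F_arc i x # F_arc c z # q) (F_arc c x # F_arc i (flip c x) # q)"
            unfolding z_def using path_eqD(2)[OF q] F c cx x by (intro path_eq_far) (auto simp: z_def)
          finally have e: "path_eq n k x y p (F_arc c x # F_arc i (flip c x) # q)" .
          note we = fun_cong[OF path_eqD(3)[OF e]]
          have "path_null n k (flip c x) (F_arc i (flip c x) # q) y"
          proof (rule less.hyps)
            show "total_weight (F_arc i (flip c x) # q) n < total_weight p n"
              using total_weight_cong[OF path_eqD(3)[OF e], of n] cn by (simp add: total_weight_simps)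
            show pth: "(flip c x, F_arc i (flip c x) # q, y) \<in> os_paths n k" using path_eqD(2)[OF e] by simp
            fix I assume I: "matching n (flip c x) I"
            show "\<not> {l. weight (F_arc i (flip c x) # q) l \<noteq> 0} \<subseteq> I"
            proof
              assume s: "{l. weight (F_arc i (flip c x) # q) l \<noteq> 0} \<subseteq> I"
              have "weight (F_arc i (flip c x) # q) l \<noteq> 0" if "l \<in> {a..b}" for l
                using we[of l] ab(4)[OF that] by auto
              then have abI: "{a..b} \<subseteq> I" using s by blast
              have "i \<in> I" using s by auto
              then have "matching n (flip i (flip c x)) I"
                using matching_flip[of n i "flip c x" I] I pth os_state_finite[OF flip_state[OF cx x]] by simp
              then have "matching n (flip c z) I" by (simp add: z_def flip_commute)
              then show False using blk[OF _ flip_state[OF c(1) z]] ab abI by blast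
            qed
          qed
          then show ?thesis using path_null_eq[OF e] path_null_F cx x by blast
        qed
        have no: "\<not> {l. weight p l \<noteq> 0} \<subseteq> I" if "matching n z I" for I
        proof
          assume s: "{l. weight p l \<noteq> 0} \<subseteq> I"
          then have "i \<in> I" using wi by blast
          then have "matching n x I" using matching_flip[OF fz z'(2)] that by (simp add: xz)
          then show False using less.prems(2) s by blast
        qed
        obtain a b where ab: "1 \<le> a" "a \<le> b" "b \<le> n" "{a..b} \<subseteq> {l. weight p l \<noteq> 0}"
          "a - 1 \<notin> z" "b \<notin> z" "{a..<b} \<subseteq> z"
          using matching_or_block[OF z'(1,3) supp no] by blast
        have abw: "weight p l \<noteq> 0" if "a \<le> l" "l \<le> b" for l using subsetD[OF ab(4), of l] that by simp
        have i: "i \<in> {a..b}"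
        proof (rule ccontr)
          assume "i \<notin> {a..b}"
          then have "weight p1 l \<noteq> 0" if "l \<in> {a..b}" for l using abw[of l] w[of l] that by (cases "l = i") auto
          then have "{a..b} \<subseteq> J" using J(2) by blast
          then show False using blk[OF J(1) z] ab by blast
        qed
        have lt: "a < b" using fz i ab by (cases "a = b") (auto simp: flippable_def)
        then have mem: "a \<in> z" "b - 1 \<in> z" using ab(7) by (auto simp: subset_iff)
        \<comment> \<open>Both points next to an interior gap of the block are occupied, so such a
          gap is not flippable.\<close>
        have "i = a \<or> i = b"
        proof (rule ccontr)
          assume "\<not> (i = a \<or> i = b)"
          then have "i - 1 \<in> {a..<b}" "i \<in> {a..<b}" using i by auto
          then show False using ab(7) fz by (auto simp: flippable_def)
        qed
        then show ?thesis
        proof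
          assume ib: "i = b"
          have fa: "flippable n a z" "weight p1 a \<noteq> 0" using mem ab(1-3,5-7) abw lt w[of a, symmetric] ib by (auto simp: flippable_def)
          show ?thesis
          proof (cases "b = a + 1")
            case True
            obtain q where q: "path_eq n k x y p (F_arc i x # F_arc a z # q)" using front[OF fa] by blast
            \<comment> \<open>The two crossings are adjacent and do not commute; one point is
              carried across both gaps, which is a monomial relation.\<close>
            have "path_null n k x (F_arc (a + 1) x # F_arc a (flip (a + 1) x) # q) y"
              by (rule path_null_LL)
                (use x ab mem lt True ib path_eqD(2)[OF q] in \<open>auto simp: xz in_flip\<close>)
            then show ?thesis using path_null_eq[OF q] ib True by (simp add: z_def)
          next
            case False
            show ?thesis
              by (rule step[of a "a + 1" b])
                (use fa False ab(1-3,5-7) abw lt ib mem in \<open>auto simp: in_flip\<close>)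
          qed
        next
          assume ia: "i = a"
          have fb: "flippable n b z" "weight p1 b \<noteq> 0" using mem ab(1-3,5-7) abw lt w[of b, symmetric] ia by (auto simp: flippable_def)
          show ?thesis
          proof (cases "b = a + 1")
            case True
            obtain q where q: "path_eq n k x y p (F_arc i x # F_arc b z # q)" using front[OF fb] by blast
            have "path_null n k x (F_arc a x # F_arc (a + 1) (flip a x) # q) y"
              by (rule path_null_RR)
                (use x ab mem lt True ia path_eqD(2)[OF q] in \<open>auto simp: xz in_flip\<close>)
            then show ?thesis using path_null_eq[OF q] ia True by (simp add: z_def)
          next
            case False
            show ?thesis
              by (rule step[of b a "b - 1"])
                (use fb False ab(1-3,5-7) abw lt ia mem in \<open>auto simp: in_flip\<close>)
          qed
        qed
      qed
    qed
  qed
qed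

text \<open>After removing \<open>U\<close> arrows the weight is at most 1 and hence determined by
  the parities. Where the heights of \<open>x\<close> and \<open>y\<close> differ, they do so by one
  and at a gap of \<open>I\<close>; an extremal such gap can be crossed directly, which brings
  \<open>x\<close> closer to \<open>y\<close>.\<close>

lemma path_of_weight:
  assumes "x \<in> os_states {0..n} k" "y \<in> os_states {0..n} k" "matching n x I" "{l. w l \<noteq> 0} \<subseteq> I"
    and "\<And>j. j \<in> {1..n} \<Longrightarrow> even (w j) \<longleftrightarrow> (even (height x j) \<longleftrightarrow> even (height y j))"
  shows "\<exists>p. (x, p, y) \<in> os_paths n k \<and> weight p = w"
  using assms
proof (induct "\<Sum>j\<in>{1..n}. w j" arbitrary: x w rule: less_induct)
  case less
  note xs = less.prems(1) and ys = less.prems(2) and m = less.prems(3)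
  have In: "I \<subseteq> {1..n}" using m by (simp add: matching_def)
  have x': "x \<subseteq> {0..n}" "finite x" "card x = k" and y': "y \<subseteq> {0..n}" "finite y" "card y = k"
    using xs ys os_state_subset os_state_finite os_state_card by blast+
  \<comment> \<open>Off \<open>I\<close> the weight is zero, so the parities of \<open>x\<close> and
    \<open>y\<close> agree there.\<close>
  have my: "matching n y I"
  proof -
    have "even (height y j) \<longleftrightarrow> even (height I j)" if "j \<in> {1..n} - I" for j
    proof -
      have "w j = 0" using that less.prems(4) by blast
      then show ?thesis using less.prems(5)[of j] m that by (auto simp: matching_def)
    qed
    then show ?thesis using m x' y' by (auto simp: matching_def)
  qed
  note hx = matching_height[OF x'(1) m] and hy = matching_height[OF y'(1) my]
  have top: "height x (Suc n) = height y (Suc n)"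
    using height_top[of x "Suc n"] height_top[of y "Suc n"] x' y'
    by (simp add: atLeast0AtMost lessThan_Suc_atMost)
  have lt: "sum v {1..n} < sum w {1..n}"
    if "i \<in> I" "v i < w i" "\<And>j. j \<noteq> i \<Longrightarrow> v j = w j" for v :: "nat \<Rightarrow> nat" and i
  proof (rule sum_strict_mono_ex1)
    show "\<forall>j\<in>{1..n}. v j \<le> w j" using that by (metis less_imp_le order_refl)
    show "\<exists>a\<in>{1..n}. v a < w a" using that In by blast
  qed simp
  show ?case
  proof (cases "\<exists>i. w i \<ge> 2")
    case True
    then obtain i where i: "w i \<ge> 2" by blast
    then have iI: "i \<in> I" using less.prems(4) by auto
    define v where "v = w(i := w i - 2)"
    have "\<exists>p. (x, p, y) \<in> os_paths n k \<and> weight p = v"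
    proof (rule less.hyps[OF _ xs ys m])
      show "sum v {1..n} < sum w {1..n}" using lt[of i v] iI i by (simp add: v_def)
      show "{l. v l \<noteq> 0} \<subseteq> I" using less.prems(4) iI by (auto simp: v_def split: if_splits)
      fix j assume j: "j \<in> {1..n}"
      have "even (v j) \<longleftrightarrow> even (w j)" using i by (simp add: v_def)
      then show "even (v j) \<longleftrightarrow> (even (height x j) \<longleftrightarrow> even (height y j))"
        using less.prems(5)[OF j] by simp
    qed
    then obtain p where p: "(x, p, y) \<in> os_paths n k" "weight p = v" by blast
    have "weight (U_arc i x # p) = w" using p(2) i by (auto simp: fun_eq_iff v_def)
    then show ?thesis using p(1) iI In by (intro exI[of _ "U_arc i x # p"]) auto
  next
    case False
    then have w1: "w j \<le> 1" for j by (metis Suc_1 not_less_eq_eq)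
    have flipstep: ?thesis if i: "i \<in> I" "height x i \<noteq> height y i" and f: "flippable n i x" for i
    proof -
      define v where "v = w(i := 0)"
      have iI: "i \<in> I" by (rule i)
      then have "i \<le> Suc n" using In by auto
      then have "height x i = Suc (height y i) \<or> height y i = Suc (height x i)"
        using i hx[of i] hy[of i] by auto
      then have "odd (height x i + height y i)" by auto
      then have "odd (w i)" using less.prems(5)[of i] i(1) In by auto
      then have wi: "w i = 1" using w1[of i] by (cases "w i = 0") auto
      have "\<exists>p. (flip i x, p, y) \<in> os_paths n k \<and> weight p = v"
      proof (rule less.hyps[OF _ flip_state[OF f xs] ys])
        show "sum v {1..n} < sum w {1..n}" using lt[of i v] i wi by (simp add: v_def)
        show "matching n (flip i x) I" using matching_flip f x' i m by blast
        show "{l. v l \<noteq> 0} \<subseteq> I" using less.prems(4) iI by (auto simp: v_def split: if_splits)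
        fix j assume j: "j \<in> {1..n}"
        show "even (v j) \<longleftrightarrow> (even (height (flip i x) j) \<longleftrightarrow> even (height y j))"
          using less.prems(5)[OF j] height_flip_parity[OF f, of j] wi by (auto simp: v_def)
      qed
      then obtain p where p: "(flip i x, p, y) \<in> os_paths n k" "weight p = v" by blast
      have "weight (F_arc i x # p) = w" using p(2) wi by (auto simp: fun_eq_iff v_def)
      then show ?thesis using p(1) f xs by (intro exI[of _ "F_arc i x # p"]) auto
    qed
    have diffI: "j \<in> I" if "height x j \<noteq> height y j" "j \<le> Suc n" for j
      using hx[of j] hy[of j] that by (cases "j \<in> I") auto
    consider (pos) "\<exists>j. j \<le> n \<and> height y j < height x j" | (neg) "\<exists>j. j \<le> n \<and> height x j < height y j"
      | (eq) "\<forall>j\<le>n. height x j = height y j"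
      by (meson linorder_neqE_nat)
    then show ?thesis
    proof cases
      case pos
      \<comment> \<open>Points of \<open>x\<close> have to move right. Taking the last such gap
        guarantees that the point \<open>i\<close> is vacant.\<close>
      define i where "i = Max {j. j \<le> n \<and> height y j < height x j}"
      have fin: "finite {j. j \<le> n \<and> height y j < height x j}" by simp
      have i: "i \<le> n" "height y i < height x i" using Max_in[OF fin] pos by (auto simp: i_def)
      have max: "height x j \<le> height y j" if "i < j" "j \<le> n" for j
      proof (rule ccontr)
        assume "\<not> height x j \<le> height y j"
        then have "j \<le> i" unfolding i_def using that(2) by (intro Max_ge[OF fin]) auto
        then show False using that(1) by simp
      qed
      have iI: "i \<in> I" using diffI[of i] i by auto
      obtain i' where i': "i = Suc i'" using iI In by (cases i) auto
      have "height x i = height I i + 1" "height y i = height I i"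
        using hx[of i] hy[of i] i iI by auto
      moreover have "height x (Suc i) \<le> height y (Suc i)"
        using max[of "Suc i"] top i(1) by (cases "i = n") auto
      moreover have "height x i' \<le> height I i" using hx(2)[of i'] i i' by (simp add: height_Suc)
      ultimately have "i \<notin> x" "i' \<in> x"
        by (auto simp: height_Suc[of _ i] of_bool_def split: if_splits)
          (simp add: i' height_Suc of_bool_def split: if_splits)
      then have "flippable n i x" using i i' by (simp add: flippable_def)
      then show ?thesis using flipstep[OF iI] i by auto
    next
      case neg
      \<comment> \<open>Points of \<open>x\<close> have to move left. Taking the first such gap
        guarantees that the point \<open>i - 1\<close> is vacant.\<close>
      define i where "i = Min {j. j \<le> n \<and> height x j < height y j}"
      have fin: "finite {j. j \<le> n \<and> height x j < height y j}" by simp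
      have i: "i \<le> n" "height x i < height y i" using Min_in[OF fin] neg by (auto simp: i_def)
      have min: "height y j \<le> height x j" if "j < i" for j
      proof (rule ccontr)
        assume "\<not> height y j \<le> height x j"
        then have "i \<le> j" unfolding i_def using that i(1) by (intro Min_le[OF fin]) auto
        then show False using that by simp
      qed
      have iI: "i \<in> I" using diffI[of i] i by auto
      obtain i' where i': "i = Suc i'" using iI In by (cases i) auto
      have 1: "height y i = height I i + 1" "height x i = height I i"
        using hx[of i] hy[of i] i iI by auto
      have "height y i \<le> Suc (height y i')" by (simp add: i' height_Suc)
      then have "height x i \<le> height x i'" using min[of i'] 1 i' by simp
      then have "i' \<notin> x" by (auto simp: i' height_Suc)
      have "height I i + 1 \<le> height x (Suc i)" using hx(1)[of "Suc i"] i iI by (simp add: height_Suc)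
      then have "i \<in> x" using 1 by (auto simp: height_Suc[of _ i] of_bool_def split: if_splits)
      then have "flippable n i x" using i i' \<open>i' \<notin> x\<close> by (simp add: flippable_def)
      then show ?thesis using flipstep[OF iI] i by auto
    next
      case eq
      have "height x j = height y j" for j
      proof (cases "j \<le> n")
        case False
        then show ?thesis using x' y' height_top[of x j] height_top[of y j] by force
      qed (use eq in simp)
      then have xy: "x = y" using height_inj by blast
      have "w j = 0" for j
      proof (cases "j \<in> {1..n}")
        case True
        then have "even (w j)" using less.prems(5) xy by simp
        then show ?thesis using w1[of j] by (cases "w j = 1") auto
      next
        case False
        then show ?thesis using less.prems(4) In by blast
      qed
      then have "weight [] = w" by (auto simp: fun_eq_iff)
      then show ?thesis using xy xs by (intro exI[of _ "[]"]) auto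
    qed
  qed
qed

section \<open>The monomial of a path\<close>

text \<open>The coordinates at which the sign sequences of the two states differ, that is, the
  hyperplanes separating their regions.\<close>

definition parity_diff :: "nat set \<Rightarrow> nat set \<Rightarrow> nat set" where
  "parity_diff x y = {j. even (height x j) \<noteq> even (height y j)}"

text \<open>Geometrically, the monomial does not vanish in the summand of the two regions. Only its
  support matters, and \<open>I\<close> records the vertex that witnesses it.\<close>

definition admissible :: "nat \<Rightarrow> nat set \<Rightarrow> nat set \<Rightarrow> (nat \<Rightarrow>\<^sub>0 nat) \<Rightarrow> bool" where
  "admissible n x y m \<longleftrightarrow> (\<exists>I. matching n x I \<and> Poly_Mapping.keys m \<union> parity_diff x y \<subseteq> I)"

lemma matching_parity_diff:
  assumes "matching n x I" "card x = card y" "parity_diff x y \<subseteq> I"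
  shows "matching n y I"
proof -
  have "even (height x j) \<longleftrightarrow> even (height y j)" if "j \<notin> I" for j
    using assms(3) that by (auto simp: parity_diff_def)
  then show ?thesis using assms(1,2) by (auto simp: matching_def)
qed

lemma finite_weight: "finite {j. weight p j \<noteq> 0}"
proof (induct p)
  case (Cons a p)
  have "finite {j. label_weight (fst (snd a)) j \<noteq> 0}"
    by (cases "fst (snd a)") auto
  then have "finite ({j. label_weight (fst (snd a)) j \<noteq> 0} \<union> {j. weight p j \<noteq> 0})"
    using Cons by simp
  then show ?case by (rule rev_finite_subset) (auto simp: weight_def)
qed simp

definition path_monom :: "(nat set \<times> os_label \<times> nat set) list \<Rightarrow> nat \<Rightarrow>\<^sub>0 nat" where
  "path_monom p = Abs_poly_mapping (\<lambda>j. weight p j div 2)"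

lemma lookup_path_monom [simp]: "Poly_Mapping.lookup (path_monom p) j = weight p j div 2"
proof -
  have "finite {j. weight p j div 2 \<noteq> 0}" by (rule rev_finite_subset[OF finite_weight[of p]]) auto
  then show ?thesis by (simp add: path_monom_def)
qed

lemma path_monom_Nil [simp]: "path_monom [] = 0"
  by (rule poly_mapping_eqI) simp

lemma weight_path_monom:
  assumes "(x, p, y) \<in> os_paths n k"
  shows "weight p j = 2 * Poly_Mapping.lookup (path_monom p) j + of_bool (j \<in> parity_diff x y)"
  using weight_parity[OF assms, of j] by (auto simp: parity_diff_def)

lemma weight_keys:
  assumes "(x, p, y) \<in> os_paths n k"
  shows "{j. weight p j \<noteq> 0} = Poly_Mapping.keys (path_monom p) \<union> parity_diff x y"
  using weight_path_monom[OF assms] by (auto simp: in_keys_iff simp del: lookup_path_monom)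

lemma admissible_path:
  assumes "(x, p, y) \<in> os_paths n k"
  shows "admissible n x y (path_monom p) \<longleftrightarrow> (\<exists>I. matching n x I \<and> {j. weight p j \<noteq> 0} \<subseteq> I)"
  unfolding admissible_def weight_keys[OF assms] ..

lemma path_of_monom:
  assumes "x \<in> os_states {0..n} k" "y \<in> os_states {0..n} k" "admissible n x y m"
  shows "\<exists>p. (x, p, y) \<in> os_paths n k \<and> path_monom p = m"
proof -
  obtain I where I: "matching n x I" "Poly_Mapping.keys m \<union> parity_diff x y \<subseteq> I"
    using assms(3) by (auto simp: admissible_def)
  define w where "w j = 2 * Poly_Mapping.lookup m j + of_bool (j \<in> parity_diff x y)" for j
  have "\<exists>p. (x, p, y) \<in> os_paths n k \<and> weight p = w"
  proof (rule path_of_weight[OF assms(1,2) I(1)])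
    show "{l. w l \<noteq> 0} \<subseteq> I" using I(2) by (auto simp: w_def in_keys_iff)
    show "even (w j) \<longleftrightarrow> (even (height x j) \<longleftrightarrow> even (height y j))" for j
      by (simp add: w_def parity_diff_def)
  qed
  then obtain p where p: "(x, p, y) \<in> os_paths n k" "weight p = w" by blast
  have "path_monom p = m" by (rule poly_mapping_eqI) (simp add: p(2) w_def)
  with p show ?thesis by blast
qed

definition sqfree_monom :: "nat set \<Rightarrow> nat \<Rightarrow>\<^sub>0 nat" where
  "sqfree_monom S = (\<Sum>i\<in>S. Poly_Mapping.single i 1)"

lemma lookup_sqfree_monom:
  "finite S \<Longrightarrow> Poly_Mapping.lookup (sqfree_monom S) j = of_bool (j \<in> S)"
  by (simp add: sqfree_monom_def lookup_sum lookup_single when_def)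

lemma keys_sqfree_monom: "finite S \<Longrightarrow> Poly_Mapping.keys (sqfree_monom S) = S"
  by (auto simp: in_keys_iff lookup_sqfree_monom)

lemma u_mon_eq: "u_mon S = frag_of (sqfree_monom S)"
  by (induct S rule: infinite_finite_induct)
    (simp_all add: u_mon_def sqfree_monom_def u_var_def mult_single)

lemma keys_add_nat: "Poly_Mapping.keys (a + b) = Poly_Mapping.keys a \<union> Poly_Mapping.keys (b :: nat \<Rightarrow>\<^sub>0 nat)"
  by (auto simp: in_keys_iff lookup_add)

text \<open>The set \<open>S(\<alpha>\<beta>\<gamma>)\<close> for the sign sequences of the three
  states: the gaps at which the middle one differs from both others.\<close>

definition conv_gaps :: "nat set \<Rightarrow> nat set \<Rightarrow> nat set \<Rightarrow> nat set" where
  "conv_gaps x y z = parity_diff x y \<inter> parity_diff y z"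

lemma parity_diff_subset:
  assumes "x \<in> os_states {0..n} k" "y \<in> os_states {0..n} k"
  shows "parity_diff x y \<subseteq> {1..n}"
proof
  fix j assume j: "j \<in> parity_diff x y"
  have "x \<subseteq> {..<j}" "y \<subseteq> {..<j}" if "n < j" using assms that os_state_subset by force+
  then have "j \<le> n" using j height_top[of x j] height_top[of y j] os_state_card assms
    by (fastforce simp: parity_diff_def not_less[symmetric])
  moreover have "j \<noteq> 0" using j by (intro notI) (simp add: parity_diff_def)
  ultimately show "j \<in> {1..n}" by simp
qed

lemma finite_conv_gaps:
  assumes "x \<in> os_states {0..n} k" "y \<in> os_states {0..n} k"
  shows "finite (conv_gaps x y z)"
  using finite_subset[OF parity_diff_subset[OF assms]] by (simp add: conv_gaps_def)

text \<open>Halving the sum of two weights differs from the sum of the halves by a carry, exactly at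
  the gaps where both weights are odd; these are the gaps in \<open>conv_gaps\<close>.\<close>

lemma path_monom_append:
  assumes "(x, p, y) \<in> os_paths n k" "(y, q, z) \<in> os_paths n k"
  shows "path_monom (p @ q) = sqfree_monom (conv_gaps x y z) + path_monom p + path_monom q"
proof (rule poly_mapping_eqI)
  fix j
  have "finite (conv_gaps x y z)"
    using quiver_paths_ends[OF wf_os_quiver assms(1)] by (intro finite_conv_gaps) simp_all
  moreover have "j \<in> conv_gaps x y z \<longleftrightarrow> odd (weight p j) \<and> odd (weight q j)"
    using weight_parity[OF assms(1), of j] weight_parity[OF assms(2), of j]
    by (simp add: conv_gaps_def parity_diff_def)
  moreover have "(a + b) div 2 = of_bool (odd a \<and> odd b) + a div 2 + b div 2" for a b :: nat
    by (auto elim!: evenE oddE)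
  ultimately show "Poly_Mapping.lookup (path_monom (p @ q)) j =
    Poly_Mapping.lookup (sqfree_monom (conv_gaps x y z) + path_monom p + path_monom q) j"
    by (simp add: lookup_add lookup_sqfree_monom)
qed

text \<open>A gap separating \<open>x\<close> from \<open>y\<close> either separates
  \<open>x\<close> from \<open>z\<close> or lies in \<open>conv_gaps\<close>. So a set
  \<open>I\<close> that is admissible for the product contains all separating gaps and matches the
  middle state too.\<close>

lemma not_admissible_conv:
  assumes "x \<in> os_states {0..n} k" "y \<in> os_states {0..n} k"
    and a: "\<not> admissible n x y m1 \<or> \<not> admissible n y z m2"
  shows "\<not> admissible n x z (sqfree_monom (conv_gaps x y z) + m1 + m2)"
proof
  assume "admissible n x z (sqfree_monom (conv_gaps x y z) + m1 + m2)"
  moreover have fin: "finite (conv_gaps x y z)" by (rule finite_conv_gaps[OF assms(1,2)])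
  ultimately obtain I where I: "matching n x I"
    "conv_gaps x y z \<union> Poly_Mapping.keys m1 \<union> Poly_Mapping.keys m2 \<union> parity_diff x z \<subseteq> I"
    by (auto simp: admissible_def keys_add_nat keys_sqfree_monom)
  have d: "parity_diff x y \<subseteq> I" "parity_diff y z \<subseteq> I"
    using I(2) by (auto simp: conv_gaps_def parity_diff_def)
  then have "matching n y I"
    using matching_parity_diff[OF I(1)] assms(1,2) os_state_card by blast
  then show False using a I d by (auto simp: admissible_def)
qed

section \<open>The kernel of the map to monomials\<close>

definition path_poly ::
  "nat set \<Rightarrow> nat set \<Rightarrow> ((nat set, nat set \<times> os_label \<times> nat set) path \<Rightarrow>\<^sub>0 int) \<Rightarrow> (nat \<Rightarrow>\<^sub>0 nat) \<Rightarrow>\<^sub>0 int" where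
  "path_poly x y = frag_extend (\<lambda>(x', p, y'). if x' = x \<and> y' = y then frag_of (path_monom p) else 0)"

lemma path_poly_simps [simp]:
  "path_poly x y 0 = 0"
  "path_poly x y (f + g) = path_poly x y f + path_poly x y g"
  "path_poly x y (f - g) = path_poly x y f - path_poly x y g"
  "path_poly x y (- f) = - path_poly x y f"
  "path_poly x y (frag_cmul c f) = frag_cmul c (path_poly x y f)"
  "path_poly x y (frag_of (x', p, y')) = (if x' = x \<and> y' = y then frag_of (path_monom p) else 0)"
  by (simp_all add: path_poly_def frag_extend_add frag_extend_diff frag_extend_minus frag_extend_cmul)

lemma path_poly_sum: "finite A \<Longrightarrow> path_poly x y (sum f A) = (\<Sum>a\<in>A. path_poly x y (f a))"
  by (induct A rule: finite_induct) simp_all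

text \<open>By bilinearity it suffices to treat single paths, where only the target of the left
  factor contributes to the sum over \<open>y\<close>.\<close>

lemma path_poly_mult:
  assumes "Poly_Mapping.keys f \<subseteq> os_paths n k" "Poly_Mapping.keys g \<subseteq> os_paths n k"
  shows "path_poly x z (path_mult f g) =
    (\<Sum>y\<in>os_states {0..n} k. u_mon (conv_gaps x y z) * path_poly x y f * path_poly y z g)"
  using assms(1)
proof (induct f rule: frag_induction)
  case (one s)
  obtain x1 p y1 where s: "s = (x1, p, y1)" by (cases s)
  show ?case
    using assms(2)
  proof (induct g rule: frag_induction)
    case (one t)
    obtain y2 q z2 where t: "t = (y2, q, z2)" by (cases t)
    have st: "(x1, p, y1) \<in> os_paths n k" "(y2, q, z2) \<in> os_paths n k" using one \<open>s \<in> _\<close> s t by auto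
    have y1: "y1 \<in> os_states {0..n} k" using quiver_paths_ends[OF wf_os_quiver st(1)] by simp
    have "(\<Sum>y\<in>os_states {0..n} k. u_mon (conv_gaps x y z) * path_poly x y (frag_of s) * path_poly y z (frag_of t)) =
      (\<Sum>y\<in>os_states {0..n} k. if y = y1 then u_mon (conv_gaps x y z) * path_poly x y1 (frag_of s) * path_poly y1 z (frag_of t) else 0)"
      by (intro sum.cong refl) (auto simp: s)
    also have "\<dots> = u_mon (conv_gaps x y1 z) * path_poly x y1 (frag_of s) * path_poly y1 z (frag_of t)"
      using y1 by simp
    also have "\<dots> = path_poly x z (path_mult (frag_of s) (frag_of t))"
      using path_monom_append[OF st(1), of q z2] st(2)
      by (auto simp: s t path_mult_frag_of u_mon_eq mult_single)
    finally show ?case by simp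
  qed (simp_all add: path_mult_diff_right right_diff_distrib sum_subtractf)
qed (simp_all add: path_mult_diff_left left_diff_distrib right_diff_distrib sum_subtractf)

definition inadmissible :: "nat \<Rightarrow> nat set \<Rightarrow> nat set \<Rightarrow> ((nat \<Rightarrow>\<^sub>0 nat) \<Rightarrow>\<^sub>0 int) set" where
  "inadmissible n x y = {q. \<forall>m\<in>Poly_Mapping.keys q. \<not> admissible n x y m}"

lemma inadmissible_iff: "q \<in> inadmissible n x y \<longleftrightarrow> (\<forall>m. admissible n x y m \<longrightarrow> Poly_Mapping.lookup q m = 0)"
  by (auto simp: inadmissible_def in_keys_iff)

lemma inadmissible_zero [simp]: "0 \<in> inadmissible n x y"
  and inadmissible_add: "q \<in> inadmissible n x y \<Longrightarrow> r \<in> inadmissible n x y \<Longrightarrow> q + r \<in> inadmissible n x y"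
  and inadmissible_diff: "q \<in> inadmissible n x y \<Longrightarrow> r \<in> inadmissible n x y \<Longrightarrow> q - r \<in> inadmissible n x y"
  and inadmissible_uminus: "q \<in> inadmissible n x y \<Longrightarrow> - q \<in> inadmissible n x y"
  by (auto simp: inadmissible_iff lookup_add lookup_minus)

lemma inadmissible_sum: "(\<And>a. a \<in> A \<Longrightarrow> f a \<in> inadmissible n x y) \<Longrightarrow> sum f A \<in> inadmissible n x y"
  by (induct A rule: infinite_finite_induct) (auto intro: inadmissible_add)

lemma inadmissible_conv:
  assumes "x \<in> os_states {0..n} k" "y \<in> os_states {0..n} k"
    and "q \<in> inadmissible n x y \<or> r \<in> inadmissible n y z"
  shows "u_mon (conv_gaps x y z) * q * r \<in> inadmissible n x z"
proof -
  have "\<not> admissible n x z m" if m: "m \<in> Poly_Mapping.keys (u_mon (conv_gaps x y z) * q * r)" for m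
  proof -
    obtain a m2 where a: "m = a + m2" "a \<in> Poly_Mapping.keys (u_mon (conv_gaps x y z) * q)" "m2 \<in> Poly_Mapping.keys r"
      using subsetD[OF keys_mult m] by blast
    obtain m1 where m1: "a = sqfree_monom (conv_gaps x y z) + m1" "m1 \<in> Poly_Mapping.keys q"
      using a(2) keys_mult[of "u_mon (conv_gaps x y z)" q] by (auto simp: u_mon_eq)
    have "\<not> admissible n x y m1 \<or> \<not> admissible n y z m2"
      using assms(3) m1(2) a(3) by (auto simp: inadmissible_def)
    then show ?thesis using not_admissible_conv[OF assms(1,2)] a m1 by simp
  qed
  then show ?thesis by (simp add: inadmissible_def)
qed

definition path_kernel :: "nat \<Rightarrow> nat \<Rightarrow> ((nat set, nat set \<times> os_label \<times> nat set) path \<Rightarrow>\<^sub>0 int) set" where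
  "path_kernel n k = {f. Poly_Mapping.keys f \<subseteq> os_paths n k \<and>
     (\<forall>x\<in>os_states {0..n} k. \<forall>y\<in>os_states {0..n} k. path_poly x y f \<in> inadmissible n x y)}"

lemma ideal_path_kernel: "ideal (path_kernel n k) (path_algebra (os_quiver n k))"
proof (rule idealI[OF ring_os_path_algebra])
  interpret R: ring "path_algebra (os_quiver n k)" by (rule ring_os_path_algebra)
  show "subgroup (path_kernel n k) (add_monoid (path_algebra (os_quiver n k)))"
  proof (rule R.add.subgroupI)
    show "path_kernel n k \<subseteq> carrier (path_algebra (os_quiver n k))"
      by (auto simp: path_kernel_def carrier_path_algebra)
    have "0 \<in> path_kernel n k" by (simp add: path_kernel_def)
    then show "path_kernel n k \<noteq> {}" by blast
    fix f g assume f: "f \<in> path_kernel n k" and g: "g \<in> path_kernel n k"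
    have "f \<in> carrier (path_algebra (os_quiver n k))" "- f \<in> carrier (path_algebra (os_quiver n k))"
      using f by (simp_all add: path_kernel_def carrier_path_algebra)
    then have "\<ominus>\<^bsub>path_algebra (os_quiver n k)\<^esub> f = - f"
      by (intro R.minus_equality) (simp_all add: add_path_algebra zero_path_algebra)
    then show "\<ominus>\<^bsub>path_algebra (os_quiver n k)\<^esub> f \<in> path_kernel n k"
      using f by (simp add: path_kernel_def inadmissible_uminus)
    show "f \<oplus>\<^bsub>path_algebra (os_quiver n k)\<^esub> g \<in> path_kernel n k"
      using f g keys_add[of f g] by (auto simp: path_kernel_def add_path_algebra intro!: inadmissible_add)
  qed
  fix f g assume f: "f \<in> path_kernel n k" and g: "g \<in> carrier (path_algebra (os_quiver n k))"
  have k: "Poly_Mapping.keys f \<subseteq> os_paths n k" "Poly_Mapping.keys g \<subseteq> os_paths n k"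
    using f g by (simp_all add: path_kernel_def carrier_path_algebra)
  have fi: "path_poly x y f \<in> inadmissible n x y" if "x \<in> os_states {0..n} k" "y \<in> os_states {0..n} k" for x y
    using f that by (simp add: path_kernel_def)
  show "g \<otimes>\<^bsub>path_algebra (os_quiver n k)\<^esub> f \<in> path_kernel n k"
    unfolding mult_path_algebra path_kernel_def
    using path_mult_closed[OF k(2,1)]
    by (auto simp: path_poly_mult[OF k(2,1)] intro!: inadmissible_sum inadmissible_conv fi)
  show "f \<otimes>\<^bsub>path_algebra (os_quiver n k)\<^esub> g \<in> path_kernel n k"
    unfolding mult_path_algebra path_kernel_def
    using path_mult_closed[OF k]
    by (auto simp: path_poly_mult[OF k] intro!: inadmissible_sum inadmissible_conv fi)
qed

text \<open>The commutation relations preserve weights, so both sides have the same monomial. In the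
  monomial relations the support contains gaps with too few adjacent points.\<close>

lemma os_relations_kernel: "os_relations n k \<subseteq> path_kernel n k"
proof
  fix f assume "f \<in> os_relations n k"
  then consider (eq) x p q y where "f = frag_of (x, p, y) - frag_of (x, q, y)"
      "(x, p, y) \<in> os_paths n k" "(x, q, y) \<in> os_paths n k" "os_eq_rel (path_labels p) (path_labels q)"
    | (zero) x p y where "f = frag_of (x, p, y)" "(x, p, y) \<in> os_paths n k" "os_zero_rel (path_labels p) x"
    unfolding os_relations_def by blast
  then show "f \<in> path_kernel n k"
  proof cases
    case eq
    have "path_monom p = path_monom q"
      by (rule poly_mapping_eqI) (simp add: weight_os_eq_rel[OF eq(4)])
    then have "path_poly x' y' f = 0" for x' y' by (simp add: eq(1))
    moreover have "Poly_Mapping.keys f \<subseteq> os_paths n k"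
      using eq keys_diff[of "frag_of (x, p, y)" "frag_of (x, q, y)"] by auto
    ultimately show ?thesis by (simp add: path_kernel_def)
  next
    case zero
    have x: "x \<in> os_states {0..n} k" using quiver_paths_ends(1)[OF wf_os_quiver zero(2)] by simp
    note x' = os_state_subset[OF x]
    have "\<not> admissible n x y (path_monom p)"
    proof
      assume "admissible n x y (path_monom p)"
      then obtain I where I: "matching n x I" "{j. weight p j \<noteq> 0} \<subseteq> I"
        using admissible_path[OF zero(2)] by blast
      note w = weight_labels[of p]
      from zero(3) show False
      proof cases
        case (U0 i)
        then have "i \<in> I" using I(2) by (auto simp: w)
        moreover have "i \<in> {1..n}" using calculation I(1) by (auto simp: matching_def)
        ultimately show False using not_matching_block[OF x' I(1), of i i] U0 by auto
      next
        case (RR0 i)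
        obtain i' where i': "i = Suc (Suc i')" using less_imp_Suc_add[OF RR0(2)] by auto
        obtain a b where p: "p = [a, b]" "fst (snd a) = R_arr (Suc i')" "fst (snd b) = R_arr i"
          using RR0(1) i' by (auto simp: path_labels_def split_beta map_eq_Cons_conv)
        have "(x, a # [b], y) \<in> os_paths n k" using zero(2) p by simp
        then have f: "a = F_arc (Suc i') x" "flippable n (Suc i') x" "Suc i' \<notin> x"
          "(flip (Suc i') x, b # [], y) \<in> os_paths n k"
          by (cases rule: os_paths_Cons_cases; use p in \<open>auto simp: F_arc_def U_arc_def split: if_splits\<close>)+
        from f(4) have "flippable n i (flip (Suc i') x)" "i \<notin> flip (Suc i') x"
          by (cases rule: os_paths_Cons_cases; use p in \<open>auto simp: F_arc_def U_arc_def split: if_splits\<close>)+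
        then have ix: "i \<notin> x" "i \<le> n" by (auto simp: in_flip flippable_def i')
        have iI: "Suc i' \<in> I" "i \<in> I" using I(2) by (auto simp: w RR0(1) i')
        have "i' \<in> x" using f(2,3) by (simp add: flippable_def)
        \<comment> \<open>Both gaps need a point, but \<open>i'\<close> is the only occupied one of
          the three points next to them.\<close>
        then have "height x (Suc i) = height x i' + 1"
          using ix f(3) by (simp add: i' height_Suc)
        moreover have "height I (Suc i) = height I (Suc i') + 2"
          using iI by (simp add: i' height_Suc)
        moreover have "height x i' \<le> height I (Suc i')"
          using matching_height(2)[OF x' I(1), of i'] ix by (simp add: height_Suc i')
        moreover have "height I (Suc i) \<le> height x (Suc i)"
          using matching_height(1)[OF x' I(1), of "Suc i"] ix by simp
        ultimately show False by simp
      next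
        case (LL0 i)
        obtain i' where i': "i = Suc (Suc i')" using less_imp_Suc_add[OF LL0(2)] by auto
        obtain a b where p: "p = [a, b]" "fst (snd a) = L_arr i" "fst (snd b) = L_arr (Suc i')"
          using LL0(1) i' by (auto simp: path_labels_def split_beta map_eq_Cons_conv)
        have "(x, a # [b], y) \<in> os_paths n k" using zero(2) p by simp
        then have f: "a = F_arc i x" "flippable n i x" "i \<in> x" "(flip i x, b # [], y) \<in> os_paths n k"
          by (cases rule: os_paths_Cons_cases; use p in \<open>auto simp: F_arc_def U_arc_def split: if_splits\<close>)+
        from f(4) have "flippable n (Suc i') (flip i x)" "Suc i' \<in> flip i x"
          by (cases rule: os_paths_Cons_cases; use p in \<open>auto simp: F_arc_def U_arc_def split: if_splits\<close>)+
        then have ix: "Suc i' \<notin> x" "i' \<notin> x" "i \<le> n" using f(2,3) by (auto simp: in_flip flippable_def i')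
        have "Suc i' \<in> I" using I(2) by (auto simp: w LL0(1) i')
        then show False using not_matching_block[OF x' I(1), of "Suc i'" "Suc i'"] ix i' by auto
      qed
    qed
    then have "path_poly x' y' f \<in> inadmissible n x' y'" for x' y'
      by (auto simp: zero(1) inadmissible_def)
    then show ?thesis using zero by (auto simp: path_kernel_def)
  qed
qed

lemma os_ideal_subset_kernel: "os_ideal n k \<subseteq> path_kernel n k"
  unfolding os_ideal_def
  by (rule ring.genideal_minimal[OF ring_os_path_algebra ideal_path_kernel os_relations_kernel])

lemma os_ideal_cmul:
  assumes "f \<in> os_ideal n k"
  shows "frag_cmul c f \<in> os_ideal n k"
proof -
  have pos: "frag_cmul (int m) f \<in> os_ideal n k" for m
    by (induct m) (auto simp: frag_cmul_distrib os_ideal_zero intro!: os_ideal_add assms)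
  show ?thesis
  proof (cases "c \<ge> 0")
    case True
    then show ?thesis using pos[of "nat c"] by simp
  next
    case False
    then have c: "c = - int (nat (- c))" by simp
    show ?thesis
      by (subst c) (metis minus_frag_cmul os_ideal_uminus pos)
  qed
qed

lemma lookup_path_poly:
  "Poly_Mapping.lookup (path_poly x y f) m =
    (\<Sum>t\<in>Poly_Mapping.keys f. Poly_Mapping.lookup f t * of_bool (fst t = x \<and> snd (snd t) = y \<and> path_monom (fst (snd t)) = m))"
  unfolding path_poly_def frag_extend_def lookup_sum
  by (intro sum.cong refl) (auto simp: split_beta)

text \<open>Induction on the number of paths that occur. An inadmissible path is itself in the
  ideal. An admissible one cannot occur alone, because the coefficient of its monomial cancels; its
  difference with another path of the same ends and monomial is in the ideal, and subtracting a
  multiple removes it without adding new paths.\<close>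

lemma kernel_subset_os_ideal:
  assumes "k \<le> n" "f \<in> path_kernel n k"
  shows "f \<in> os_ideal n k"
  using assms(2)
proof (induct "card (Poly_Mapping.keys f)" arbitrary: f rule: less_induct)
  case less
  show ?case
  proof (cases "f = 0")
    case True
    then show ?thesis by (simp add: os_ideal_zero)
  next
    case False
    then obtain t where t: "t \<in> Poly_Mapping.keys f" using keys_eq_empty[of f] by blast
    obtain x p y where xpy: "t = (x, p, y)" by (cases t)
    have P: "(x, p, y) \<in> os_paths n k" using less.prems t xpy by (auto simp: path_kernel_def)
    have xy: "x \<in> os_states {0..n} k" "y \<in> os_states {0..n} k"
      using quiver_paths_ends[OF wf_os_quiver P] by simp_all
    define c where "c = Poly_Mapping.lookup f t"
    have "\<exists>d. d \<in> os_ideal n k \<and> Poly_Mapping.lookup d t = 1 \<and> Poly_Mapping.keys d \<subseteq> Poly_Mapping.keys f"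
    proof (cases "admissible n x y (path_monom p)")
      case False
      then have "path_null n k x p y"
        using path_null_unmatched[OF assms(1) P] admissible_path[OF P] by blast
      then show ?thesis using t xpy by (intro exI[of _ "frag_of t"]) (auto simp: path_null_def)
    next
      case True
      then have "Poly_Mapping.lookup (path_poly x y f) (path_monom p) = 0"
        using less.prems xy by (auto simp: path_kernel_def inadmissible_iff)
      moreover define h where "h s = Poly_Mapping.lookup f s *
          of_bool (fst s = x \<and> snd (snd s) = y \<and> path_monom (fst (snd s)) = path_monom p)" for s
      moreover have "Poly_Mapping.lookup (path_poly x y f) (path_monom p) = sum h (Poly_Mapping.keys f)"
        unfolding lookup_path_poly h_def ..
      ultimately have "sum h (Poly_Mapping.keys f) = 0" by simp
      then have "h t + sum h (Poly_Mapping.keys f - {t}) = 0" using t by (simp add: sum.remove[of _ t])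
      moreover have "h t \<noteq> 0" using t by (simp add: h_def xpy in_keys_iff)
      ultimately have "sum h (Poly_Mapping.keys f - {t}) \<noteq> 0" by simp
      then obtain s where s': "s \<in> Poly_Mapping.keys f - {t}" "h s \<noteq> 0"
        by (rule sum.not_neutral_contains_not_neutral)
      then have s: "s \<in> Poly_Mapping.keys f" "s \<noteq> t" "fst s = x" "snd (snd s) = y"
        "path_monom (fst (snd s)) = path_monom p"
        by (auto simp: h_def split: if_splits)
      define q where "q = fst (snd s)"
      have sq: "s = (x, q, y)" using s by (simp add: q_def prod_eq_iff)
      have Q: "(x, q, y) \<in> os_paths n k" using less.prems s sq by (auto simp: path_kernel_def)
      have "path_monom q = path_monom p" using s(5) by (simp add: q_def)
      \<comment> \<open>Equal ends give equal parities, so equal monomials mean equal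
        weights.\<close>
      then have "weight p j = weight q j" for j
        unfolding weight_path_monom[OF P] weight_path_monom[OF Q] by (simp only:)
      then have "weight p = weight q" by blast
      moreover obtain I where "matching n x I" "{j. weight p j \<noteq> 0} \<subseteq> I"
        using True admissible_path[OF P] by blast
      ultimately have "path_eq n k x y p q" using path_eq_if_weight_eq[OF P Q] by blast
      then have "frag_of t - frag_of s \<in> os_ideal n k" by (simp add: path_eq_def xpy sq)
      moreover have "Poly_Mapping.keys (frag_of t - frag_of s) \<subseteq> Poly_Mapping.keys f"
        using keys_diff[of "frag_of t" "frag_of s"] t s by auto
      ultimately show ?thesis using s(2) by (intro exI[of _ "frag_of t - frag_of s"]) (auto simp: lookup_minus)
    qed
    then obtain d where d: "d \<in> os_ideal n k" "Poly_Mapping.lookup d t = 1" "Poly_Mapping.keys d \<subseteq> Poly_Mapping.keys f"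
      by blast
    define g where "g = f - frag_cmul c d"
    have "Poly_Mapping.keys g \<subseteq> Poly_Mapping.keys f - {t}"
    proof
      fix s assume "s \<in> Poly_Mapping.keys g"
      then show "s \<in> Poly_Mapping.keys f - {t}"
        using d(2,3) by (auto simp: g_def in_keys_iff lookup_minus c_def)
    qed
    then have card: "card (Poly_Mapping.keys g) < card (Poly_Mapping.keys f)"
      using t by (meson Diff_subset card_Diff1_less card_mono finite_Diff finite_keys le_less_trans)
    have dk: "frag_cmul c d \<in> os_ideal n k" using os_ideal_cmul d(1) by blast
    then have "frag_cmul c d \<in> path_kernel n k" using os_ideal_subset_kernel by blast
    then have "g \<in> path_kernel n k"
      using less.prems keys_diff[of f "frag_cmul c d"]
      by (auto simp: path_kernel_def g_def intro!: inadmissible_diff)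
    then have "g \<in> os_ideal n k" using less.hyps card by blast
    then have "g + frag_cmul c d \<in> os_ideal n k" using dk os_ideal_add by blast
    then show ?thesis by (simp add: g_def)
  qed
qed

lemma os_ideal_eq_kernel: "k \<le> n \<Longrightarrow> os_ideal n k = path_kernel n k"
  using os_ideal_subset_kernel kernel_subset_os_ideal by blast

section \<open>The monomial ideals of the hypertoric algebra\<close>

lemma carrier_poly_ring: "carrier (poly_ring n) = {p. \<forall>m\<in>Poly_Mapping.keys p. Poly_Mapping.keys m \<subseteq> {1..n}}"
  and mult_poly_ring: "monoid.mult (poly_ring n) = (*)"
  and add_poly_ring: "add (poly_ring n) = (+)"
  and one_poly_ring: "\<one>\<^bsub>poly_ring n\<^esub> = 1"
  and zero_poly_ring: "\<zero>\<^bsub>poly_ring n\<^esub> = 0"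
  by (simp_all add: poly_ring_def)

lemma poly_ring_add_closed:
  "p \<in> carrier (poly_ring n) \<Longrightarrow> q \<in> carrier (poly_ring n) \<Longrightarrow> p + q \<in> carrier (poly_ring n)"
  and poly_ring_uminus_closed: "p \<in> carrier (poly_ring n) \<Longrightarrow> - p \<in> carrier (poly_ring n)"
  and poly_ring_diff_closed:
  "p \<in> carrier (poly_ring n) \<Longrightarrow> q \<in> carrier (poly_ring n) \<Longrightarrow> p - q \<in> carrier (poly_ring n)"
  using keys_add[of p q] keys_diff[of p q] by (auto simp: carrier_poly_ring dest!: subsetD)

lemma poly_ring_mult_closed:
  assumes "p \<in> carrier (poly_ring n)" "q \<in> carrier (poly_ring n)"
  shows "p * q \<in> carrier (poly_ring n)"
proof -
  have "Poly_Mapping.keys m \<subseteq> {1..n}" if m: "m \<in> Poly_Mapping.keys (p * q)" for m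
  proof -
    obtain a b where ab: "m = a + b" "a \<in> Poly_Mapping.keys p" "b \<in> Poly_Mapping.keys q"
      using subsetD[OF keys_mult m] by blast
    then have "Poly_Mapping.keys a \<subseteq> {1..n}" "Poly_Mapping.keys b \<subseteq> {1..n}"
      using assms by (auto simp only: carrier_poly_ring mem_Collect_eq)
    then show ?thesis by (simp add: ab keys_add_nat)
  qed
  then show ?thesis by (simp add: carrier_poly_ring)
qed

lemma cring_poly_ring: "cring (poly_ring n)"
proof (rule cringI)
  show "abelian_group (poly_ring n)"
  proof (rule abelian_groupI)
    fix p assume "p \<in> carrier (poly_ring n)"
    then show "\<exists>q\<in>carrier (poly_ring n). q \<oplus>\<^bsub>poly_ring n\<^esub> p = \<zero>\<^bsub>poly_ring n\<^esub>"
      by (intro bexI[of _ "- p"]) (simp_all add: add_poly_ring zero_poly_ring poly_ring_uminus_closed)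
  qed (auto simp: add_poly_ring zero_poly_ring poly_ring_add_closed, simp add: carrier_poly_ring)
  show "comm_monoid (poly_ring n)"
    by (rule comm_monoidI)
      (auto simp: mult_poly_ring one_poly_ring mult.assoc mult.commute intro: poly_ring_mult_closed,
       simp add: carrier_poly_ring)
qed (simp add: add_poly_ring mult_poly_ring distrib_right)

lemma u_mon_carrier: "S \<subseteq> {1..n} \<Longrightarrow> u_mon S \<in> carrier (poly_ring n)"
  using keys_sqfree_monom[of S] finite_subset[of S "{1..n}"] by (simp add: carrier_poly_ring u_mon_eq)

lemma hyp_inter_mono: "S \<subseteq> T \<Longrightarrow> hyp_inter \<eta> T \<subseteq> hyp_inter \<eta> S"
  by (auto simp: hyp_inter_def)

text \<open>The generators are closed under enlarging \<open>S\<close>, because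
  \<open>hyp_inter\<close> shrinks. Hence the ideal is spanned by the monomials whose set of
  variables is the index of a generator.\<close>

lemma hyp_ideal_eq:
  "hyp_ideal n \<eta> \<alpha> \<beta> = {q \<in> carrier (poly_ring n). \<forall>m\<in>Poly_Mapping.keys q.
     region n \<eta> \<alpha> \<inter> region n \<eta> \<beta> \<inter> hyp_inter \<eta> (Poly_Mapping.keys m) = {}}" (is "_ = ?J")
proof
  interpret R: cring "poly_ring n" by (rule cring_poly_ring)
  let ?gen = "{u_mon S | S. S \<subseteq> {1..n} \<and> region n \<eta> \<alpha> \<inter> region n \<eta> \<beta> \<inter> hyp_inter \<eta> S = {}}"
  have gen: "?gen \<subseteq> carrier (poly_ring n)" using u_mon_carrier by blast
  have "ideal ?J (poly_ring n)"
  proof (rule idealI[OF R.ring_axioms])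
    show "subgroup ?J (add_monoid (poly_ring n))"
    proof (rule R.add.subgroupI)
      show "?J \<noteq> {}" by (auto simp: carrier_poly_ring intro: exI[of _ 0])
      fix p q assume p: "p \<in> ?J" and q: "q \<in> ?J"
      have "\<ominus>\<^bsub>poly_ring n\<^esub> p = - p"
        using p by (intro R.minus_equality) (simp_all add: add_poly_ring zero_poly_ring poly_ring_uminus_closed)
      then show "\<ominus>\<^bsub>poly_ring n\<^esub> p \<in> ?J" using p by (simp add: poly_ring_uminus_closed)
      have "m \<in> Poly_Mapping.keys p \<or> m \<in> Poly_Mapping.keys q" if "m \<in> Poly_Mapping.keys (p + q)" for m
        using that keys_add[of p q] by blast
      then show "p \<oplus>\<^bsub>poly_ring n\<^esub> q \<in> ?J"
        using p q by (fastforce simp: add_poly_ring poly_ring_add_closed)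
    qed auto
    have mult: "q * p \<in> ?J" if p: "p \<in> ?J" and q: "q \<in> carrier (poly_ring n)" for p q
    proof -
      have "region n \<eta> \<alpha> \<inter> region n \<eta> \<beta> \<inter> hyp_inter \<eta> (Poly_Mapping.keys m) = {}"
        if m: "m \<in> Poly_Mapping.keys (q * p)" for m
      proof -
        obtain a b where "m = a + b" "b \<in> Poly_Mapping.keys p" using subsetD[OF keys_mult m] by blast
        then show ?thesis using p hyp_inter_mono[of "Poly_Mapping.keys b" "Poly_Mapping.keys m" \<eta>]
          by (auto simp: keys_add_nat)
      qed
      then show ?thesis using p q poly_ring_mult_closed by auto
    qed
    fix p q assume "p \<in> ?J" "q \<in> carrier (poly_ring n)"
    then show "q \<otimes>\<^bsub>poly_ring n\<^esub> p \<in> ?J" "p \<otimes>\<^bsub>poly_ring n\<^esub> q \<in> ?J"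
      using mult[of p q] by (simp_all add: mult_poly_ring mult.commute)
  qed
  moreover have "?gen \<subseteq> ?J"
  proof
    fix f assume "f \<in> ?gen"
    then obtain S where "f = u_mon S" "S \<subseteq> {1..n}" "region n \<eta> \<alpha> \<inter> region n \<eta> \<beta> \<inter> hyp_inter \<eta> S = {}" by blast
    then show "f \<in> ?J" using u_mon_carrier[of S n] keys_sqfree_monom[of S] finite_subset[of S "{1..n}"]
      by (simp add: u_mon_eq)
  qed
  ultimately show "hyp_ideal n \<eta> \<alpha> \<beta> \<subseteq> ?J" unfolding hyp_ideal_def by (rule R.genideal_minimal)
  interpret I: ideal "hyp_ideal n \<eta> \<alpha> \<beta>" "poly_ring n"
    unfolding hyp_ideal_def by (rule R.genideal_ideal[OF gen])
  show "?J \<subseteq> hyp_ideal n \<eta> \<alpha> \<beta>"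
  proof
    fix q assume q: "q \<in> ?J"
    have *: "Poly_Mapping.single m c \<in> hyp_ideal n \<eta> \<alpha> \<beta>" if m: "m \<in> Poly_Mapping.keys q" for m c
    proof -
      let ?S = "Poly_Mapping.keys m"
      have S: "?S \<subseteq> {1..n}" "region n \<eta> \<alpha> \<inter> region n \<eta> \<beta> \<inter> hyp_inter \<eta> ?S = {}"
        using q m by (auto simp: carrier_poly_ring)
      then have 1: "u_mon ?S \<in> hyp_ideal n \<eta> \<alpha> \<beta>"
        unfolding hyp_ideal_def using R.genideal_self[OF gen] by blast
      \<comment> \<open>The product of the variables that occur is split off; it is a
        generator.\<close>
      have "m = (m - sqfree_monom ?S) + sqfree_monom ?S"
        by (rule poly_mapping_eqI) (auto simp: lookup_add lookup_minus lookup_sqfree_monom in_keys_iff)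
      then have "Poly_Mapping.single m c = Poly_Mapping.single (m - sqfree_monom ?S) c * u_mon ?S"
        by (simp add: u_mon_eq mult_single)
      moreover have "Poly_Mapping.keys (m - sqfree_monom ?S) \<subseteq> ?S"
        by (auto simp: in_keys_iff lookup_minus)
      then have "Poly_Mapping.single (m - sqfree_monom ?S) c \<in> carrier (poly_ring n)"
        using S by (auto simp: carrier_poly_ring)
      ultimately show ?thesis
        using I.I_l_closed[OF 1] by (simp add: mult_poly_ring)
    qed
    have "(\<Sum>m\<in>A. Poly_Mapping.single m (Poly_Mapping.lookup q m)) \<in> hyp_ideal n \<eta> \<alpha> \<beta>"
      if "finite A" "A \<subseteq> Poly_Mapping.keys q" for A
      using that
    proof (induct A rule: finite_induct)
      case empty then show ?case using I.zero_closed by (simp add: zero_poly_ring)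
    next
      case (insert m A)
      then show ?case
        using I.a_closed[of "Poly_Mapping.single m (Poly_Mapping.lookup q m)"] * by (simp add: add_poly_ring)
    qed
    moreover have "(\<Sum>m\<in>Poly_Mapping.keys q. Poly_Mapping.single m (Poly_Mapping.lookup q m)) = q"
      by (rule poly_mapping_eqI) (auto simp: lookup_sum lookup_single when_def in_keys_iff sum.delta)
    ultimately show "q \<in> hyp_ideal n \<eta> \<alpha> \<beta>" by (metis finite_keys order_refl)
  qed
qed

section \<open>The isomorphism of algebras\<close>

text \<open>Two surjections from one set \<open>C\<close> with the same fibres induce a bijection,
  which is a homomorphism as soon as operations \<open>m\<close> and \<open>p\<close> on
  \<open>C\<close> cover those of \<open>A\<close> and of \<open>B\<close>.\<close>

lemma is_ring_iso_of_common_cover: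
  assumes \<phi>: "\<phi> ` C = carrier A" and \<psi>: "\<psi> ` C = carrier B"
    and ker: "\<And>f g. f \<in> C \<Longrightarrow> g \<in> C \<Longrightarrow> \<phi> f = \<phi> g \<longleftrightarrow> \<psi> f = \<psi> g"
    and u: "u \<in> C" "\<phi> u = \<one>\<^bsub>A\<^esub>" "\<psi> u = \<one>\<^bsub>B\<^esub>"
    and mult: "\<And>f g. f \<in> C \<Longrightarrow> g \<in> C \<Longrightarrow> m f g \<in> C \<and> \<phi> (m f g) = \<phi> f \<otimes>\<^bsub>A\<^esub> \<phi> g \<and> \<psi> (m f g) = \<psi> f \<otimes>\<^bsub>B\<^esub> \<psi> g"
    and add: "\<And>f g. f \<in> C \<Longrightarrow> g \<in> C \<Longrightarrow> p f g \<in> C \<and> \<phi> (p f g) = \<phi> f \<oplus>\<^bsub>A\<^esub> \<phi> g \<and> \<psi> (p f g) = \<psi> f \<oplus>\<^bsub>B\<^esub> \<psi> g"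
  shows "A \<simeq> B"
proof -
  define h where "h X = \<psi> (inv_into C \<phi> X)" for X
  have h: "h (\<phi> f) = \<psi> f" if "f \<in> C" for f
  proof -
    have "inv_into C \<phi> (\<phi> f) \<in> C" "\<phi> (inv_into C \<phi> (\<phi> f)) = \<phi> f"
      using that by (auto intro: inv_into_into f_inv_into_f)
    then show ?thesis using ker[of "inv_into C \<phi> (\<phi> f)" f] that by (simp add: h_def)
  qed
  have "h \<in> Ring.ring_hom A B"
  proof (rule ring_hom_memI)
    fix X assume "X \<in> carrier A"
    then obtain f where f: "f \<in> C" "X = \<phi> f" using \<phi> by blast
    then show "h X \<in> carrier B" using h \<psi> by auto
    fix Y assume "Y \<in> carrier A"
    then obtain g where g: "g \<in> C" "Y = \<phi> g" using \<phi> by blast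
    show "h (X \<otimes>\<^bsub>A\<^esub> Y) = h X \<otimes>\<^bsub>B\<^esub> h Y" using mult[OF f(1) g(1)] h f g by metis
    show "h (X \<oplus>\<^bsub>A\<^esub> Y) = h X \<oplus>\<^bsub>B\<^esub> h Y" using add[OF f(1) g(1)] h f g by metis
  next
    show "h \<one>\<^bsub>A\<^esub> = \<one>\<^bsub>B\<^esub>" using h u by metis
  qed
  moreover have "bij_betw h (carrier A) (carrier B)"
  proof (rule bij_betw_imageI)
    show "inj_on h (carrier A)"
      unfolding \<phi>[symmetric] by (rule inj_onI) (use h ker in auto)
    show "h ` carrier A = carrier B"
      unfolding \<phi>[symmetric] \<psi>[symmetric] image_image using h by (rule image_cong[OF refl])
  qed
  ultimately show ?thesis unfolding is_ring_iso_def ring_iso_def by blast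
qed

lemma finsum_FactRing:
  assumes "ideal I R" "finite A" "f \<in> A \<rightarrow> carrier R"
  shows "finsum (R Quot I) (\<lambda>a. I +>\<^bsub>R\<^esub> f a) A = I +>\<^bsub>R\<^esub> finsum R f A"
proof -
  interpret I: ideal I R by (rule assms(1))
  interpret Q: ring "R Quot I" by (rule I.quotient_is_ring)
  have hom: "(+>\<^bsub>R\<^esub>) I \<in> Ring.ring_hom R (R Quot I)" by (rule I.rcos_ring_hom)
  show ?thesis
    using assms(2,3)
  proof (induct A rule: finite_induct)
    case empty
    have "\<zero>\<^bsub>R\<^esub> \<in> I" by (rule additive_subgroup.zero_closed[OF ideal.axioms(1)[OF assms(1)]])
    then have "I +>\<^bsub>R\<^esub> \<zero>\<^bsub>R\<^esub> = \<zero>\<^bsub>R Quot I\<^esub>" by (simp add: I.a_rcos_const FactRing_def)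
    then show ?case by simp
  next
    case (insert a A)
    then have f: "f \<in> A \<rightarrow> carrier R" "f a \<in> carrier R" by auto
    have "finsum (R Quot I) (\<lambda>a. I +>\<^bsub>R\<^esub> f a) (insert a A) =
      (I +>\<^bsub>R\<^esub> f a) \<oplus>\<^bsub>R Quot I\<^esub> (I +>\<^bsub>R\<^esub> finsum R f A)"
      using insert f ring_hom_closed[OF hom] by (subst Q.finsum_insert) (auto simp: Pi_iff)
    also have "\<dots> = I +>\<^bsub>R\<^esub> (f a \<oplus>\<^bsub>R\<^esub> finsum R f A)"
      using f by (simp add: ring_hom_add[OF hom] I.finsum_closed)
    also have "f a \<oplus>\<^bsub>R\<^esub> finsum R f A = finsum R f (insert a A)"
      using insert f by (simp add: I.finsum_insert)
    finally show ?case .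
  qed
qed

section \<open>Sign sequences of states\<close>

definition sign_vec :: "nat \<Rightarrow> nat set \<Rightarrow> nat \<Rightarrow> real" where
  "sign_vec n x = (\<lambda>j\<in>{1..n}. (- 1) ^ height x j)"

lemma sign_vec_seqs: "sign_vec n x \<in> sign_seqs n"
  by (auto simp: sign_vec_def sign_seqs_def minus_one_power_iff)

lemma sign_vec_eq_iff:
  "j \<in> {1..n} \<Longrightarrow> sign_vec n x j = sign_vec n y j \<longleftrightarrow> j \<notin> parity_diff x y"
  by (auto simp: sign_vec_def parity_diff_def minus_one_power_iff)

lemma parity_diff_empty: "parity_diff x y = {} \<Longrightarrow> x = y"
proof (rule Set.set_eqI)
  fix j assume "parity_diff x y = {}"
  then have "even (height x i) \<longleftrightarrow> even (height y i)" for i by (auto simp: parity_diff_def)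
  from this[of j] this[of "Suc j"] show "j \<in> x \<longleftrightarrow> j \<in> y"
    by (auto simp: height_Suc of_bool_def split: if_splits)
qed

text \<open>The point \<open>n\<close> affects no coordinate; it is recovered from the others
  because all states have \<open>k\<close> points.\<close>

lemma sign_vec_inj: "inj_on (sign_vec n) (os_states {0..n} k)"
proof (rule inj_onI)
  fix x y assume xy: "x \<in> os_states {0..n} k" "y \<in> os_states {0..n} k" and e: "sign_vec n x = sign_vec n y"
  have "j \<notin> parity_diff x y" if "j \<in> {1..n}" for j
    using sign_vec_eq_iff[OF that, of x y] e by simp
  then show "x = y" using parity_diff_subset[OF xy] by (intro parity_diff_empty[of x y]) blast
qed

lemma conv_set_sign_vec:
  assumes "x \<in> os_states {0..n} k" "y \<in> os_states {0..n} k"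
  shows "conv_set n (sign_vec n x) (sign_vec n y) (sign_vec n z) = conv_gaps x y z"
proof (rule Set.set_eqI)
  fix i
  show "i \<in> conv_set n (sign_vec n x) (sign_vec n y) (sign_vec n z) \<longleftrightarrow> i \<in> conv_gaps x y z"
  proof (cases "i \<in> {1..n}")
    case True
    then show ?thesis using sign_vec_eq_iff[OF True, of x z] sign_vec_eq_iff[OF True, of x y]
      by (auto simp: conv_set_def conv_gaps_def parity_diff_def)
  next
    case False
    then show ?thesis using parity_diff_subset[OF assms] by (auto simp: conv_set_def conv_gaps_def)
  qed
qed

lemma ideal_hyp_ideal: "ideal (hyp_ideal n \<eta> \<alpha> \<beta>) (poly_ring n)"
proof -
  interpret R: cring "poly_ring n" by (rule cring_poly_ring)
  show ?thesis unfolding hyp_ideal_def by (rule R.genideal_ideal) (use u_mon_carrier in blast)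
qed

lemma hyp_coset_eq_iff:
  assumes "p \<in> carrier (poly_ring n)" "q \<in> carrier (poly_ring n)"
  shows "hyp_ideal n \<eta> \<alpha> \<beta> +>\<^bsub>poly_ring n\<^esub> p = hyp_ideal n \<eta> \<alpha> \<beta> +>\<^bsub>poly_ring n\<^esub> q \<longleftrightarrow>
    p - q \<in> hyp_ideal n \<eta> \<alpha> \<beta>"
proof -
  interpret R: cring "poly_ring n" by (rule cring_poly_ring)
  have "\<ominus>\<^bsub>poly_ring n\<^esub> q = - q"
    using assms(2) by (intro R.minus_equality) (simp_all add: add_poly_ring zero_poly_ring poly_ring_uminus_closed)
  then have "p \<ominus>\<^bsub>poly_ring n\<^esub> q = p - q" by (simp add: a_minus_def add_poly_ring)
  then show ?thesis using R.quotient_eq_iff_same_a_r_cos[OF ideal_hyp_ideal assms, of \<eta> \<alpha> \<beta>] by simp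
qed

lemma hyp_ideal_add: "p \<in> hyp_ideal n \<eta> \<alpha> \<beta> \<Longrightarrow> q \<in> hyp_ideal n \<eta> \<alpha> \<beta> \<Longrightarrow> p + q \<in> hyp_ideal n \<eta> \<alpha> \<beta>"
  using additive_subgroup.a_closed[OF ideal.axioms(1)[OF ideal_hyp_ideal], of p n \<eta> \<alpha> \<beta> q]
  by (simp add: add_poly_ring)

text \<open>This makes the product independent of representatives. A point of the regions of
  \<alpha> and \<gamma> on the hyperplanes of \<open>conv_set\<close> lies in the region of \<beta>
  as well, since elsewhere \<beta> agrees with \<alpha> or \<gamma>.\<close>

lemma hyp_ideal_conv:
  assumes s: "\<alpha> \<in> sign_seqs n" "\<beta> \<in> sign_seqs n" "\<gamma> \<in> sign_seqs n"
    and p: "p \<in> carrier (poly_ring n)" and q: "q \<in> carrier (poly_ring n)"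
    and pq: "p \<in> hyp_ideal n \<eta> \<alpha> \<beta> \<or> q \<in> hyp_ideal n \<eta> \<beta> \<gamma>"
  shows "u_mon (conv_set n \<alpha> \<beta> \<gamma>) * p * q \<in> hyp_ideal n \<eta> \<alpha> \<gamma>"
  unfolding hyp_ideal_eq
proof (intro CollectI conjI ballI)
  have S: "conv_set n \<alpha> \<beta> \<gamma> \<subseteq> {1..n}" "finite (conv_set n \<alpha> \<beta> \<gamma>)" by (auto simp: conv_set_def)
  show "u_mon (conv_set n \<alpha> \<beta> \<gamma>) * p * q \<in> carrier (poly_ring n)"
    by (intro poly_ring_mult_closed u_mon_carrier S p q)
  fix m assume m: "m \<in> Poly_Mapping.keys (u_mon (conv_set n \<alpha> \<beta> \<gamma>) * p * q)"
  obtain a m2 where a: "m = a + m2" "a \<in> Poly_Mapping.keys (u_mon (conv_set n \<alpha> \<beta> \<gamma>) * p)" "m2 \<in> Poly_Mapping.keys q"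
    using subsetD[OF keys_mult m] by blast
  obtain m1 where m1: "a = sqfree_monom (conv_set n \<alpha> \<beta> \<gamma>) + m1" "m1 \<in> Poly_Mapping.keys p"
    using subsetD[OF keys_mult a(2)] by (auto simp: u_mon_eq)
  have keys: "Poly_Mapping.keys m = conv_set n \<alpha> \<beta> \<gamma> \<union> Poly_Mapping.keys m1 \<union> Poly_Mapping.keys m2"
    by (simp add: a m1 keys_add_nat keys_sqfree_monom[OF S(2)])
  show "region n \<eta> \<alpha> \<inter> region n \<eta> \<gamma> \<inter> hyp_inter \<eta> (Poly_Mapping.keys m) = {}"
  proof (rule ccontr)
    assume "\<not> ?thesis"
    then obtain v where v: "v \<in> region n \<eta> \<alpha>" "v \<in> region n \<eta> \<gamma>" "v \<in> hyp_inter \<eta> (Poly_Mapping.keys m)" by blast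
    have "v \<in> region n \<eta> \<beta>"
    proof -
      have "\<beta> i * Poly_Mapping.lookup v i \<ge> 0" if i: "i \<in> {1..n}" for i
      proof -
        have vals: "\<alpha> i \<in> {1, -1}" "\<beta> i \<in> {1, -1}" "\<gamma> i \<in> {1, -1}" using s i by (auto simp: sign_seqs_def)
        consider "\<beta> i = \<alpha> i" | "\<beta> i = \<gamma> i" | "i \<in> conv_set n \<alpha> \<beta> \<gamma>"
          using vals i by (auto simp: conv_set_def)
        then show ?thesis
        proof cases
          case 3
          then have "Poly_Mapping.lookup v i = 0" using v(3) keys by (simp add: hyp_inter_def)
          then show ?thesis by simp
        qed (use v(1,2) i in \<open>auto simp: region_def\<close>)
      qed
      then show ?thesis using v(1) by (simp add: region_def)
    qed
    then have "v \<in> region n \<eta> \<alpha> \<inter> region n \<eta> \<beta> \<inter> hyp_inter \<eta> (Poly_Mapping.keys m1)"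
      "v \<in> region n \<eta> \<beta> \<inter> region n \<eta> \<gamma> \<inter> hyp_inter \<eta> (Poly_Mapping.keys m2)"
      using v keys by (auto simp: hyp_inter_def)
    then show False using pq m1(2) a(3) unfolding hyp_ideal_eq by blast
  qed
qed

text \<open>All representatives give the same class, so the union defining \<open>conv_mult\<close>
  collapses to one coset.\<close>

lemma conv_mult_cosets:
  assumes s: "\<alpha> \<in> sign_seqs n" "\<beta> \<in> sign_seqs n" "\<gamma> \<in> sign_seqs n"
    and p: "p \<in> carrier (poly_ring n)" and q: "q \<in> carrier (poly_ring n)"
  shows "conv_mult n \<eta> \<alpha> \<beta> \<gamma> (hyp_ideal n \<eta> \<alpha> \<beta> +>\<^bsub>poly_ring n\<^esub> p) (hyp_ideal n \<eta> \<beta> \<gamma> +>\<^bsub>poly_ring n\<^esub> q) =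
    hyp_ideal n \<eta> \<alpha> \<gamma> +>\<^bsub>poly_ring n\<^esub> (u_mon (conv_set n \<alpha> \<beta> \<gamma>) * p * q)"
proof -
  let ?u = "u_mon (conv_set n \<alpha> \<beta> \<gamma>)"
  have u: "?u \<in> carrier (poly_ring n)" by (rule u_mon_carrier) (auto simp: conv_set_def)
  have zero: "0 \<in> hyp_ideal n \<eta> \<alpha> \<beta>" for \<alpha> \<beta> by (simp add: hyp_ideal_eq carrier_poly_ring)
  have carr: "h \<in> carrier (poly_ring n)" if "h \<in> hyp_ideal n \<eta> \<alpha> \<beta>" for h \<alpha> \<beta>
    using that by (simp add: hyp_ideal_eq)
  have eq: "hyp_ideal n \<eta> \<alpha> \<gamma> +>\<^bsub>poly_ring n\<^esub> (?u * (h + p) * (h' + q)) = hyp_ideal n \<eta> \<alpha> \<gamma> +>\<^bsub>poly_ring n\<^esub> (?u * p * q)"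
    if h: "h \<in> hyp_ideal n \<eta> \<alpha> \<beta>" "h' \<in> hyp_ideal n \<eta> \<beta> \<gamma>" for h h'
  proof (subst hyp_coset_eq_iff)
    show "?u * (h + p) * (h' + q) \<in> carrier (poly_ring n)" "?u * p * q \<in> carrier (poly_ring n)"
      by (intro poly_ring_mult_closed poly_ring_add_closed u p q carr[OF h(1)] carr[OF h(2)])+
    have "?u * h * (h' + q) \<in> hyp_ideal n \<eta> \<alpha> \<gamma>" "?u * p * h' \<in> hyp_ideal n \<eta> \<alpha> \<gamma>"
      by (intro hyp_ideal_conv s poly_ring_add_closed p q carr[OF h(1)] carr[OF h(2)] disjI1 h(1) disjI2 h(2))+
    then have "?u * h * (h' + q) + ?u * p * h' \<in> hyp_ideal n \<eta> \<alpha> \<gamma>" by (rule hyp_ideal_add)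
    moreover have "?u * (h + p) * (h' + q) - ?u * p * q = ?u * h * (h' + q) + ?u * p * h'"
      by (simp add: algebra_simps)
    ultimately show "?u * (h + p) * (h' + q) - ?u * p * q \<in> hyp_ideal n \<eta> \<alpha> \<gamma>" by simp
  qed
  have coset: "hyp_ideal n \<eta> \<alpha> \<beta> +>\<^bsub>poly_ring n\<^esub> p = (\<lambda>h. h + p) ` hyp_ideal n \<eta> \<alpha> \<beta>" for \<alpha> \<beta> p
    by (auto simp: a_r_coset_def' add_poly_ring)
  show ?thesis
    unfolding conv_mult_def coset[of \<alpha> \<beta>] coset[of \<beta> \<gamma>] using zero eq
    by (simp add: image_UN) blast
qed

lemma carrier_hyp_R: "carrier (hyp_R n \<eta> \<alpha> \<beta>) = (\<lambda>q. hyp_ideal n \<eta> \<alpha> \<beta> +>\<^bsub>poly_ring n\<^esub> q) ` carrier (poly_ring n)"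
  by (auto simp: hyp_R_def FactRing_def A_RCOSETS_def')

text \<open>Only the ends lie in \<open>W\<close>; a path may pass through states outside
  \<open>W\<close>, as the corner is taken in the full algebra.\<close>

definition corner_paths ::
  "nat \<Rightarrow> nat \<Rightarrow> nat set set \<Rightarrow> ((nat set, nat set \<times> os_label \<times> nat set) path \<Rightarrow>\<^sub>0 int) set" where
  "corner_paths n k W = {f. Poly_Mapping.keys f \<subseteq> {(x, p, y) \<in> os_paths n k. x \<in> W \<and> y \<in> W}}"

lemma corner_pathsD:
  assumes "f \<in> corner_paths n k W"
  shows "Poly_Mapping.keys f \<subseteq> os_paths n k" "f \<in> carrier (path_algebra (os_quiver n k))"
  using assms by (auto simp: corner_paths_def carrier_path_algebra)

lemma path_poly_outside:
  assumes "f \<in> corner_paths n k W" "x \<notin> W \<or> y \<notin> W"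
  shows "path_poly x y f = 0"
proof -
  have "frag_cmul (Poly_Mapping.lookup f t) (case t of (x', p, y') \<Rightarrow> if x' = x \<and> y' = y then frag_of (path_monom p) else 0) = 0"
    if "t \<in> Poly_Mapping.keys f" for t
    using that assms by (cases t) (auto simp: corner_paths_def)
  then show ?thesis unfolding path_poly_def frag_extend_def by (intro sum.neutral ballI)
qed

lemma path_poly_carrier:
  assumes "Poly_Mapping.keys f \<subseteq> os_paths n k"
  shows "path_poly x y f \<in> carrier (poly_ring n)"
  using assms
proof (induct f rule: frag_induction)
  case (one t)
  obtain x' p y' where t: "t = (x', p, y')" by (cases t)
  have "j \<in> {1..n}" if "j \<in> Poly_Mapping.keys (path_monom p)" for j
    using weight_supp[of x' p y' n k j] one t that weight_keys[of x' p y' n k] by blast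
  then show ?case by (auto simp: t carrier_poly_ring)
next
  case (diff a b)
  then show ?case by (simp add: poly_ring_diff_closed)
qed (simp add: carrier_poly_ring)

lemma os_coset_eq_iff:
  assumes "Poly_Mapping.keys f \<subseteq> os_paths n k" "Poly_Mapping.keys g \<subseteq> os_paths n k"
  shows "os_ideal n k +>\<^bsub>path_algebra (os_quiver n k)\<^esub> f = os_ideal n k +>\<^bsub>path_algebra (os_quiver n k)\<^esub> g \<longleftrightarrow>
    f - g \<in> os_ideal n k"
proof -
  interpret R: ring "path_algebra (os_quiver n k)" by (rule ring_os_path_algebra)
  have c: "f \<in> carrier (path_algebra (os_quiver n k))" "g \<in> carrier (path_algebra (os_quiver n k))"
    using assms by (simp_all add: carrier_path_algebra)
  have "\<ominus>\<^bsub>path_algebra (os_quiver n k)\<^esub> g = - g"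
    using assms(2) c by (intro R.minus_equality) (simp_all add: add_path_algebra zero_path_algebra carrier_path_algebra)
  then have "f \<ominus>\<^bsub>path_algebra (os_quiver n k)\<^esub> g = f - g" by (simp add: a_minus_def add_path_algebra)
  then show ?thesis using R.quotient_eq_iff_same_a_r_cos[OF ideal_os_ideal c] by simp
qed

lemma finsum_path_algebra:
  assumes "finite A" "\<And>a. a \<in> A \<Longrightarrow> Poly_Mapping.keys (f a) \<subseteq> os_paths n k"
  shows "finsum (path_algebra (os_quiver n k)) f A = sum f A"
proof -
  interpret R: ring "path_algebra (os_quiver n k)" by (rule ring_os_path_algebra)
  show ?thesis using assms
    by (induct A rule: finite_induct)
      (simp_all add: zero_path_algebra add_path_algebra Pi_iff carrier_path_algebra)
qed

lemma finsum_poly_ring: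
  assumes "finite A" "\<And>a. a \<in> A \<Longrightarrow> f a \<in> carrier (poly_ring n)"
  shows "finsum (poly_ring n) f A = sum f A"
proof -
  interpret R: cring "poly_ring n" by (rule cring_poly_ring)
  show ?thesis using assms
    by (induct A rule: finite_induct) (simp_all add: zero_poly_ring add_poly_ring Pi_iff)
qed

lemma corner_paths_sum:
  "(\<And>a. a \<in> A \<Longrightarrow> f a \<in> corner_paths n k W) \<Longrightarrow> sum f A \<in> corner_paths n k W"
  using keys_sum[of f A] by (fastforce simp: corner_paths_def)

lemma corner_paths_mult:
  assumes "f \<in> corner_paths n k W" "g \<in> corner_paths n k W"
  shows "path_mult f g \<in> corner_paths n k W"
proof -
  have "t \<in> {(x, p, y) \<in> os_paths n k. x \<in> W \<and> y \<in> W}" if t: "t \<in> Poly_Mapping.keys (path_mult f g)" for t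
  proof -
    obtain x p y q z where "t = (x, p @ q, z)"
      "(x, p, y) \<in> Poly_Mapping.keys f" "(y, q, z) \<in> Poly_Mapping.keys g"
      using subsetD[OF keys_path_mult t] by blast
    then show ?thesis using assms by (auto simp: corner_paths_def intro: quiver_paths_append)
  qed
  then show ?thesis by (auto simp: corner_paths_def)
qed

lemma path_mult_sandwich:
  "Poly_Mapping.keys (path_mult (path_mult (frag_of (x, [], x)) f) (frag_of (y, [], y))) \<subseteq>
    {(x, p, y) | p. (x, p, y) \<in> Poly_Mapping.keys f}"
proof
  fix t assume "t \<in> Poly_Mapping.keys (path_mult (path_mult (frag_of (x, [], x)) f) (frag_of (y, [], y)))"
  from subsetD[OF keys_path_mult this] obtain x1 p y1 q z where
    1: "t = (x1, p @ q, z)" "(x1, p, y1) \<in> Poly_Mapping.keys (path_mult (frag_of (x, [], x)) f)" "(y1, q, z) = (y, [], y)"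
    by auto
  from subsetD[OF keys_path_mult 1(2)] show "t \<in> {(x, p, y) | p. (x, p, y) \<in> Poly_Mapping.keys f}"
    using 1(1,3) by auto
qed

text \<open>A summand between two idempotents consists of classes of combinations of paths with
  these ends. Conversely, sandwiching \<open>f\<close> between all pairs of trivial paths of
  \<open>W\<close> and adding up returns \<open>f\<close>.\<close>

lemma carrier_os_corner:
  assumes W: "W \<subseteq> os_states {0..n} k"
  shows "carrier (os_corner n k W) =
    (\<lambda>f. os_ideal n k +>\<^bsub>path_algebra (os_quiver n k)\<^esub> f) ` corner_paths n k W" (is "?L = ?\<pi> ` ?C")
proof -
  let ?P = "path_algebra (os_quiver n k)"
  interpret I: ideal "os_ideal n k" ?P by (rule ideal_os_ideal)
  have fW: "finite W" using W finite_subset finite_os_states by blast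
  define s where "s x y f = path_mult (path_mult (frag_of (x, [], x)) f) (frag_of (y, [], y))"
    for x y and f :: "(nat set, nat set \<times> os_label \<times> nat set) path \<Rightarrow>\<^sub>0 int"
  have e: "frag_of (x, [], x) \<in> carrier ?P" if "x \<in> W" for x
    using W that by (auto simp: carrier_path_algebra)
  have sW: "s x y f \<in> ?C" if "x \<in> W" "y \<in> W" "f \<in> carrier ?P" for x y f
    using path_mult_sandwich[of x f y] that by (fastforce simp: s_def corner_paths_def carrier_path_algebra)
  have sandwich: "os_idem n k x \<otimes>\<^bsub>os_algebra n k\<^esub> ?\<pi> f \<otimes>\<^bsub>os_algebra n k\<^esub> os_idem n k y = ?\<pi> (s x y f)"
    if "x \<in> W" "y \<in> W" "f \<in> carrier ?P" for x y f
  proof -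
    have c: "path_mult (frag_of (x, [], x)) f \<in> carrier ?P"
      using I.m_closed[OF e[OF that(1)] that(3)] by (simp add: mult_path_algebra)
    show ?thesis
      using I.rcoset_mult_add[OF e[OF that(1)] that(3)] I.rcoset_mult_add[OF c e[OF that(2)]]
      by (simp add: os_idem_def os_algebra_def FactRing_def mult_path_algebra s_def)
  qed
  have fin: "finsum (os_algebra n k) (\<lambda>(x, y). os_idem n k x \<otimes>\<^bsub>os_algebra n k\<^esub> ?\<pi> (f (x, y)) \<otimes>\<^bsub>os_algebra n k\<^esub> os_idem n k y) (W \<times> W)
      = ?\<pi> (\<Sum>(x, y)\<in>W \<times> W. s x y (f (x, y)))"
    if f: "f \<in> W \<times> W \<rightarrow> carrier ?P" for f
  proof -
    interpret Q: ring "os_algebra n k" unfolding os_algebra_def by (rule I.quotient_is_ring)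
    have fc: "f (x, y) \<in> carrier ?P" if "x \<in> W" "y \<in> W" for x y using f that by auto
    have \<pi>: "?\<pi> g \<in> carrier (os_algebra n k)" if "g \<in> carrier ?P" for g
      using that by (auto simp: os_algebra_def FactRing_def A_RCOSETS_def')
    have sc: "s x y (f (x, y)) \<in> carrier ?P" if "x \<in> W" "y \<in> W" for x y
      using corner_pathsD(2)[OF sW[OF that fc[OF that]]] .
    have "finsum (os_algebra n k) (\<lambda>(x, y). os_idem n k x \<otimes>\<^bsub>os_algebra n k\<^esub> ?\<pi> (f (x, y)) \<otimes>\<^bsub>os_algebra n k\<^esub> os_idem n k y) (W \<times> W)
      = finsum (os_algebra n k) (\<lambda>t. ?\<pi> (case t of (x, y) \<Rightarrow> s x y (f (x, y)))) (W \<times> W)"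
      by (rule Q.finsum_cong') (auto simp: sandwich fc sc \<pi>)
    also have "\<dots> = ?\<pi> (finsum ?P (\<lambda>t. case t of (x, y) \<Rightarrow> s x y (f (x, y))) (W \<times> W))"
      unfolding os_algebra_def using fW sc by (intro finsum_FactRing ideal_os_ideal) auto
    also have "finsum ?P (\<lambda>t. case t of (x, y) \<Rightarrow> s x y (f (x, y))) (W \<times> W) = (\<Sum>(x, y)\<in>W \<times> W. s x y (f (x, y)))"
      using fW sc by (intro finsum_path_algebra) (auto simp: carrier_path_algebra)
    finally show ?thesis .
  qed
  show ?thesis
  proof (intro equalityI subsetI)
    fix X assume "X \<in> ?L"
    then obtain b where b: "b \<in> W \<times> W \<rightarrow> carrier (os_algebra n k)"
      "X = finsum (os_algebra n k) (\<lambda>(x, y). os_idem n k x \<otimes>\<^bsub>os_algebra n k\<^esub> b (x, y) \<otimes>\<^bsub>os_algebra n k\<^esub> os_idem n k y) (W \<times> W)"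
      by (auto simp: os_corner_def)
    have "\<exists>f. \<forall>t\<in>W \<times> W. f t \<in> carrier ?P \<and> b t = ?\<pi> (f t)"
      using b(1) by (intro bchoice) (fastforce simp: os_algebra_def FactRing_def A_RCOSETS_def' Pi_iff)
    then obtain f where "\<forall>t\<in>W \<times> W. f t \<in> carrier ?P \<and> b t = ?\<pi> (f t)" ..
    then have f: "f t \<in> carrier ?P \<and> b t = ?\<pi> (f t)" if "t \<in> W \<times> W" for t using that by (rule bspec)
    interpret Q: ring "os_algebra n k" unfolding os_algebra_def by (rule I.quotient_is_ring)
    have idem: "os_idem n k x \<in> carrier (os_algebra n k)" if "x \<in> W" for x
      using e[OF that] by (auto simp: os_idem_def os_algebra_def FactRing_def A_RCOSETS_def')
    have "X = finsum (os_algebra n k) (\<lambda>(x, y). os_idem n k x \<otimes>\<^bsub>os_algebra n k\<^esub> ?\<pi> (f (x, y)) \<otimes>\<^bsub>os_algebra n k\<^esub> os_idem n k y) (W \<times> W)"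
      unfolding b(2) using f b(1) idem by (intro Q.finsum_cong') (auto simp: Pi_iff)
    also have "\<dots> = ?\<pi> (\<Sum>(x, y)\<in>W \<times> W. s x y (f (x, y)))" using f by (intro fin) auto
    finally show "X \<in> ?\<pi> ` ?C" using f sW by (auto intro!: imageI corner_paths_sum)
  next
    fix X assume "X \<in> ?\<pi> ` ?C"
    then obtain f where f: "f \<in> ?C" "X = ?\<pi> f" by blast
    have one: "path_mult (\<Sum>x\<in>W. frag_of (x, [], x)) f = f" "path_mult f (\<Sum>x\<in>W. frag_of (x, [], x)) = f"
      using f(1) by (auto intro!: path_one_left path_one_right fW simp: corner_paths_def)
    have "(\<Sum>(x, y)\<in>W \<times> W. s x y f) = path_mult (path_mult (\<Sum>x\<in>W. frag_of (x, [], x)) f) (\<Sum>y\<in>W. frag_of (y, [], y))"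
      by (simp add: sum.cartesian_product[symmetric] s_def path_mult_sum_left path_mult_sum_right)
        (rule sum.swap)
    then have "(\<Sum>(x, y)\<in>W \<times> W. s x y f) = f" by (simp add: one)
    then have "X = finsum (os_algebra n k) (\<lambda>(x, y). os_idem n k x \<otimes>\<^bsub>os_algebra n k\<^esub> ?\<pi> f \<otimes>\<^bsub>os_algebra n k\<^esub> os_idem n k y) (W \<times> W)"
      using fin[of "\<lambda>_. f"] corner_pathsD(2)[OF f(1)] f(2) by simp
    moreover have "(\<lambda>_. ?\<pi> f) \<in> W \<times> W \<rightarrow> carrier (os_algebra n k)"
      using corner_pathsD(2)[OF f(1)] by (auto simp: os_algebra_def FactRing_def A_RCOSETS_def')
    ultimately show "X \<in> ?L" unfolding os_corner_def by (simp, intro exI[of _ "\<lambda>_. ?\<pi> f"]) simp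
  qed
qed

text \<open>All geometry enters through \<open>reg\<close>: the nonempty faces are those given by
  matchings. Both algebras are covered by \<open>corner_paths\<close>, one by taking classes modulo
  the relation ideal, the other by reading off the polynomial of each pair of ends; the two kernels
  agree by \<open>os_ideal_eq_kernel\<close>.\<close>

theorem conv_algebra_iso_os_corner:
  assumes kn: "k \<le> n" and W: "W \<subseteq> os_states {0..n} k"
    and reg: "\<And>x y T. x \<in> W \<Longrightarrow> y \<in> W \<Longrightarrow> T \<subseteq> {1..n} \<Longrightarrow>
      region n \<eta> (sign_vec n x) \<inter> region n \<eta> (sign_vec n y) \<inter> hyp_inter \<eta> T \<noteq> {} \<longleftrightarrow>
      (\<exists>I. matching n x I \<and> T \<union> parity_diff x y \<subseteq> I)"
  shows "conv_algebra n \<eta> (sign_vec n ` W) \<simeq> os_corner n k W"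
proof -
  let ?P = "path_algebra (os_quiver n k)" and ?C = "corner_paths n k W" and ?A = "sign_vec n ` W"
  let ?H = "\<lambda>\<alpha> \<beta>. hyp_ideal n \<eta> \<alpha> \<beta>"
  define r where "r = inv_into W (sign_vec n)"
  define \<Phi> where "\<Phi> f = (\<lambda>(\<alpha>, \<beta>)\<in>?A \<times> ?A. ?H \<alpha> \<beta> +>\<^bsub>poly_ring n\<^esub> path_poly (r \<alpha>) (r \<beta>) f)" for f
  define \<pi> where "\<pi> f = os_ideal n k +>\<^bsub>?P\<^esub> f" for f
  have fW: "finite W" using W finite_subset finite_os_states by blast
  have inj: "inj_on (sign_vec n) W" using sign_vec_inj W by (rule inj_on_subset)
  have r [simp]: "r (sign_vec n x) = x" if "x \<in> W" for x using inv_into_f_f[OF inj that] by (simp add: r_def)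
  have Ws: "x \<in> os_states {0..n} k" if "x \<in> W" for x using W that by blast
  have H: "?H (sign_vec n x) (sign_vec n y) = carrier (poly_ring n) \<inter> inadmissible n x y" if "x \<in> W" "y \<in> W" for x y
  proof -
    have "region n \<eta> (sign_vec n x) \<inter> region n \<eta> (sign_vec n y) \<inter> hyp_inter \<eta> (Poly_Mapping.keys m) = {} \<longleftrightarrow>
      \<not> admissible n x y m" if "Poly_Mapping.keys m \<subseteq> {1..n}" for m
      using reg[OF \<open>x \<in> W\<close> \<open>y \<in> W\<close> that] by (auto simp: admissible_def)
    then show ?thesis by (auto simp: hyp_ideal_eq carrier_poly_ring inadmissible_def)
  qed
  have pp: "path_poly x y f \<in> carrier (poly_ring n)" if "f \<in> ?C" for x y f
    using path_poly_carrier[OF corner_pathsD(1)[OF that]] .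
  have \<Phi>_at: "\<Phi> f (sign_vec n x, sign_vec n y) = ?H (sign_vec n x) (sign_vec n y) +>\<^bsub>poly_ring n\<^esub> path_poly x y f"
    if "x \<in> W" "y \<in> W" for f x y
    using that by (simp add: \<Phi>_def)
  have eqI: "X = Y" if X: "X \<in> extensional (?A \<times> ?A)" "Y \<in> extensional (?A \<times> ?A)"
      and "\<And>x y. x \<in> W \<Longrightarrow> y \<in> W \<Longrightarrow> X (sign_vec n x, sign_vec n y) = Y (sign_vec n x, sign_vec n y)"
    for X Y :: "(nat \<Rightarrow> real) \<times> (nat \<Rightarrow> real) \<Rightarrow> ((nat \<Rightarrow>\<^sub>0 nat) \<Rightarrow>\<^sub>0 int) set"
    by (rule extensionalityI[OF X]) (use that(3) in auto)
  have \<Phi>_ext: "\<Phi> f \<in> extensional (?A \<times> ?A)" for f by (simp add: \<Phi>_def)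
  have ext: "(\<lambda>t\<in>?A \<times> ?A. F t) \<in> extensional (?A \<times> ?A)"
    for F :: "(nat \<Rightarrow> real) \<times> (nat \<Rightarrow> real) \<Rightarrow> ((nat \<Rightarrow>\<^sub>0 nat) \<Rightarrow>\<^sub>0 int) set" by simp
  show ?thesis
  proof (rule is_ring_iso_of_common_cover[where \<phi> = \<Phi> and \<psi> = \<pi> and C = ?C and m = path_mult and p = "(+)"
        and u = "\<Sum>x\<in>W. frag_of (x, [], x)"])
    show "\<pi> ` ?C = carrier (os_corner n k W)" using carrier_os_corner[OF W] by (simp add: \<pi>_def[abs_def])
    show "\<Phi> ` ?C = carrier (conv_algebra n \<eta> ?A)"
    proof (intro equalityI subsetI)
      fix X assume "X \<in> \<Phi> ` ?C"
      then obtain f where f: "f \<in> ?C" "X = \<Phi> f" by blast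
      have "\<Phi> f \<in> (\<Pi>\<^sub>E (\<alpha>, \<beta>)\<in>?A \<times> ?A. carrier (hyp_R n \<eta> \<alpha> \<beta>))"
        unfolding \<Phi>_def restrict_PiE_iff carrier_hyp_R using pp[OF f(1)] by auto
      then show "X \<in> carrier (conv_algebra n \<eta> ?A)" by (simp add: conv_algebra_def f)
    next
      fix X assume "X \<in> carrier (conv_algebra n \<eta> ?A)"
      then have X: "X \<in> extensional (?A \<times> ?A)"
        "\<And>x y. x \<in> W \<Longrightarrow> y \<in> W \<Longrightarrow> X (sign_vec n x, sign_vec n y) \<in> carrier (hyp_R n \<eta> (sign_vec n x) (sign_vec n y))"
        by (auto simp: conv_algebra_def PiE_def Pi_iff)
      define q where "q x y = (SOME q. q \<in> carrier (poly_ring n) \<and>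
        X (sign_vec n x, sign_vec n y) = ?H (sign_vec n x) (sign_vec n y) +>\<^bsub>poly_ring n\<^esub> q)" for x y
      have q: "q x y \<in> carrier (poly_ring n)"
        "X (sign_vec n x, sign_vec n y) = ?H (sign_vec n x) (sign_vec n y) +>\<^bsub>poly_ring n\<^esub> q x y" if "x \<in> W" "y \<in> W" for x y
      proof -
        have "\<exists>q. q \<in> carrier (poly_ring n) \<and>
          X (sign_vec n x, sign_vec n y) = ?H (sign_vec n x) (sign_vec n y) +>\<^bsub>poly_ring n\<^esub> q"
          using X(2)[OF that] by (auto simp: carrier_hyp_R)
        from someI_ex[OF this] show "q x y \<in> carrier (poly_ring n)"
          "X (sign_vec n x, sign_vec n y) = ?H (sign_vec n x) (sign_vec n y) +>\<^bsub>poly_ring n\<^esub> q x y" by (simp_all add: q_def)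
      qed
      define p where "p x y m = (SOME p. (x, p, y) \<in> os_paths n k \<and> path_monom p = m)" for x y m
      have p: "(x, p x y m, y) \<in> os_paths n k \<and> path_monom (p x y m) = m"
        if "x \<in> W" "y \<in> W" "admissible n x y m" for x y m
        unfolding p_def by (rule someI_ex) (rule path_of_monom[OF Ws[OF that(1)] Ws[OF that(2)] that(3)])
      \<comment> \<open>Only admissible monomials are lifted to paths; the others lie in
        \<open>hyp_ideal\<close>.\<close>
      define S where "S x y = {m \<in> Poly_Mapping.keys (q x y). admissible n x y m}" for x y
      define g where "g x y = (\<Sum>m\<in>S x y. frag_cmul (Poly_Mapping.lookup (q x y) m) (frag_of (x, p x y m, y)))" for x y
      define f where "f = (\<Sum>(x, y)\<in>W \<times> W. g x y)"
      have gC: "g x y \<in> ?C" if "x \<in> W" "y \<in> W" for x y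
        unfolding g_def
      proof (rule corner_paths_sum)
        fix m assume "m \<in> S x y"
        then have "(x, p x y m, y) \<in> os_paths n k" using p that by (simp add: S_def)
        then show "frag_cmul (Poly_Mapping.lookup (q x y) m) (frag_of (x, p x y m, y)) \<in> ?C"
          using that by (auto simp: corner_paths_def)
      qed
      have fC: "f \<in> ?C" unfolding f_def using gC by (intro corner_paths_sum) auto
      have "X = \<Phi> f"
      proof (rule eqI[OF X(1) \<Phi>_ext])
        fix x y assume xy: "x \<in> W" "y \<in> W"
        have finS: "finite (S x y)" for x y by (simp add: S_def)
        have pg: "path_poly x y (g x' y') = (if (x', y') = (x, y) then
            (\<Sum>m\<in>S x y. frag_cmul (Poly_Mapping.lookup (q x y) m) (frag_of m)) else 0)" if "x' \<in> W" "y' \<in> W" for x' y'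
        proof -
          have "path_poly x y (g x' y') = (\<Sum>m\<in>S x' y'. frag_cmul (Poly_Mapping.lookup (q x' y') m)
              (if x' = x \<and> y' = y then frag_of (path_monom (p x' y' m)) else 0))"
            by (simp add: g_def path_poly_sum[OF finS])
          moreover have "path_monom (p x y m) = m" if "m \<in> S x y" for m using p xy that by (simp add: S_def)
          ultimately show ?thesis by (cases "x' = x \<and> y' = y") (simp, subst if_not_P, auto intro: sum.neutral)
        qed
        have "path_poly x y f = (\<Sum>t\<in>W \<times> W. path_poly x y (g (fst t) (snd t)))"
          unfolding f_def by (subst path_poly_sum) (simp_all add: fW split_beta)
        also have "\<dots> = (\<Sum>t\<in>W \<times> W. if t = (x, y) then
            (\<Sum>m\<in>S x y. frag_cmul (Poly_Mapping.lookup (q x y) m) (frag_of m)) else 0)"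
        proof (rule sum.cong[OF refl])
          fix t assume "t \<in> W \<times> W"
          then show "path_poly x y (g (fst t) (snd t)) = (if t = (x, y) then
            (\<Sum>m\<in>S x y. frag_cmul (Poly_Mapping.lookup (q x y) m) (frag_of m)) else 0)"
            using pg[of "fst t" "snd t"] by (cases t) simp
        qed
        also have "\<dots> = (\<Sum>m\<in>S x y. frag_cmul (Poly_Mapping.lookup (q x y) m) (frag_of m))"
          using fW xy by simp
        finally have "Poly_Mapping.lookup (path_poly x y f) m = Poly_Mapping.lookup (q x y) m" if "admissible n x y m" for m
          using that finS by (auto simp: lookup_sum S_def in_keys_iff if_distrib cong: if_cong)
        then have "q x y - path_poly x y f \<in> inadmissible n x y"
          by (simp add: inadmissible_iff lookup_minus)
        then show "X (sign_vec n x, sign_vec n y) = \<Phi> f (sign_vec n x, sign_vec n y)"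
          unfolding q(2)[OF xy] \<Phi>_at[OF xy] unfolding hyp_coset_eq_iff[OF q(1)[OF xy] pp[OF fC]] unfolding H[OF xy]
          using q(1)[OF xy] pp[OF fC] by (simp add: poly_ring_diff_closed)
      qed
      then show "X \<in> \<Phi> ` ?C" using fC by blast
    qed
    show "\<Phi> f = \<Phi> g \<longleftrightarrow> \<pi> f = \<pi> g" if f: "f \<in> ?C" and g: "g \<in> ?C" for f g
    proof -
      have "\<Phi> f = \<Phi> g \<longleftrightarrow> (\<forall>x\<in>W. \<forall>y\<in>W. \<Phi> f (sign_vec n x, sign_vec n y) = \<Phi> g (sign_vec n x, sign_vec n y))"
        using eqI[OF \<Phi>_ext \<Phi>_ext, of f g] by auto
      also have "\<dots> \<longleftrightarrow> (\<forall>x\<in>W. \<forall>y\<in>W. path_poly x y (f - g) \<in> inadmissible n x y)"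
      proof -
        have "\<Phi> f (sign_vec n x, sign_vec n y) = \<Phi> g (sign_vec n x, sign_vec n y) \<longleftrightarrow>
            path_poly x y (f - g) \<in> inadmissible n x y" if xy: "x \<in> W" "y \<in> W" for x y
          unfolding \<Phi>_at[OF xy] unfolding hyp_coset_eq_iff[OF pp[OF f] pp[OF g]] unfolding H[OF xy]
          using pp[OF f] pp[OF g] by (simp add: poly_ring_diff_closed)
        then show ?thesis by blast
      qed
      also have "\<dots> \<longleftrightarrow> f - g \<in> path_kernel n k"
      proof -
        have "f - g \<in> ?C" using f g keys_diff[of f g] by (fastforce simp: corner_paths_def)
        then have "Poly_Mapping.keys (f - g) \<subseteq> os_paths n k" "\<And>x y. x \<notin> W \<or> y \<notin> W \<Longrightarrow> path_poly x y (f - g) = 0"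
          using corner_pathsD path_poly_outside by blast+
        moreover from this(2) have "path_poly x y (f - g) \<in> inadmissible n x y"
          if "\<not> (x \<in> W \<and> y \<in> W)" for x y using that by (metis inadmissible_zero)
        ultimately show ?thesis using Ws unfolding path_kernel_def by blast
      qed
      also have "\<dots> \<longleftrightarrow> \<pi> f = \<pi> g"
        unfolding \<pi>_def os_coset_eq_iff[OF corner_pathsD(1)[OF f] corner_pathsD(1)[OF g]]
        by (simp add: os_ideal_eq_kernel[OF kn])
      finally show ?thesis .
    qed
    have e: "frag_of (x, [], x) \<in> ?C" if "x \<in> W" for x
      using that Ws by (auto simp: corner_paths_def)
    then show uC: "(\<Sum>x\<in>W. frag_of (x, [], x)) \<in> ?C" by (rule corner_paths_sum)
    show "\<pi> (\<Sum>x\<in>W. frag_of (x, [], x)) = \<one>\<^bsub>os_corner n k W\<^esub>"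
    proof -
      have "\<one>\<^bsub>os_corner n k W\<^esub> = finsum (?P Quot os_ideal n k) (\<lambda>x. os_ideal n k +>\<^bsub>?P\<^esub> frag_of (x, [], x)) W"
        by (simp add: os_corner_def os_algebra_def os_idem_def[abs_def])
      also have "\<dots> = \<pi> (finsum ?P (\<lambda>x. frag_of (x, [], x)) W)"
        unfolding \<pi>_def by (intro finsum_FactRing ideal_os_ideal fW) (use corner_pathsD(2)[OF e] in auto)
      also have "finsum ?P (\<lambda>x. frag_of (x, [], x)) W = (\<Sum>x\<in>W. frag_of (x, [], x))"
        by (intro finsum_path_algebra fW corner_pathsD(1)[OF e])
      finally show ?thesis by simp
    qed
    show "\<Phi> (\<Sum>x\<in>W. frag_of (x, [], x)) = \<one>\<^bsub>conv_algebra n \<eta> ?A\<^esub>"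
    proof (rule eqI[OF \<Phi>_ext])
      show "\<one>\<^bsub>conv_algebra n \<eta> ?A\<^esub> \<in> extensional (?A \<times> ?A)" by (simp add: conv_algebra_def)
      fix x y assume xy: "x \<in> W" "y \<in> W"
      have "path_poly x y (\<Sum>x\<in>W. frag_of (x, [], x)) = (\<Sum>z\<in>W. if z = x then (if x = y then 1 else 0) else 0)"
        unfolding path_poly_sum[OF fW] by (intro sum.cong refl) auto
      also have "\<dots> = (if x = y then 1 else 0)" using fW xy by simp
      finally have "path_poly x y (\<Sum>x\<in>W. frag_of (x, [], x)) = (if x = y then 1 else 0)" .
      moreover have "?H \<alpha> \<beta> +>\<^bsub>poly_ring n\<^esub> 0 = ?H \<alpha> \<beta>" for \<alpha> \<beta>
        by (auto simp: a_r_coset_def' add_poly_ring)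
      moreover have "sign_vec n x = sign_vec n y \<longleftrightarrow> x = y" using xy inj by (auto dest: inj_onD)
      ultimately show "\<Phi> (\<Sum>x\<in>W. frag_of (x, [], x)) (sign_vec n x, sign_vec n y) = \<one>\<^bsub>conv_algebra n \<eta> ?A\<^esub> (sign_vec n x, sign_vec n y)"
        unfolding \<Phi>_at[OF xy] using xy
        by (simp add: conv_algebra_def hyp_R_def FactRing_def one_poly_ring)
    qed
    fix f g assume f: "f \<in> ?C" and g: "g \<in> ?C"
    note fP = corner_pathsD[OF f] and gP = corner_pathsD[OF g]
    have "f + g \<in> ?C" using f g keys_add[of f g] by (fastforce simp: corner_paths_def)
    moreover have "\<pi> (f + g) = \<pi> f \<oplus>\<^bsub>os_corner n k W\<^esub> \<pi> g"
      using ideal.a_rcos_sum[OF ideal_os_ideal fP(2) gP(2)]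
      by (simp add: os_corner_def os_algebra_def FactRing_def \<pi>_def add_path_algebra)
    moreover have "\<Phi> (f + g) = \<Phi> f \<oplus>\<^bsub>conv_algebra n \<eta> ?A\<^esub> \<Phi> g"
    proof (rule eqI[OF \<Phi>_ext])
      show "\<Phi> f \<oplus>\<^bsub>conv_algebra n \<eta> ?A\<^esub> \<Phi> g \<in> extensional (?A \<times> ?A)" by (simp add: conv_algebra_def)
      fix x y assume xy: "x \<in> W" "y \<in> W"
      show "\<Phi> (f + g) (sign_vec n x, sign_vec n y) = (\<Phi> f \<oplus>\<^bsub>conv_algebra n \<eta> ?A\<^esub> \<Phi> g) (sign_vec n x, sign_vec n y)"
        using ideal.a_rcos_sum[OF ideal_hyp_ideal pp[OF f] pp[OF g], of \<eta> "sign_vec n x" "sign_vec n y" x y x y] xy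
        by (simp add: conv_algebra_def \<Phi>_at hyp_R_def FactRing_def add_poly_ring)
    qed
    ultimately show "f + g \<in> ?C \<and> \<Phi> (f + g) = \<Phi> f \<oplus>\<^bsub>conv_algebra n \<eta> ?A\<^esub> \<Phi> g \<and> \<pi> (f + g) = \<pi> f \<oplus>\<^bsub>os_corner n k W\<^esub> \<pi> g"
      by blast
    have "path_mult f g \<in> ?C" by (rule corner_paths_mult[OF f g])
    moreover have "\<pi> (path_mult f g) = \<pi> f \<otimes>\<^bsub>os_corner n k W\<^esub> \<pi> g"
      using ideal.rcoset_mult_add[OF ideal_os_ideal fP(2) gP(2)]
      by (simp add: os_corner_def os_algebra_def FactRing_def \<pi>_def mult_path_algebra)
    moreover have "\<Phi> (path_mult f g) = \<Phi> f \<otimes>\<^bsub>conv_algebra n \<eta> ?A\<^esub> \<Phi> g"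
    proof (rule eqI[OF \<Phi>_ext])
      show "\<Phi> f \<otimes>\<^bsub>conv_algebra n \<eta> ?A\<^esub> \<Phi> g \<in> extensional (?A \<times> ?A)" by (simp add: conv_algebra_def)
      fix x z assume xz: "x \<in> W" "z \<in> W"
      let ?x = "sign_vec n x" and ?z = "sign_vec n z"
      interpret Q: ring "poly_ring n Quot ?H ?x ?z" by (rule ideal.quotient_is_ring[OF ideal_hyp_ideal])
      define t where "t \<beta> = u_mon (conv_set n ?x \<beta> ?z) * path_poly x (r \<beta>) f * path_poly (r \<beta>) z g" for \<beta>
      have tc: "t \<beta> \<in> carrier (poly_ring n)" for \<beta>
        unfolding t_def by (intro poly_ring_mult_closed u_mon_carrier pp f g) (auto simp: conv_set_def)
      have "(\<Phi> f \<otimes>\<^bsub>conv_algebra n \<eta> ?A\<^esub> \<Phi> g) (?x, ?z) =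
        finsum (poly_ring n Quot ?H ?x ?z) (\<lambda>\<beta>. conv_mult n \<eta> ?x \<beta> ?z (\<Phi> f (?x, \<beta>)) (\<Phi> g (\<beta>, ?z))) ?A"
        using xz by (simp add: conv_algebra_def hyp_R_def)
      also have "\<dots> = finsum (poly_ring n Quot ?H ?x ?z) (\<lambda>\<beta>. ?H ?x ?z +>\<^bsub>poly_ring n\<^esub> t \<beta>) ?A"
      proof (rule Q.finsum_cong')
        show "(\<lambda>\<beta>. ?H ?x ?z +>\<^bsub>poly_ring n\<^esub> t \<beta>) \<in> ?A \<rightarrow> carrier (poly_ring n Quot ?H ?x ?z)"
          using tc by (auto simp: FactRing_def A_RCOSETS_def')
        fix \<beta> assume "\<beta> \<in> ?A"
        then obtain y where y: "y \<in> W" "\<beta> = sign_vec n y" by blast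
        show "conv_mult n \<eta> ?x \<beta> ?z (\<Phi> f (?x, \<beta>)) (\<Phi> g (\<beta>, ?z)) = ?H ?x ?z +>\<^bsub>poly_ring n\<^esub> t \<beta>"
          unfolding y(2) \<Phi>_at[OF xz(1) y(1)] \<Phi>_at[OF y(1) xz(2)] t_def
          using y(1) by (simp add: conv_mult_cosets sign_vec_seqs pp f g)
      qed simp
      also have "\<dots> = ?H ?x ?z +>\<^bsub>poly_ring n\<^esub> finsum (poly_ring n) t ?A"
        using fW tc by (intro finsum_FactRing ideal_hyp_ideal) auto
      also have "finsum (poly_ring n) t ?A = sum t ?A" using fW tc by (intro finsum_poly_ring) auto
      also have "\<dots> = (\<Sum>y\<in>W. u_mon (conv_gaps x y z) * path_poly x y f * path_poly y z g)"
        unfolding sum.reindex[OF inj] by (intro sum.cong refl) (simp add: t_def conv_set_sign_vec[OF Ws[OF xz(1)] Ws])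
      \<comment> \<open>States outside \<open>W\<close> contribute nothing, as \<open>f\<close> has
        no path ending there.\<close>
      also have "\<dots> = (\<Sum>y\<in>os_states {0..n} k. u_mon (conv_gaps x y z) * path_poly x y f * path_poly y z g)"
        using W path_poly_outside[OF f] by (intro sum.mono_neutral_left) auto
      also have "\<dots> = path_poly x z (path_mult f g)"
        by (rule path_poly_mult[OF fP(1) gP(1), symmetric])
      finally show "\<Phi> (path_mult f g) (?x, ?z) = (\<Phi> f \<otimes>\<^bsub>conv_algebra n \<eta> ?A\<^esub> \<Phi> g) (?x, ?z)"
        by (simp add: \<Phi>_at[OF xz])
    qed
    ultimately show "path_mult f g \<in> ?C \<and> \<Phi> (path_mult f g) = \<Phi> f \<otimes>\<^bsub>conv_algebra n \<eta> ?A\<^esub> \<Phi> g \<and>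
        \<pi> (path_mult f g) = \<pi> f \<otimes>\<^bsub>os_corner n k W\<^esub> \<pi> g"
      by blast
  qed
qed

section \<open>Maximal minors\<close>

text \<open>Columns come as a list rather than a set, so that an extra column can be appended out of
  order or repeated.\<close>

definition minor :: "nat \<Rightarrow> (nat \<Rightarrow> (nat \<Rightarrow>\<^sub>0 real)) \<Rightarrow> nat list \<Rightarrow> real" where
  "minor d b cs = Determinant.det (Matrix.mat d d (\<lambda>(i, j). Poly_Mapping.lookup (b i) (cs ! j)))"

lemma plucker_minor: "plucker d b I = minor d b (sorted_list_of_set I)"
  by (simp add: plucker_def minor_def)

lemma minor_move_last:
  assumes "length xs + Suc (length ys) = d"
  shows "minor d b (xs @ j # ys) = (- 1) ^ length ys * minor d b (xs @ ys @ [j])"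
proof -
  let ?A = "Matrix.mat d d (\<lambda>(i, c). Poly_Mapping.lookup (b i) ((xs @ j # ys) ! c))"
  have "Determinant.det ?A = (- 1) ^ (1 * length ys) * Determinant.det (Matrix.mat d d
      (\<lambda>(i, c). ?A $$ (i, if c < length xs then c else if c < length xs + length ys then c + 1 else c - length ys)))"
    by (rule det_swap_final_cols) (use assms in auto)
  also have "Matrix.mat d d (\<lambda>(i, c). ?A $$ (i, if c < length xs then c else if c < length xs + length ys then c + 1 else c - length ys))
      = Matrix.mat d d (\<lambda>(i, c). Poly_Mapping.lookup (b i) ((xs @ ys @ [j]) ! c))"
  proof (rule eq_matI)
    fix i c assume ic: "i < dim_row (Matrix.mat d d (\<lambda>(i, c). Poly_Mapping.lookup (b i) ((xs @ ys @ [j]) ! c)))"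
      "c < dim_col (Matrix.mat d d (\<lambda>(i, c). Poly_Mapping.lookup (b i) ((xs @ ys @ [j]) ! c)))"
    then have c: "c < d" "i < d" by simp_all
    consider "c < length xs" | "length xs \<le> c" "c < length xs + length ys" | "c = length xs + length ys"
      using c assms by linarith
    then show "Matrix.mat d d (\<lambda>(i, c). ?A $$ (i, if c < length xs then c else if c < length xs + length ys then c + 1 else c - length ys)) $$ (i, c)
      = Matrix.mat d d (\<lambda>(i, c). Poly_Mapping.lookup (b i) ((xs @ ys @ [j]) ! c)) $$ (i, c)"
      using c assms by cases (auto simp: nth_append Suc_diff_le)
  qed simp_all
  finally show ?thesis by (simp add: minor_def)
qed

lemma minor_repeat:
  assumes "length cs = d" "j \<in> set cs"
  shows "minor (Suc d) b (cs @ [j]) = 0"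
proof -
  obtain a where a: "a < d" "cs ! a = j" using assms by (auto simp: in_set_conv_nth)
  show ?thesis unfolding minor_def
    by (rule det_identical_columns[of _ "Suc d" a d])
      (use a assms(1) in \<open>auto simp: nth_append Matrix.col_def\<close>)
qed

text \<open>The cofactors along the last column do not involve its entries, so a single
  \<open>c\<close> serves every \<open>j\<close>; the last cofactor is the minor of the first
  \<open>d\<close> rows.\<close>

lemma minor_expand_last:
  assumes "length cs = d"
  shows "\<exists>c. c d = minor d b cs \<and>
    (\<forall>j. minor (Suc d) b (cs @ [j]) = (\<Sum>i<Suc d. c i * Poly_Mapping.lookup (b i) j))"
proof -
  define A where "A j = Matrix.mat (Suc d) (Suc d) (\<lambda>(i, c). Poly_Mapping.lookup (b i) ((cs @ [j]) ! c))" for j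
  have del: "mat_delete (A j) i d = Matrix.mat d d (\<lambda>(i', j'). Poly_Mapping.lookup (b (if i' < i then i' else Suc i')) (cs ! j'))"
    if "i < Suc d" for i j
    unfolding mat_delete_def A_def using that assms
    by (intro eq_matI) (auto simp: nth_append)
  define c where "c i = cofactor (A 0) i d" for i
  have cof: "cofactor (A j) i d = c i" if "i < Suc d" for i j
    unfolding c_def cofactor_def del[OF that] ..
  have "minor (Suc d) b (cs @ [j]) = (\<Sum>i<Suc d. c i * Poly_Mapping.lookup (b i) j)" for j
  proof -
    have "Determinant.det (A j) = (\<Sum>i<Suc d. A j $$ (i, d) * cofactor (A j) i d)"
      by (rule laplace_expansion_column) (auto simp: A_def)
    also have "\<dots> = (\<Sum>i<Suc d. c i * Poly_Mapping.lookup (b i) j)"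
      by (rule sum.cong[OF refl]) (simp add: cof, simp add: A_def nth_append assms)
    finally show ?thesis by (simp add: minor_def A_def)
  qed
  moreover have "c d = minor d b cs"
  proof -
    have "Matrix.mat d d (\<lambda>(i', j'). Poly_Mapping.lookup (b (if i' < d then i' else Suc i')) (cs ! j')) =
        Matrix.mat d d (\<lambda>(i, j). Poly_Mapping.lookup (b i) (cs ! j))"
      by (intro eq_matI) auto
    then show ?thesis unfolding c_def cofactor_def del[OF lessI] minor_def by simp
  qed
  ultimately show ?thesis by blast
qed

lemma sorted_list_of_set_split:
  assumes "finite I"
  shows "sorted_list_of_set (insert j I) =
      sorted_list_of_set {i \<in> I. i < j} @ j # sorted_list_of_set {i \<in> I. j < i}"
    and "j \<notin> I \<Longrightarrow> sorted_list_of_set I =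
      sorted_list_of_set {i \<in> I. i < j} @ sorted_list_of_set {i \<in> I. j < i}"
proof -
  let ?xs = "sorted_list_of_set {i \<in> I. i < j}" and ?ys = "sorted_list_of_set {i \<in> I. j < i}"
  have set: "set ?xs = {i \<in> I. i < j}" "set ?ys = {i \<in> I. j < i}" using assms by simp_all
  have sd: "sorted ?xs" "sorted ?ys" "distinct ?xs" "distinct ?ys" by simp_all
  have "sorted (j # ?ys)" unfolding sorted_wrt.simps set(2) by (intro conjI ballI sd(2)) auto
  then have 1: "sorted (?xs @ j # ?ys)"
    unfolding sorted_append by (intro conjI ballI sd(1)) (auto simp: set)
  have s2: "sorted (?xs @ ?ys)"
    unfolding sorted_append by (intro conjI ballI sd(1,2)) (auto simp: set)
  have 2: "distinct (?xs @ j # ?ys)" "distinct (?xs @ ?ys)"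
    unfolding distinct_append distinct.simps list.set set using sd(3,4) by auto
  have "insert j I = set (?xs @ j # ?ys)" unfolding set_append list.set set by auto
  then show "sorted_list_of_set (insert j I) = ?xs @ j # ?ys"
    using sorted_list_of_set.idem_if_sorted_distinct[OF 1 2(1)] by simp
  assume "j \<notin> I"
  then have "I = set (?xs @ ?ys)" unfolding set_append list.set set by (auto simp: not_less le_less)
  then show "sorted_list_of_set I = ?xs @ ?ys"
    using sorted_list_of_set.idem_if_sorted_distinct[OF s2 2(2)] by simp
qed

lemma plucker_insert:
  assumes "finite I" "card I = d" "j \<notin> I"
  shows "minor (Suc d) b (sorted_list_of_set I @ [j]) =
    (- 1) ^ card {i \<in> I. j < i} * plucker (Suc d) b (insert j I)"
proof -
  let ?xs = "sorted_list_of_set {i \<in> I. i < j}" and ?ys = "sorted_list_of_set {i \<in> I. j < i}"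
  have "length (sorted_list_of_set I) = d" using assms by simp
  then have "length ?xs + Suc (length ?ys) = Suc d"
    unfolding sorted_list_of_set_split(2)[OF assms(1,3)] by simp
  from minor_move_last[OF this, of b j] show ?thesis
    unfolding plucker_minor sorted_list_of_set_split(1)[OF assms(1)] sorted_list_of_set_split(2)[OF assms(1,3)]
    by (simp add: mult.assoc[symmetric] power_add[symmetric] mult_2[symmetric])
qed

lemma lookup_scaleR [simp]: "Poly_Mapping.lookup (a *\<^sub>R x) j = a * Poly_Mapping.lookup x (j :: nat)"
proof -
  have "finite {i. a * Poly_Mapping.lookup x i \<noteq> 0}"
    by (rule rev_finite_subset[OF finite_lookup[of x]]) auto
  then show ?thesis by (simp add: scaleR_poly_mapping_def)
qed

text \<open>The witness is the vector of signed cofactors along an extra column.\<close>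

lemma minor_vector:
  assumes "finite I" "card I = d"
  shows "\<exists>c. c d = plucker d b I \<and> (\<forall>j. Poly_Mapping.lookup (\<Sum>i<Suc d. c i *\<^sub>R b i) j =
    (if j \<in> I then 0 else (- 1) ^ card {i \<in> I. j < i} * plucker (Suc d) b (insert j I)))"
proof -
  have len: "length (sorted_list_of_set I) = d" using assms by simp
  obtain c where c: "c d = minor d b (sorted_list_of_set I)"
    "\<And>j. minor (Suc d) b (sorted_list_of_set I @ [j]) = (\<Sum>i<Suc d. c i * Poly_Mapping.lookup (b i) j)"
    using minor_expand_last[OF len, of b] by blast
  have "Poly_Mapping.lookup (\<Sum>i<Suc d. c i *\<^sub>R b i) j = minor (Suc d) b (sorted_list_of_set I @ [j])" for j
    unfolding c(2) lookup_sum by simp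
  then show ?thesis
    using c(1) minor_repeat[OF len] plucker_insert[OF assms] assms(1)
    by (intro exI[of _ c]) (auto simp: plucker_minor)
qed

text \<open>The row \<open>b i0\<close> is repeated as an additional last row; the determinant
  vanishes, and its expansion along that row is the relation.\<close>

lemma minor_relation:
  assumes "finite K" "card K = Suc d" "i0 < d"
  shows "(\<Sum>j\<in>K. (- 1) ^ height K j * plucker d b (K - {j}) * Poly_Mapping.lookup (b i0) j) = 0"
proof -
  define L where "L = sorted_list_of_set K"
  have L: "length L = Suc d" "distinct L" "set L = K" using assms by (simp_all add: L_def)
  define b' where "b' = b(d := b i0)"
  define A where "A = Matrix.mat (Suc d) (Suc d) (\<lambda>(i, j). Poly_Mapping.lookup (b' i) (L ! j))"
  have A: "A \<in> carrier_mat (Suc d) (Suc d)" by (simp add: A_def)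
  have "Determinant.det A = 0"
    by (rule det_identical_rows[OF A, of i0 d]) (use assms(3) in \<open>auto simp: A_def Matrix.row_def b'_def\<close>)
  moreover have "Determinant.det A = (\<Sum>l<Suc d. A $$ (d, l) * cofactor A d l)"
    by (rule laplace_expansion_row[OF A]) simp
  moreover have "A $$ (d, l) * cofactor A d l =
      (- 1) ^ d * ((- 1) ^ height K (L ! l) * plucker d b (K - {L ! l}) * Poly_Mapping.lookup (b i0) (L ! l))"
    if l: "l < Suc d" for l
  proof -
    define j where "j = L ! l"
    have jK: "j \<in> K" using l L nth_mem by (fastforce simp: j_def)
    let ?K = "K - {j}"
    have fin: "finite ?K" using assms(1) by simp
    have ins: "insert j ?K = K" using jK by blast
    obtain xs ys where split: "L = xs @ j # ys" "sorted_list_of_set ?K = xs @ ys" and xs: "xs = sorted_list_of_set {i \<in> ?K. i < j}"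
      using sorted_list_of_set_split[OF fin, of j] unfolding ins L_def by simp
    have "{i \<in> ?K. i < j} = {i \<in> K. i < j}" by auto
    then have h: "length xs = height K j" by (simp add: xs height_def)
    have "L ! length xs = j" "length xs < length L" by (simp_all add: split)
    then have lxs: "length xs = l" using l L nth_eq_iff_index_eq[of L "length xs" l] by (simp add: j_def)
    have "mat_delete A d l = Matrix.mat d d (\<lambda>(i, c). Poly_Mapping.lookup (b i) (sorted_list_of_set ?K ! c))"
    proof (rule eq_matI)
      fix i c assume "i < dim_row (Matrix.mat d d (\<lambda>(i, c). Poly_Mapping.lookup (b i) (sorted_list_of_set ?K ! c)))"
        "c < dim_col (Matrix.mat d d (\<lambda>(i, c). Poly_Mapping.lookup (b i) (sorted_list_of_set ?K ! c)))"
      then have ic: "i < d" "c < d" by simp_all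
      have "L ! (if c < l then c else Suc c) = sorted_list_of_set ?K ! c"
        unfolding split by (auto simp: nth_append lxs Suc_diff_le)
      then show "mat_delete A d l $$ (i, c) = Matrix.mat d d (\<lambda>(i, c). Poly_Mapping.lookup (b i) (sorted_list_of_set ?K ! c)) $$ (i, c)"
        using ic by (simp add: mat_delete_def A_def b'_def)
    qed (simp_all add: mat_delete_def A_def)
    then have "cofactor A d l = (- 1) ^ (d + l) * plucker d b ?K" by (simp add: cofactor_def plucker_def)
    moreover have "A $$ (d, l) = Poly_Mapping.lookup (b i0) j" using l by (simp add: A_def b'_def j_def)
    ultimately show ?thesis using h lxs by (simp add: j_def power_add)
  qed
  ultimately have "(- 1) ^ d * (\<Sum>l<Suc d. (- 1) ^ height K (L ! l) * plucker d b (K - {L ! l}) * Poly_Mapping.lookup (b i0) (L ! l)) = 0"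
    by (simp add: sum_distrib_left del: sum.lessThan_Suc)
  then have "(\<Sum>l<Suc d. (- 1) ^ height K (L ! l) * plucker d b (K - {L ! l}) * Poly_Mapping.lookup (b i0) (L ! l)) = 0"
    by (simp del: sum.lessThan_Suc)
  moreover have "bij_betw ((!) L) {..<Suc d} K" using L by (intro bij_betw_nth) auto
  ultimately show ?thesis using sum.reindex_bij_betw[of "(!) L" "{..<Suc d}" K
      "\<lambda>j. (- 1) ^ height K j * plucker d b (K - {j}) * Poly_Mapping.lookup (b i0) j"] by argo
qed

section \<open>Positive frames\<close>

text \<open>The span with coefficients indexed by position, which avoids reindexing along the image
  of \<open>b\<close>.\<close>

definition combos :: "nat \<Rightarrow> (nat \<Rightarrow> (nat \<Rightarrow>\<^sub>0 real)) \<Rightarrow> (nat \<Rightarrow>\<^sub>0 real) set" where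
  "combos d b = range (\<lambda>a. \<Sum>i<d. a i *\<^sub>R b i)"

definition pos_frame :: "nat \<Rightarrow> nat set \<Rightarrow> (nat \<Rightarrow> (nat \<Rightarrow>\<^sub>0 real)) \<Rightarrow> bool" where
  "pos_frame d J b \<longleftrightarrow> (\<exists>e\<in>{1, -1}. \<forall>I. I \<subseteq> J \<longrightarrow> card I = d \<longrightarrow> e * plucker d b I > 0)"

lemma pos_frame_mono: "pos_frame d J b \<Longrightarrow> J' \<subseteq> J \<Longrightarrow> pos_frame d J' b"
  unfolding pos_frame_def by (meson subset_trans)

lemma combosI: "(\<Sum>i<d. a i *\<^sub>R b i) \<in> combos d b"
  by (simp add: combos_def)

lemma combos_basis: "i < d \<Longrightarrow> b i \<in> combos d b"
proof -
  assume "i < d"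
  then have "b i = (\<Sum>l<d. (if l = i then 1 else 0) *\<^sub>R b l)" by (simp add: if_distrib[of "\<lambda>t. t *\<^sub>R _"] cong: if_cong)
  then show ?thesis unfolding combos_def by (rule range_eqI[of _ _ "\<lambda>l. if l = i then 1 else 0"])
qed

lemma Gr_pos_frame:
  assumes "V \<in> Gr_pos d J"
  obtains b where "V = combos d b" "pos_frame d J b"
proof -
  obtain b where b: "inj_on b {..<d}" "Real_Vector_Spaces.span (b ` {..<d}) = V"
    "(\<forall>I. I \<subseteq> J \<and> card I = d \<longrightarrow> plucker d b I > 0) \<or> (\<forall>I. I \<subseteq> J \<and> card I = d \<longrightarrow> plucker d b I < 0)"
    using assms unfolding Gr_pos_def by blast
  have "V = range (\<lambda>u. \<Sum>v\<in>b ` {..<d}. u v *\<^sub>R v)"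
    using b(2) Real_Vector_Spaces.span_finite[of "b ` {..<d}"] by simp
  also have "\<dots> = combos d b"
  proof
    show "range (\<lambda>u. \<Sum>v\<in>b ` {..<d}. u v *\<^sub>R v) \<subseteq> combos d b"
      by (auto simp: combos_def sum.reindex[OF b(1)])
    show "combos d b \<subseteq> range (\<lambda>u. \<Sum>v\<in>b ` {..<d}. u v *\<^sub>R v)"
    proof
      fix x assume "x \<in> combos d b"
      then obtain a where "x = (\<Sum>i<d. a i *\<^sub>R b i)" by (auto simp: combos_def)
      also have "\<dots> = (\<Sum>v\<in>b ` {..<d}. a (inv_into {..<d} b v) *\<^sub>R v)"
        using b(1) by (simp add: sum.reindex[OF b(1)])
      finally show "x \<in> range (\<lambda>u. \<Sum>v\<in>b ` {..<d}. u v *\<^sub>R v)"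
        by (intro range_eqI[of _ _ "\<lambda>v. a (inv_into {..<d} b v)"]) simp
    qed
  qed
  finally have "V = combos d b" .
  moreover have "pos_frame d J b" unfolding pos_frame_def using b(3)
    by (elim disjE) (auto intro: bexI[of _ 1] bexI[of _ "-1"])
  ultimately show ?thesis by (rule that)
qed

text \<open>The base change matrix multiplies all maximal minors by the same determinant.\<close>

lemma pos_frame_change:
  assumes pos: "pos_frame d J b'" and J: "finite J" and b': "\<And>l. l < d \<Longrightarrow> b' l \<in> combos d b"
  shows "pos_frame d J b"
proof -
  have "\<exists>C. \<forall>l<d. b' l = (\<Sum>i<d. C l i *\<^sub>R b i)" using b' by (intro choice) (auto simp: combos_def)
  then obtain C where C: "\<And>l. l < d \<Longrightarrow> b' l = (\<Sum>i<d. C l i *\<^sub>R b i)" by blast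
  define M where "M = Matrix.mat d d (\<lambda>(l, i). C l i)"
  have pl: "plucker d b' I = Determinant.det M * plucker d b I" for I
  proof -
    let ?B = "Matrix.mat d d (\<lambda>(i, j). Poly_Mapping.lookup (b i) (sorted_list_of_set I ! j))"
    have "Matrix.mat d d (\<lambda>(i, j). Poly_Mapping.lookup (b' i) (sorted_list_of_set I ! j)) = M * ?B"
    proof (rule eq_matI)
      fix i j assume "i < dim_row (M * ?B)" "j < dim_col (M * ?B)"
      then have ij: "i < d" "j < d" by (simp_all add: M_def)
      then have "(M * ?B) $$ (i, j) = (\<Sum>l<d. C i l * Poly_Mapping.lookup (b l) (sorted_list_of_set I ! j))"
        by (simp add: M_def scalar_prod_def atLeast0LessThan)
      also have "\<dots> = Poly_Mapping.lookup (b' i) (sorted_list_of_set I ! j)"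
        by (simp add: C[OF ij(1)] lookup_sum)
      finally show "Matrix.mat d d (\<lambda>(i, j). Poly_Mapping.lookup (b' i) (sorted_list_of_set I ! j)) $$ (i, j) = (M * ?B) $$ (i, j)"
        using ij by simp
    qed (simp_all add: M_def)
    then show ?thesis unfolding plucker_def
      using det_mult[of M d ?B] by (simp add: M_def)
  qed
  obtain e where e: "e \<in> {1, -1}" "\<forall>I. I \<subseteq> J \<longrightarrow> card I = d \<longrightarrow> e * plucker d b' I > 0"
    using pos unfolding pos_frame_def by blast
  note e = e(1) e(2)[rule_format]
  have "e * sgn (Determinant.det M) * plucker d b I > 0 \<and> Determinant.det M \<noteq> 0" if "I \<subseteq> J" "card I = d" for I
  proof -
    have *: "e * (Determinant.det M * plucker d b I) > 0" using e(2)[OF that] by (simp add: pl)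
    then have nz: "Determinant.det M \<noteq> 0" by auto
    have "0 < e * (\<bar>Determinant.det M\<bar> * sgn (Determinant.det M) * plucker d b I)"
      unfolding abs_mult_sgn by (rule *)
    then have "0 < \<bar>Determinant.det M\<bar> * (e * sgn (Determinant.det M) * plucker d b I)" by (simp only: mult_ac)
    then show ?thesis using zero_less_mult_pos nz by (metis zero_less_abs_iff)
  qed
  then have *: "e * sgn (Determinant.det M) * plucker d b I > 0" and nz: "Determinant.det M \<noteq> 0"
    if "I \<subseteq> J" "card I = d" for I using that by blast+
  show ?thesis
  proof (cases "\<exists>I. I \<subseteq> J \<and> card I = d")
    case True
    then have "e * sgn (Determinant.det M) \<in> {1, -1}" using nz e(1) by (auto simp: sgn_if)
    then show ?thesis using * unfolding pos_frame_def by blast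
  next
    \<comment> \<open>With fewer than \<open>d\<close> columns the determinant may vanish, but there
      is no minor to compare.\<close>
    case False
    then show ?thesis unfolding pos_frame_def by blast
  qed
qed

lemma card_less_greater:
  assumes "finite I" "j \<notin> I"
  shows "card {i \<in> I. j < i} + height I j = card I"
proof -
  have "I = {i \<in> I. j < i} \<union> {i \<in> I. i < j}" using assms(2) by (auto simp: not_less le_less)
  then have "card I = card ({i \<in> I. j < i} \<union> {i \<in> I. i < j})" by simp
  also have "\<dots> = card {i \<in> I. j < i} + card {i \<in> I. i < j}"
    using assms(1) by (intro card_Un_disjoint) auto
  finally show ?thesis by (simp add: height_def)
qed

text \<open>The vector of signed cofactors vanishes on \<open>I\<close>, and its other entries are
  maximal minors up to sign. Positivity makes the sign change exactly when an index of
  \<open>I\<close> is passed.\<close>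

lemma pos_frame_vector:
  assumes pos: "pos_frame d J b" and J: "finite J" and I: "I \<subseteq> J" "Suc (card I) = d"
  shows "\<exists>v\<in>combos d b. (\<forall>i\<in>I. Poly_Mapping.lookup v i = 0) \<and>
    (\<forall>j\<in>J - I. (- 1) ^ height I j * Poly_Mapping.lookup v j > 0)"
proof -
  obtain e where e: "e \<in> {1, -1}" "\<forall>I. I \<subseteq> J \<longrightarrow> card I = d \<longrightarrow> e * plucker d b I > 0"
    using pos unfolding pos_frame_def by blast
  note e = e(1) e(2)[rule_format]
  have fI: "finite I" using I J finite_subset by blast
  obtain c where c: "\<And>j. Poly_Mapping.lookup (\<Sum>i<d. c i *\<^sub>R b i) j =
    (if j \<in> I then 0 else (- 1) ^ card {i \<in> I. j < i} * plucker d b (insert j I))"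
    using minor_vector[OF fI refl, of b] I(2) by auto
  \<comment> \<open>The cofactor sign counts the zeros to the right of \<open>j\<close>; the factor
    \<open>(- 1) ^ card I\<close> turns this into zeros to the left, and \<open>e\<close> removes
    the common sign of the minors.\<close>
  define s where "s = e * (- 1) ^ card I"
  define v where "v = (\<Sum>i<d. (s * c i) *\<^sub>R b i)"
  have v: "Poly_Mapping.lookup v j = s * Poly_Mapping.lookup (\<Sum>i<d. c i *\<^sub>R b i) j" for j
    by (simp add: v_def lookup_sum sum_distrib_left mult.assoc)
  have "(- 1) ^ height I j * Poly_Mapping.lookup v j > 0" if j: "j \<in> J - I" for j
  proof -
    have "card (insert j I) = d" "insert j I \<subseteq> J" using j fI I by auto
    then have p: "e * plucker d b (insert j I) > 0" by (intro e(2))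
    have "card I = card {i \<in> I. j < i} + height I j" using card_less_greater[OF fI] j by simp
    then have "(- 1) ^ height I j * Poly_Mapping.lookup v j =
      ((- 1) ^ height I j * (- 1) ^ height I j) *
      ((- 1) ^ card {i \<in> I. j < i} * (- 1) ^ card {i \<in> I. j < i}) * (e * plucker d b (insert j I))"
      using j by (simp add: v c s_def power_add mult_ac)
    then show ?thesis using p by (simp add: power_mult_distrib[symmetric])
  qed
  moreover have "v \<in> combos d b" by (simp add: v_def combos_def)
  ultimately show ?thesis using v c by (intro bexI[of _ v]) auto
qed

text \<open>The coefficients are the maximal minors with one column omitted, hence of one sign apart
  from the alternation. Such relations serve below as certificates that a region is bounded or
  compact.\<close>

lemma pos_frame_relation:
  assumes pos: "pos_frame d J b" and K: "finite K" "K \<subseteq> J" "card K = Suc d"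
  shows "\<exists>e. (\<forall>j\<in>K. e j > 0) \<and>
    (\<forall>v\<in>combos d b. (\<Sum>j\<in>K. (- 1) ^ height K j * e j * Poly_Mapping.lookup v j) = 0)"
proof -
  obtain s where s: "s \<in> {1, -1}" "\<forall>I. I \<subseteq> J \<longrightarrow> card I = d \<longrightarrow> s * plucker d b I > 0"
    using pos unfolding pos_frame_def by blast
  note s = s(1) s(2)[rule_format]
  define e where "e j = s * plucker d b (K - {j})" for j
  have "e j > 0" if "j \<in> K" for j
    unfolding e_def using that K by (intro s(2)) (auto simp: card_Diff_singleton)
  moreover have "(\<Sum>j\<in>K. (- 1) ^ height K j * e j * Poly_Mapping.lookup v j) = 0" if v: "v \<in> combos d b" for v
  proof -
    obtain a where a: "v = (\<Sum>i<d. a i *\<^sub>R b i)" using v by (auto simp: combos_def)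
    have "(\<Sum>j\<in>K. (- 1) ^ height K j * e j * Poly_Mapping.lookup v j) =
      (\<Sum>j\<in>K. \<Sum>i<d. s * a i * ((- 1) ^ height K j * plucker d b (K - {j}) * Poly_Mapping.lookup (b i) j))"
      by (simp add: a lookup_sum sum_distrib_left e_def mult_ac)
    also have "\<dots> = (\<Sum>i<d. s * a i * (\<Sum>j\<in>K. (- 1) ^ height K j * plucker d b (K - {j}) * Poly_Mapping.lookup (b i) j))"
      by (subst sum.swap) (simp add: sum_distrib_left)
    also have "\<dots> = 0" by (intro sum.neutral) (use minor_relation[OF K(1,3)] in auto)
    finally show ?thesis .
  qed
  ultimately show ?thesis by blast
qed

section \<open>Vertices of positive arrangements\<close>

abbreviation coord :: "(nat \<Rightarrow>\<^sub>0 real) \<Rightarrow> nat \<Rightarrow> real" where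
  "coord \<equiv> Poly_Mapping.lookup"

text \<open>The frame \<open>b\<close> of \<open>V\<close> is extended by a representative
  \<open>r\<close> of \<eta> at position \<open>k\<close>, so that a maximal minor of
  \<open>V\<close> is the coefficient of \<open>r\<close> in a cofactor vector. Of the orthogonal
  projection, \<open>orient\<close> keeps only the point of \<eta> orthogonal to
  \<open>V\<close>.\<close>

locale pos_arrangement =
  fixes n k :: nat and V \<eta> :: "(nat \<Rightarrow>\<^sub>0 real) set" and b :: "nat \<Rightarrow> (nat \<Rightarrow>\<^sub>0 real)" and r :: "nat \<Rightarrow>\<^sub>0 real"
  assumes kn: "k < n"
    and V_combos: "V = combos k b" and V_coord: "V \<subseteq> coord_space {1..n}"
    and V_sub: "Real_Vector_Spaces.subspace V"
    and V_pos: "pos_frame k {1..n} b"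
    and r_coord: "r \<in> coord_space {1..n}" and \<eta>_eq: "\<eta> = (\<lambda>v. r + v) ` V"
    and W_pos: "pos_frame (Suc k) {1..n} (b(k := r))"
    and orient: "\<exists>p\<in>\<eta>. (\<forall>v\<in>V. dot p v = 0) \<and> coord p 1 > 0"
begin

lemma \<eta>_diff: "x \<in> \<eta> \<Longrightarrow> y \<in> \<eta> \<Longrightarrow> x - y \<in> V"
  using Real_Vector_Spaces.subspace_diff[OF V_sub] by (auto simp: \<eta>_eq)

lemma \<eta>_add: "x \<in> \<eta> \<Longrightarrow> v \<in> V \<Longrightarrow> x + v \<in> \<eta>"
  using Real_Vector_Spaces.subspace_add[OF V_sub] by (auto simp: \<eta>_eq add.assoc)

lemma V_scale: "v \<in> V \<Longrightarrow> c *\<^sub>R v \<in> V"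
  using Real_Vector_Spaces.subspace_scale[OF V_sub] .

lemma V_outside: "v \<in> V \<Longrightarrow> j \<notin> {1..n} \<Longrightarrow> coord v j = 0"
  using V_coord by (auto simp: coord_space_def in_keys_iff subset_iff)

text \<open>The alternating relation on \<open>I\<close> and one more index \<open>j\<close> has a
  nonzero coefficient at \<open>j\<close>, so coordinate \<open>j\<close> vanishes as well. Thus any
  \<open>k\<close> coordinates determine a vector of \<open>V\<close>.\<close>

lemma V_zero:
  assumes v: "v \<in> V" and I: "I \<subseteq> {1..n}" "card I = k" and z: "\<And>i. i \<in> I \<Longrightarrow> coord v i = 0"
  shows "v = 0"
proof (rule poly_mapping_eqI)
  fix j
  show "coord v j = coord 0 j"
  proof (cases "j \<in> {1..n} - I")
    case True
    have fI: "finite I" using I finite_subset by blast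
    have K: "finite (insert j I)" "insert j I \<subseteq> {1..n}" "card (insert j I) = Suc k"
      using True I fI by auto
    obtain e where e: "\<forall>i\<in>insert j I. e i > 0"
      "\<forall>v\<in>combos k b. (\<Sum>i\<in>insert j I. (- 1) ^ height (insert j I) i * e i * coord v i) = 0"
      using pos_frame_relation[OF V_pos K] by blast
    have "(\<Sum>i\<in>insert j I. (- 1) ^ height (insert j I) i * e i * coord v i) =
      (- 1) ^ height (insert j I) j * e j * coord v j"
      using True fI z by (subst sum.insert) (auto intro!: sum.neutral)
    then have "(- 1) ^ height (insert j I) j * e j * coord v j = 0"
      using e(2) v V_combos by simp
    then show ?thesis using e(1) by simp
  next
    case False
    then show ?thesis using V_outside[OF v, of j] z by auto
  qed
qed

lemma V_vector:
  assumes "I \<subseteq> {1..n}" "Suc (card I) = k"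
  obtains v where "v \<in> V" "\<And>i. i \<in> I \<Longrightarrow> coord v i = 0"
    "\<And>j. j \<in> {1..n} - I \<Longrightarrow> (- 1) ^ height I j * coord v j > 0"
  using pos_frame_vector[OF V_pos _ assms] V_combos by auto

text \<open>The cofactor vector for \<open>I\<close> has the form \<open>w + c k *\<^sub>R r\<close>
  with \<open>w\<close> in \<open>V\<close>, and \<open>c k\<close> is the Pluecker coordinate of
  \<open>V\<close> at \<open>I\<close>, which is nonzero. Dividing by it gives the vertex.\<close>

lemma vertices_up_to_sign:
  "\<exists>\<delta>\<in>{1, -1}. \<forall>I. I \<subseteq> {1..n} \<longrightarrow> card I = k \<longrightarrow>
    (\<exists>x\<in>\<eta>. (\<forall>i\<in>I. coord x i = 0) \<and> (\<forall>j\<in>{1..n} - I. \<delta> * (- 1) ^ height I j * coord x j > 0))"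
proof -
  obtain e where e: "e \<in> {1, -1}" "\<forall>I. I \<subseteq> {1..n} \<longrightarrow> card I = k \<longrightarrow> e * plucker k b I > 0"
    using V_pos unfolding pos_frame_def by blast
  obtain e' where e': "e' \<in> {1, -1}" "\<forall>I. I \<subseteq> {1..n} \<longrightarrow> card I = Suc k \<longrightarrow> e' * plucker (Suc k) (b(k := r)) I > 0"
    using W_pos unfolding pos_frame_def by blast
  \<comment> \<open>The two frames contribute their common signs; \<open>(- 1) ^ k\<close> turns
    zeros to the right of \<open>j\<close> into zeros to the left.\<close>
  define \<delta> where "\<delta> = e * e' * (- 1) ^ k"
  have "\<exists>x\<in>\<eta>. (\<forall>i\<in>I. coord x i = 0) \<and> (\<forall>j\<in>{1..n} - I. \<delta> * (- 1) ^ height I j * coord x j > 0)"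
    if I: "I \<subseteq> {1..n}" "card I = k" for I
  proof -
    have fI: "finite I" using I finite_subset by blast
    obtain c where c: "c k = plucker k (b(k := r)) I"
      "\<forall>j. coord (\<Sum>i<Suc k. c i *\<^sub>R (b(k := r)) i) j =
        (if j \<in> I then 0 else (- 1) ^ card {i \<in> I. j < i} * plucker (Suc k) (b(k := r)) (insert j I))"
      using minor_vector[OF fI I(2), of "b(k := r)"] by blast
    have "plucker k (b(k := r)) I = plucker k b I"
      unfolding plucker_def by (rule arg_cong[where f = Determinant.det]) (auto intro!: eq_matI)
    then have ck: "e * c k > 0" using e(2) I c(1) by simp
    then have ck0: "c k \<noteq> 0" by auto
    define w where "w = (\<Sum>i<k. c i *\<^sub>R b i)"
    have sum: "(\<Sum>i<Suc k. c i *\<^sub>R (b(k := r)) i) = w + c k *\<^sub>R r" by (simp add: w_def)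
    have c2: "coord (w + c k *\<^sub>R r) j =
        (if j \<in> I then 0 else (- 1) ^ card {i \<in> I. j < i} * plucker (Suc k) (b(k := r)) (insert j I))" for j
      using c(2) unfolding sum by blast
    define x where "x = r + (1 / c k) *\<^sub>R w"
    have "w \<in> V" by (simp add: w_def V_combos combos_def)
    then have x: "x \<in> \<eta>" using V_scale by (simp add: x_def \<eta>_eq)
    have cx: "c k * coord x j = coord (w + c k *\<^sub>R r) j" for j
      using ck0 by (simp add: x_def lookup_add algebra_simps)
    have "coord x i = 0" if "i \<in> I" for i
      using cx[of i] ck0 that by (simp add: c2)
    moreover have "\<delta> * (- 1) ^ height I j * coord x j > 0" if j: "j \<in> {1..n} - I" for j
    proof -
      let ?p = "plucker (Suc k) (b(k := r)) (insert j I)" and ?g = "card {i \<in> I. j < i}"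
      have "insert j I \<subseteq> {1..n}" "card (insert j I) = Suc k" using j I fI by auto
      then have p: "e' * ?p > 0" using e'(2) by blast
      have kk: "k = ?g + height I j" using card_less_greater[OF fI, of j] j I by simp
      have "e * c k * (\<delta> * (- 1) ^ height I j * coord x j) = e * \<delta> * (- 1) ^ height I j * (c k * coord x j)"
        by (simp add: mult_ac)
      also have "c k * coord x j = (- 1) ^ ?g * ?p" using cx[of j] j by (simp add: c2)
      also have "e * \<delta> * (- 1) ^ height I j * ((- 1) ^ ?g * ?p) =
        (e * e) * ((- 1) ^ ?g * (- 1) ^ ?g) * ((- 1) ^ height I j * (- 1) ^ height I j) * (e' * ?p)"
        unfolding \<delta>_def by (subst kk) (simp add: power_add mult_ac)
      also have "\<dots> = e' * ?p" using e(1) by (auto simp: power_mult_distrib[symmetric])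
      finally show ?thesis using p ck zero_less_mult_pos by metis
    qed
    ultimately show ?thesis using x by blast
  qed
  moreover have "\<delta> \<in> {1, -1}" using e(1) e'(1) by (auto simp: \<delta>_def minus_one_power_iff)
  ultimately show ?thesis by blast
qed

definition zeros :: "(nat \<Rightarrow>\<^sub>0 real) \<Rightarrow> nat set" where
  "zeros x = {i \<in> {1..n}. coord x i = 0}"

lemma zeros_simps: "finite (zeros x)" "zeros x \<subseteq> {1..n}" "i \<in> zeros x \<Longrightarrow> coord x i = 0"
  by (auto simp: zeros_def)

text \<open>The ratio test: \<open>t\<close> is the first time at which a coordinate moving towards
  zero reaches it.\<close>

lemma move_to_face:
  assumes x: "x \<in> \<eta>" and v: "v \<in> V" and vz: "\<And>i. i \<in> zeros x \<Longrightarrow> coord v i = 0"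
    and i0: "i0 \<in> {1..n}" "coord x i0 * coord v i0 < 0"
  obtains t where "t > 0" "x + t *\<^sub>R v \<in> \<eta>" "\<And>i. i \<in> {1..n} \<Longrightarrow> coord x i * coord (x + t *\<^sub>R v) i \<ge> 0"
    "zeros x \<subset> zeros (x + t *\<^sub>R v)"
proof -
  define T where "T = {i \<in> {1..n}. coord x i * coord v i < 0}"
  define f where "f i = - coord x i / coord v i" for i
  have T: "finite T" "T \<noteq> {}" using i0 by (auto simp: T_def)
  have fpos: "f i > 0" if "i \<in> T" for i
    using that by (auto simp: T_def f_def mult_less_0_iff divide_less_0_iff)
  define t where "t = Min (f ` T)"
  have "t \<in> f ` T" unfolding t_def by (rule Min_in) (use T in auto)
  then obtain m where m: "m \<in> T" "t = f m" by blast
  have tpos: "t > 0" using fpos m by simp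
  have le: "t \<le> f i" if "i \<in> T" for i using T that by (simp add: t_def)
  have coordt: "coord (x + t *\<^sub>R v) i = coord x i + t * coord v i" for i by (simp add: lookup_add)
  have "coord x i * coord (x + t *\<^sub>R v) i \<ge> 0" if i: "i \<in> {1..n}" for i
  proof (cases "i \<in> T")
    case True
    then have neg: "coord x i * coord v i < 0" by (simp add: T_def)
    then have v0: "coord v i \<noteq> 0" by auto
    have "t * (- (coord x i * coord v i)) \<le> f i * (- (coord x i * coord v i))"
      using le[OF True] neg by (intro mult_right_mono) auto
    also have "\<dots> = coord x i * coord x i" using v0 by (simp add: f_def)
    finally show ?thesis by (simp add: coordt algebra_simps)
  next
    case False
    then have "coord x i * coord v i \<ge> 0" using i by (simp add: T_def)
    then have "0 \<le> t * (coord x i * coord v i)" using tpos by simp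
    then show ?thesis by (simp add: coordt algebra_simps)
  qed
  moreover have "zeros x \<subset> zeros (x + t *\<^sub>R v)"
  proof
    show "zeros x \<subseteq> zeros (x + t *\<^sub>R v)" using vz by (auto simp: zeros_def coordt)
    have vm: "m \<in> {1..n}" "coord v m \<noteq> 0" "coord x m \<noteq> 0" using m by (auto simp: T_def)
    have "coord (x + t *\<^sub>R v) m = 0" unfolding coordt unfolding m(2) f_def using vm by simp
    then have "m \<in> zeros (x + t *\<^sub>R v)" "m \<notin> zeros x" using vm unfolding zeros_def by blast+
    then show "zeros x \<noteq> zeros (x + t *\<^sub>R v)" by blast
  qed
  ultimately show ?thesis using that tpos \<eta>_add[OF x V_scale[OF v]] by blast
qed

text \<open>
  Moving inside a face until no further coordinate can be made to vanish ends at a vertex.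
\<close>

lemma ex_vertex:
  assumes x: "x \<in> \<eta>" "P x"
    and step: "\<And>x v. x \<in> \<eta> \<Longrightarrow> P x \<Longrightarrow> v \<in> V \<Longrightarrow> v \<noteq> 0 \<Longrightarrow> (\<And>i. i \<in> zeros x \<Longrightarrow> coord v i = 0) \<Longrightarrow>
      (\<exists>i\<in>{1..n}. coord x i * coord v i < 0) \<or> (\<exists>i\<in>{1..n}. coord x i * coord v i > 0) \<Longrightarrow>
      \<exists>y\<in>\<eta>. P y \<and> zeros x \<subset> zeros y"
  obtains y I where "y \<in> \<eta>" "P y" "I \<subseteq> zeros y" "card I = k"
proof -
  have "\<exists>y\<in>\<eta>. P y \<and> k \<le> card (zeros y)"
    using x
  proof (induct "n - card (zeros x)" arbitrary: x rule: less_induct)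
    case less
    show ?case
    proof (cases "k \<le> card (zeros x)")
      case False
      then have "card (zeros x) \<le> k - 1" "k - 1 \<le> card {1..n}" using kn by auto
      then obtain I where I: "zeros x \<subseteq> I" "I \<subseteq> {1..n}" "card I = k - 1"
        using exists_subset_between[of "zeros x" "k - 1" "{1..n}"] zeros_simps by auto
      have Suc: "Suc (card I) = k" using False I by simp
      obtain v where v: "v \<in> V" "\<And>i. i \<in> I \<Longrightarrow> coord v i = 0"
        "\<And>j. j \<in> {1..n} - I \<Longrightarrow> (- 1) ^ height I j * coord v j > 0"
        using V_vector[OF I(2) Suc] by blast
      have "\<not> {1..n} \<subseteq> I" using I(2) Suc kn by (metis card_atLeastAtMost diff_Suc_1 le_antisym less_not_refl Suc_lessD subset_antisym)
      then obtain j where j: "j \<in> {1..n} - I" by blast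
      have vj: "coord v j \<noteq> 0" using v(3)[OF j] by auto
      then have v0: "v \<noteq> 0" by auto
      have xj: "coord x j \<noteq> 0" using j I(1) by (auto simp: zeros_def)
      have "coord x j * coord v j < 0 \<or> coord x j * coord v j > 0" using vj xj by (metis linorder_neqE_linordered_idom mult_eq_0_iff)
      then obtain y where y: "y \<in> \<eta>" "P y" "zeros x \<subset> zeros y"
        using step[OF less.prems v(1) v0] v(2) I(1) j by blast
      then have "card (zeros x) < card (zeros y)" using psubset_card_mono[OF zeros_simps(1)] by blast
      moreover have "card (zeros y) \<le> n" using card_mono[OF _ zeros_simps(2)[of y]] by simp
      ultimately have "n - card (zeros y) < n - card (zeros x)" by linarith
      then show ?thesis using less.hyps y by blast
    qed (use less in blast)
  qed
  then obtain y where y: "y \<in> \<eta>" "P y" "k \<le> card (zeros y)" by blast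
  then obtain I where "I \<subseteq> zeros y" "card I = k" using obtain_subset_with_card_n by metis
  then show ?thesis using that y by blast
qed

lemma vertex_unique:
  assumes "x \<in> \<eta>" "y \<in> \<eta>" "I \<subseteq> {1..n}" "card I = k"
    and "\<And>i. i \<in> I \<Longrightarrow> coord x i = 0" "\<And>i. i \<in> I \<Longrightarrow> coord y i = 0"
  shows "x = y"
  using V_zero[OF \<eta>_diff[OF assms(1,2)] assms(3,4)] assms(5,6) by (simp add: lookup_minus)

lemma dot_eq:
  assumes "p \<in> coord_space {1..n}"
  shows "dot p v = (\<Sum>i\<in>{1..n}. coord p i * coord v i)"
  unfolding dot_def
  by (rule sum.mono_neutral_left) (use assms in \<open>auto simp: coord_space_def in_keys_iff\<close>)

lemma \<eta>_coord: "x \<in> \<eta> \<Longrightarrow> x \<in> coord_space {1..n}"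
proof -
  assume "x \<in> \<eta>"
  then obtain v where v: "x = r + v" "v \<in> V" by (auto simp: \<eta>_eq)
  then show ?thesis using keys_add[of r v] r_coord V_coord unfolding coord_space_def by blast
qed

text \<open>One vertex suffices to fix the global sign \<delta>. Starting at the point
  \<open>p\<close> orthogonal to \<open>V\<close>, a walk to a vertex keeps the first coordinate
  positive; no zero precedes that coordinate, so its sign is \<delta> itself.\<close>

lemma vertices:
  assumes "I \<subseteq> {1..n}" "card I = k"
  obtains x where "x \<in> \<eta>" "\<And>i. i \<in> I \<Longrightarrow> coord x i = 0" "\<And>j. j \<in> {1..n} - I \<Longrightarrow> (- 1) ^ height I j * coord x j > 0"
proof -
  obtain \<delta> where \<delta>: "\<delta> \<in> {1, -1}" "\<forall>I. I \<subseteq> {1..n} \<longrightarrow> card I = k \<longrightarrow>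
    (\<exists>x\<in>\<eta>. (\<forall>i\<in>I. coord x i = 0) \<and> (\<forall>j\<in>{1..n} - I. \<delta> * (- 1) ^ height I j * coord x j > 0))"
    using vertices_up_to_sign by blast
  obtain p where p: "p \<in> \<eta>" "\<And>v. v \<in> V \<Longrightarrow> dot p v = 0" "coord p 1 > 0" using orient by blast
  \<comment> \<open>Zeros of \<open>p\<close> are kept, so every moving coordinate is visible in the
    orthogonality relation with \<open>p\<close>.\<close>
  define P where "P x \<longleftrightarrow> coord x 1 > 0 \<and> (\<forall>i\<in>{1..n}. coord p i * coord x i \<ge> 0 \<and> (coord p i = 0 \<longrightarrow> coord x i = 0))" for x
  have "P p" using p by (auto simp: P_def)
  obtain y J where y: "y \<in> \<eta>" "P y" "J \<subseteq> zeros y" "card J = k"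
  proof (rule ex_vertex[where P = P, OF p(1) \<open>P p\<close>])
    fix x v assume x: "x \<in> \<eta>" "P x" and v: "v \<in> V" "v \<noteq> 0" "\<And>i. i \<in> zeros x \<Longrightarrow> coord v i = 0"
      and "(\<exists>i\<in>{1..n}. coord x i * coord v i < 0) \<or> (\<exists>i\<in>{1..n}. coord x i * coord v i > 0)"
    then obtain j where j: "j \<in> {1..n}" "coord x j * coord v j \<noteq> 0" by fastforce
    have vp: "(\<Sum>i\<in>{1..n}. coord p i * coord v i) = 0" using p(2)[OF v(1)] dot_eq[OF \<eta>_coord[OF p(1)]] by simp
    have sgn: "coord x i * coord v i < 0" if "i \<in> {1..n}" "coord p i * coord v i < 0" for i
    proof -
      have "coord v i \<noteq> 0" "coord p i \<noteq> 0" using that by auto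
      then have "coord x i \<noteq> 0" "coord p i * coord x i \<ge> 0" using v(3)[of i] x(2) that by (auto simp: zeros_def P_def)
      then show ?thesis using that(2) by (smt (verit) mult_less_0_iff zero_le_mult_iff)
    qed
    have sgn': "coord x i * coord v i > 0" if "i \<in> {1..n}" "coord p i * coord v i > 0" for i
    proof -
      have "coord v i \<noteq> 0" "coord p i \<noteq> 0" using that by auto
      then have "coord x i \<noteq> 0" "coord p i * coord x i \<ge> 0" using v(3)[of i] x(2) that by (auto simp: zeros_def P_def)
      then show ?thesis using that(2) by (smt (verit) zero_less_mult_iff zero_le_mult_iff)
    qed
    have pj: "coord p j * coord v j \<noteq> 0" using j x(2) by (auto simp: P_def)
    have "\<exists>i\<in>{1..n}. coord p i * coord v i < 0"
    proof (rule ccontr)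
      assume "\<not> ?thesis"
      then have "\<forall>i\<in>{1..n}. coord p i * coord v i \<ge> 0" by (simp add: not_less)
      then show False using vp pj j(1) sum_nonneg_eq_0_iff[of "{1..n}" "\<lambda>i. coord p i * coord v i"] by auto
    qed
    then obtain i1 where i1: "i1 \<in> {1..n}" "coord x i1 * coord v i1 < 0" using sgn by blast
    have "\<exists>i\<in>{1..n}. coord p i * coord v i > 0"
    proof (rule ccontr)
      assume "\<not> ?thesis"
      then have "\<forall>i\<in>{1..n}. - (coord p i * coord v i) \<ge> 0" by (simp add: not_less)
      then show False using vp pj j(1) sum_nonneg_eq_0_iff[of "{1..n}" "\<lambda>i. - (coord p i * coord v i)"]
        by (auto simp: sum_negf)
    qed
    then obtain i2 where i2: "i2 \<in> {1..n}" "coord x i2 * coord v i2 > 0" using sgn' by blast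
    \<comment> \<open>By orthogonality to \<open>p\<close> some coordinate moves towards zero and
      some away from it, so \<open>v\<close> and \<open>- v\<close> both reach a new face, and the
      direction can be chosen not to decrease the first coordinate.\<close>
    obtain w i where w: "w \<in> V" "\<And>i. i \<in> zeros x \<Longrightarrow> coord w i = 0" "coord w 1 \<ge> 0" "i \<in> {1..n}" "coord x i * coord w i < 0"
    proof (cases "coord v 1 \<ge> 0")
      case True
      then show ?thesis using that[of v i1] v i1 by blast
    next
      case False
      have "- v \<in> V" using V_scale[OF v(1), of "-1"] by simp
      then show ?thesis using that[of "- v" i2] v(3) i2 False by auto
    qed
    obtain t where t: "t > 0" "x + t *\<^sub>R w \<in> \<eta>" "\<And>i. i \<in> {1..n} \<Longrightarrow> coord x i * coord (x + t *\<^sub>R w) i \<ge> 0"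
      "zeros x \<subset> zeros (x + t *\<^sub>R w)"
      using move_to_face[OF x(1) w(1,2,4,5)] by blast
    have "P (x + t *\<^sub>R w)"
      unfolding P_def
    proof (intro conjI ballI impI)
      show "coord (x + t *\<^sub>R w) 1 > 0" using x(2) w(3) t(1) by (simp add: P_def lookup_add add_pos_nonneg)
      fix i assume i: "i \<in> {1..n}"
      have z: "coord (x + t *\<^sub>R w) i = 0" if "coord x i = 0" using that t(4) i by (auto simp: zeros_def)
      show "coord p i = 0 \<Longrightarrow> coord (x + t *\<^sub>R w) i = 0" using z x(2) i by (simp add: P_def)
      have "coord p i * coord x i \<ge> 0" using x(2) i by (simp add: P_def)
      then show "coord p i * coord (x + t *\<^sub>R w) i \<ge> 0"
        using t(3)[OF i] z by (cases "coord x i = 0") (auto simp: zero_le_mult_iff)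
    qed
    then show "\<exists>y\<in>\<eta>. P y \<and> zeros x \<subset> zeros y" using t by blast
  qed (use that in blast)
  have J: "J \<subseteq> {1..n}" using y(3) zeros_simps(2) by blast
  obtain x where x: "x \<in> \<eta>" "\<forall>i\<in>J. coord x i = 0" "\<forall>j\<in>{1..n} - J. \<delta> * (- 1) ^ height J j * coord x j > 0"
    using \<delta>(2) J y(4) by blast
  have "x = y" using vertex_unique[OF x(1) y(1) J y(4)] x(2) y(3) zeros_simps(3) by blast
  moreover have "coord y 1 > 0" using y(2) by (simp add: P_def)
  moreover have J1: "1 \<in> {1..n} - J" using calculation(2) y(3) zeros_simps(3)[of 1 y] kn by auto
  moreover have "height J 1 = 0" using J by (auto simp: height_def)
  moreover have "\<delta> * (- 1) ^ height J 1 * coord x 1 > 0" using x(3) J1 by blast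
  ultimately have "\<delta> > 0" by (simp add: zero_less_mult_iff)
  then have "\<delta> = 1" using \<delta>(1) by auto
  then have "\<exists>x\<in>\<eta>. (\<forall>i\<in>I. coord x i = 0) \<and> (\<forall>j\<in>{1..n} - I. 1 * (- 1) ^ height I j * coord x j > 0)"
    using \<delta>(2) assms by blast
  then show ?thesis using that by (simp only: mult_1) blast
qed

text \<open>A nonempty face contains a vertex. Its zeros are exactly the \<open>k\<close> indices of
  \<open>I\<close>, so off \<open>I\<close> the signs of both regions are forced by
  \<open>vertices\<close>.\<close>

lemma region_inter_iff:
  assumes "\<alpha> \<in> sign_seqs n" "\<beta> \<in> sign_seqs n" "T \<subseteq> {1..n}"
  shows "region n \<eta> \<alpha> \<inter> region n \<eta> \<beta> \<inter> hyp_inter \<eta> T \<noteq> {} \<longleftrightarrow>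
    (\<exists>I\<subseteq>{1..n}. card I = k \<and> T \<subseteq> I \<and> (\<forall>j\<in>{1..n} - I. \<alpha> j = (- 1) ^ height I j \<and> \<beta> j = (- 1) ^ height I j))"
    (is "?L \<longleftrightarrow> ?R")
proof
  assume ?R
  then obtain I where I: "I \<subseteq> {1..n}" "card I = k" "T \<subseteq> I"
    "\<And>j. j \<in> {1..n} - I \<Longrightarrow> \<alpha> j = (- 1) ^ height I j \<and> \<beta> j = (- 1) ^ height I j" by blast
  obtain x where x: "x \<in> \<eta>" "\<And>i. i \<in> I \<Longrightarrow> coord x i = 0" "\<And>j. j \<in> {1..n} - I \<Longrightarrow> (- 1) ^ height I j * coord x j > 0"
    using vertices[OF I(1,2)] by blast
  have "\<alpha> j * coord x j \<ge> 0 \<and> \<beta> j * coord x j \<ge> 0" if "j \<in> {1..n}" for j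
    using x(2)[of j] x(3)[of j] I(4)[of j] that by (cases "j \<in> I") auto
  then have "x \<in> region n \<eta> \<alpha> \<inter> region n \<eta> \<beta> \<inter> hyp_inter \<eta> T"
    using x(1,2) I(3) by (auto simp: region_def hyp_inter_def)
  then show ?L by blast
next
  assume ?L
  then obtain x0 where x0: "x0 \<in> region n \<eta> \<alpha>" "x0 \<in> region n \<eta> \<beta>" "x0 \<in> hyp_inter \<eta> T" by blast
  define P where "P x \<longleftrightarrow> x \<in> region n \<eta> \<alpha> \<and> x \<in> region n \<eta> \<beta> \<and> x \<in> hyp_inter \<eta> T" for x
  have x0': "x0 \<in> \<eta>" "P x0" using x0 by (auto simp: P_def region_def)
  obtain y I where y: "y \<in> \<eta>" "P y" "I \<subseteq> zeros y" "card I = k"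
  proof (rule ex_vertex[where P = P, OF x0'])
    fix x v assume x: "x \<in> \<eta>" "P x" and v: "v \<in> V" "v \<noteq> 0" "\<And>i. i \<in> zeros x \<Longrightarrow> coord v i = 0"
      and ex: "(\<exists>i\<in>{1..n}. coord x i * coord v i < 0) \<or> (\<exists>i\<in>{1..n}. coord x i * coord v i > 0)"
    obtain w i where w: "w \<in> V" "\<And>i. i \<in> zeros x \<Longrightarrow> coord w i = 0" "i \<in> {1..n}" "coord x i * coord w i < 0"
      using ex
    proof
      assume "\<exists>i\<in>{1..n}. coord x i * coord v i < 0"
      then show ?thesis using that[of v] v by blast
    next
      assume "\<exists>i\<in>{1..n}. coord x i * coord v i > 0"
      then obtain i where i: "i \<in> {1..n}" "coord x i * coord v i > 0" by blast
      have "- v \<in> V" using V_scale[OF v(1), of "-1"] by simp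
      then show ?thesis using that[of "- v" i] v(3) i by auto
    qed
    obtain t where t: "t > 0" "x + t *\<^sub>R w \<in> \<eta>" "\<And>i. i \<in> {1..n} \<Longrightarrow> coord x i * coord (x + t *\<^sub>R w) i \<ge> 0"
      "zeros x \<subset> zeros (x + t *\<^sub>R w)"
      using move_to_face[OF x(1) w] by blast
    have z: "coord (x + t *\<^sub>R w) i = 0" if "i \<in> {1..n}" "coord x i = 0" for i using that t(4) by (auto simp: zeros_def)
    have s: "c * coord (x + t *\<^sub>R w) i \<ge> 0" if "i \<in> {1..n}" "c * coord x i \<ge> 0" for c i
      using t(3)[OF that(1)] z[OF that(1)] that(2) by (cases "coord x i = 0") (auto simp: zero_le_mult_iff)
    have "P (x + t *\<^sub>R w)"
      unfolding P_def region_def hyp_inter_def using x(2) t(2) z s assms(3)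
      by (auto simp: P_def region_def hyp_inter_def)
    then show "\<exists>y\<in>\<eta>. P y \<and> zeros x \<subset> zeros y" using t by blast
  qed (use that in blast)
  have I: "I \<subseteq> {1..n}" using y(3) zeros_simps(2) by blast
  obtain x where x: "x \<in> \<eta>" "\<And>i. i \<in> I \<Longrightarrow> coord x i = 0" "\<And>j. j \<in> {1..n} - I \<Longrightarrow> (- 1) ^ height I j * coord x j > 0"
    using vertices[OF I y(4)] by blast
  have xy: "x = y" using vertex_unique[OF x(1) y(1) I y(4) x(2)] y(3) zeros_simps(3) by blast
  have sgn: "\<sigma> j = (- 1) ^ height I j" if "\<sigma> \<in> sign_seqs n" "y \<in> region n \<eta> \<sigma>" "j \<in> {1..n} - I" for \<sigma> j
  proof -
    have "\<sigma> j \<in> {1, -1}" "\<sigma> j * coord y j \<ge> 0" using that by (auto simp: sign_seqs_def region_def)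
    then show ?thesis using x(3)[OF that(3)] unfolding xy
      by (auto simp: minus_one_power_iff split: if_splits)
  qed
  have "T \<subseteq> I"
  proof
    fix i assume i: "i \<in> T"
    then have "coord y i = 0" using y(2) by (simp add: P_def hyp_inter_def)
    then show "i \<in> I" using x(3)[of i] i assms(3) unfolding xy by (cases "i \<in> I") auto
  qed
  moreover have "\<alpha> j = (- 1) ^ height I j \<and> \<beta> j = (- 1) ^ height I j" if "j \<in> {1..n} - I" for j
    using sgn[OF assms(1) _ that] sgn[OF assms(2) _ that] y(2) by (simp add: P_def)
  ultimately show ?R using I y(4) by blast
qed

end

section \<open>Sign changes\<close>

text \<open>The entry \<open>a\<close> marks a change between coordinates \<open>a\<close> and
  \<open>a + 1\<close>, and \<open>s\<close> is the sign placed in front of the first coordinate.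
  With \<open>s = 1\<close> this inverts \<open>sign_vec\<close> on subsets of
  \<open>{0..<n}\<close>; the value \<open>s = -1\<close> is needed for directions in
  \<open>V\<close>, which may be negated.\<close>

definition sign_changes :: "nat \<Rightarrow> real \<Rightarrow> (nat \<Rightarrow> real) \<Rightarrow> nat set" where
  "sign_changes n s \<alpha> = {a \<in> {0..<n}. (if a = 0 then s else \<alpha> a) \<noteq> \<alpha> (Suc a)}"

lemma sign_changes_subset: "sign_changes n s \<alpha> \<subseteq> {0..<n}"
  by (auto simp: sign_changes_def)

lemma subset_from_one: "x \<subseteq> {0..<n} \<Longrightarrow> 0 \<notin> x \<Longrightarrow> x \<subseteq> {1..<n :: nat}"
proof
  fix a assume "x \<subseteq> {0..<n}" "0 \<notin> x" "a \<in> x"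
  then show "a \<in> {1..<n}" by (cases a) auto
qed

lemma finite_sign_changes [simp]: "finite (sign_changes n s \<alpha>)"
  by (rule finite_subset[OF sign_changes_subset]) simp

lemma sign_seq_changes:
  assumes \<alpha>: "\<alpha> \<in> sign_seqs n" and s: "s \<in> {1, -1}" and j: "j \<in> {1..n}"
  shows "\<alpha> j = s * (- 1) ^ height (sign_changes n s \<alpha>) j"
proof -
  have "Suc a \<le> n \<Longrightarrow> \<alpha> (Suc a) = s * (- 1) ^ height (sign_changes n s \<alpha>) (Suc a)" for a
  proof (induct a)
    case 0
    have v: "\<alpha> (Suc 0) \<in> {1, -1}" using \<alpha> 0 by (auto simp: sign_seqs_def)
    have "0 \<in> sign_changes n s \<alpha> \<longleftrightarrow> s \<noteq> \<alpha> (Suc 0)" using 0 by (simp add: sign_changes_def)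
    then show ?case using s v by (auto simp: height_Suc)
  next
    case (Suc a)
    have v: "\<alpha> (Suc (Suc a)) \<in> {1, -1}" "\<alpha> (Suc a) \<in> {1, -1}" using \<alpha> Suc(2) by (auto simp: sign_seqs_def)
    have "Suc a \<in> sign_changes n s \<alpha> \<longleftrightarrow> \<alpha> (Suc a) \<noteq> \<alpha> (Suc (Suc a))" using Suc(2) by (simp add: sign_changes_def)
    then have "\<alpha> (Suc (Suc a)) = \<alpha> (Suc a) * (- 1) ^ of_bool (Suc a \<in> sign_changes n s \<alpha>)" using v by auto
    also have "\<alpha> (Suc a) = s * (- 1) ^ height (sign_changes n s \<alpha>) (Suc a)" using Suc by simp
    finally show ?case by (simp add: height_Suc[of _ "Suc a"] power_add)
  qed
  from this[of "j - 1"] j show ?thesis by simp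
qed

lemma height_Int: "j \<le> n \<Longrightarrow> height (x \<inter> {0..<n}) j = height x j"
  unfolding height_def by (rule arg_cong[where f = card]) auto

lemma sign_vec_Int: "sign_vec n (x \<inter> {0..<n}) = sign_vec n x"
  by (auto simp: sign_vec_def height_Int restrict_def)

lemma sign_vec_changes:
  assumes "\<alpha> \<in> sign_seqs n"
  shows "sign_vec n (sign_changes n 1 \<alpha>) = \<alpha>"
proof (rule extensionalityI[of _ "{1..n}"])
  show "\<alpha> \<in> extensional {1..n}" using assms by (auto simp: sign_seqs_def PiE_def)
qed (simp_all add: sign_vec_def sign_seq_changes[OF assms, of 1])

lemma sign_changes_sign_vec: "sign_changes n 1 (sign_vec n x) = x \<inter> {0..<n}"
proof (rule Set.set_eqI)
  fix a
  show "a \<in> sign_changes n 1 (sign_vec n x) \<longleftrightarrow> a \<in> x \<inter> {0..<n}"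
  proof (cases "a < n")
    case True
    then have "(if a = 0 then 1 else sign_vec n x a) = (- 1) ^ height x a"
      "sign_vec n x (Suc a) = (- 1) ^ height x a * (- 1) ^ of_bool (a \<in> x)"
      by (auto simp: sign_vec_def height_Suc power_add)
    then show ?thesis using True by (auto simp: sign_changes_def)
  qed (auto simp: sign_changes_def)
qed

lemma sign_changes_minus:
  assumes \<alpha>: "\<alpha> \<in> sign_seqs n" and "n \<ge> 1"
  shows "0 \<in> sign_changes n 1 \<alpha> \<Longrightarrow> sign_changes n (- 1) \<alpha> = sign_changes n 1 \<alpha> - {0}"
    and "0 \<notin> sign_changes n 1 \<alpha> \<Longrightarrow> sign_changes n (- 1) \<alpha> = insert 0 (sign_changes n 1 \<alpha>)"
proof -
  have "\<alpha> 1 \<in> {1, -1}" using assms by (auto simp: sign_seqs_def)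
  then have 0: "0 \<in> sign_changes n (- 1) \<alpha> \<longleftrightarrow> 0 \<notin> sign_changes n 1 \<alpha>" using assms(2) by (auto simp: sign_changes_def)
  have "a \<in> sign_changes n (- 1) \<alpha> \<longleftrightarrow> a \<in> sign_changes n 1 \<alpha>" if "a \<noteq> 0" for a
    using that by (simp add: sign_changes_def)
  then have *: "a \<in> sign_changes n (- 1) \<alpha> \<longleftrightarrow> (if a = 0 then 0 \<notin> sign_changes n 1 \<alpha> else a \<in> sign_changes n 1 \<alpha>)" for a
    using 0 by simp
  show "0 \<in> sign_changes n 1 \<alpha> \<Longrightarrow> sign_changes n (- 1) \<alpha> = sign_changes n 1 \<alpha> - {0}"
    by (rule Set.set_eqI) (simp add: *)
  show "0 \<notin> sign_changes n 1 \<alpha> \<Longrightarrow> sign_changes n (- 1) \<alpha> = insert 0 (sign_changes n 1 \<alpha>)"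
    by (rule Set.set_eqI) (simp add: *)
qed

lemma height_Suc_image: "height (Suc ` X) (Suc a) = height X a"
proof -
  have "{i \<in> Suc ` X. i < Suc a} = Suc ` {i \<in> X. i < a}" by auto
  then show ?thesis by (simp add: height_def card_image)
qed

text \<open>
  Put a zero directly behind each sign change; the missing zeros go to the end, where they do not
  affect the signs of the remaining coordinates.
\<close>

lemma ex_zero_set:
  assumes \<alpha>: "\<alpha> \<in> sign_seqs n" and s: "s \<in> {1, -1}" and d: "card (sign_changes n s \<alpha>) \<le> d" "d \<le> n"
  shows "\<exists>I\<subseteq>{1..n}. card I = d \<and> (\<forall>j\<in>{1..n} - I. \<alpha> j = s * (- 1) ^ height I j)"
proof -
  let ?X = "sign_changes n s \<alpha>"
  have "\<exists>I\<subseteq>{1..n}. card I = card ?X + m \<and> (\<forall>j\<in>{1..n} - I. \<alpha> j = s * (- 1) ^ height I j)"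
    if "card ?X + m \<le> n" for m
    using that
  proof (induct m)
    case 0
    have "\<alpha> j = s * (- 1) ^ height (Suc ` ?X) j" if j: "j \<in> {1..n} - Suc ` ?X" for j
    proof -
      obtain a where a: "j = Suc a" using j by (cases j) auto
      then have "a \<notin> ?X" using j by auto
      then have "height (Suc ` ?X) j = height ?X j" by (simp only: a height_Suc_image height_Suc[of ?X]) simp
      then show ?thesis using sign_seq_changes[OF \<alpha> s, of j] j by simp
    qed
    then show ?case using sign_changes_subset[of n s \<alpha>]
      by (intro exI[of _ "Suc ` ?X"]) (auto simp: card_image)
  next
    case (Suc m)
    then obtain I where I: "I \<subseteq> {1..n}" "card I = card ?X + m" "\<And>j. j \<in> {1..n} - I \<Longrightarrow> \<alpha> j = s * (- 1) ^ height I j"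
      by auto
    have fI: "finite I" using I finite_subset by blast
    have "{1..n} - I \<noteq> {}"
    proof
      assume "{1..n} - I = {}"
      then have "card {1..n} \<le> card I" using fI by (intro card_mono) auto
      then show False using I(2) Suc(2) by simp
    qed
    then obtain e where e: "e \<in> {1..n} - I" "\<And>j. j \<in> {1..n} - I \<Longrightarrow> j \<le> e"
      using Max_in[of "{1..n} - I"] Max_ge[of "{1..n} - I"] by blast
    have "\<alpha> j = s * (- 1) ^ height (insert e I) j" if j: "j \<in> {1..n} - insert e I" for j
    proof -
      have "j < e" using e(2)[of j] j by (simp add: order.strict_iff_order)
      then have "{i \<in> insert e I. i < j} = {i \<in> I. i < j}" by auto
      then have "height (insert e I) j = height I j" by (simp add: height_def)
      then show ?thesis using I(3)[of j] j by simp
    qed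
    moreover have "insert e I \<subseteq> {1..n}" "card (insert e I) = card ?X + Suc m" using e I fI by auto
    ultimately show ?case by blast
  qed
  from this[of "d - card ?X"] d show ?thesis by simp
qed

section \<open>Bounded and compact regions\<close>

lemma bounded_linear_coord: "bounded_linear (\<lambda>x. coord x j)"
proof (rule bounded_linear_intro)
  fix x :: "nat \<Rightarrow>\<^sub>0 real"
  have "\<bar>coord x j\<bar> \<le> (\<Sum>i\<in>Poly_Mapping.keys x. \<bar>coord x i\<bar>)"
    by (cases "j \<in> Poly_Mapping.keys x") (auto simp: in_keys_iff sum_nonneg intro: member_le_sum)
  then show "norm (coord x j) \<le> norm x * 1" by (simp add: norm_poly_mapping_def dist_poly_mapping_def)
qed (simp_all add: lookup_add)

text \<open>The ambient space of finitely supported functions is infinite dimensional, where closed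
  bounded sets need not be compact. A Minkowski sum of finitely many segments is compact in any
  normed space.\<close>

lemma compact_zonotope:
  fixes w :: "'i \<Rightarrow> 'a :: real_normed_vector"
  assumes "finite I"
  shows "compact {\<Sum>i\<in>I. t i *\<^sub>R w i | t. \<forall>i\<in>I. \<bar>t i\<bar> \<le> M i}"
  using assms
proof (induct I rule: finite_induct)
  case (insert a I)
  have seg: "compact ((\<lambda>t. t *\<^sub>R w a) ` {- M a..M a})"
    by (intro compact_continuous_image continuous_intros) auto
  have "{\<Sum>i\<in>insert a I. t i *\<^sub>R w i | t. \<forall>i\<in>insert a I. \<bar>t i\<bar> \<le> M i} =
    {x + y | x y. x \<in> (\<lambda>t. t *\<^sub>R w a) ` {- M a..M a} \<and> y \<in> {\<Sum>i\<in>I. t i *\<^sub>R w i | t. \<forall>i\<in>I. \<bar>t i\<bar> \<le> M i}}"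
    (is "?L = ?R")
  proof (intro equalityI subsetI)
    fix x assume "x \<in> ?L"
    then obtain t where t: "x = (\<Sum>i\<in>insert a I. t i *\<^sub>R w i)" "\<forall>i\<in>insert a I. \<bar>t i\<bar> \<le> M i" by blast
    then have "x = t a *\<^sub>R w a + (\<Sum>i\<in>I. t i *\<^sub>R w i)" "t a \<in> {- M a..M a}" using insert by auto
    then show "x \<in> ?R" using t(2) by blast
  next
    fix x assume "x \<in> ?R"
    then obtain c t where t: "x = c *\<^sub>R w a + (\<Sum>i\<in>I. t i *\<^sub>R w i)" "c \<in> {- M a..M a}" "\<forall>i\<in>I. \<bar>t i\<bar> \<le> M i" by blast
    have "x = (\<Sum>i\<in>insert a I. (t(a := c)) i *\<^sub>R w i)"
      using insert(1,2) by (auto simp: t(1) intro!: sum.cong)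
    moreover have "\<forall>i\<in>insert a I. \<bar>(t(a := c)) i\<bar> \<le> M i" using t(2,3) by auto
    ultimately show "x \<in> ?L" by blast
  qed
  then show ?case using compact_sums[OF seg insert(3)] by simp
qed simp

section \<open>Feasibility, boundedness and compactness in terms of sign changes\<close>

context pos_arrangement
begin

text \<open>A vertex with zero set \<open>I\<close> allows at most one sign change per zero;
  conversely \<open>ex_zero_set\<close> places \<open>k\<close> zeros so that all changes are
  absorbed.\<close>

lemma feasible_iff:
  assumes \<alpha>: "\<alpha> \<in> sign_seqs n"
  shows "feasible n \<eta> \<alpha> \<longleftrightarrow> card (sign_changes n 1 \<alpha>) \<le> k"
proof -
  have "hyp_inter \<eta> {} = \<eta>" by (simp add: hyp_inter_def)
  then have "region n \<eta> \<alpha> \<inter> region n \<eta> \<alpha> \<inter> hyp_inter \<eta> {} = region n \<eta> \<alpha>" by (auto simp: region_def)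
  then have f: "feasible n \<eta> \<alpha> \<longleftrightarrow> (\<exists>I\<subseteq>{1..n}. card I = k \<and> (\<forall>j\<in>{1..n} - I. \<alpha> j = (- 1) ^ height I j))"
    using region_inter_iff[OF \<alpha> \<alpha>, of "{}"] by (simp add: feasible_def)
  let ?X = "sign_changes n 1 \<alpha>"
  show ?thesis
  proof
    assume "feasible n \<eta> \<alpha>"
    then obtain I where I: "I \<subseteq> {1..n}" "card I = k" "\<And>j. j \<in> {1..n} - I \<Longrightarrow> \<alpha> j = (- 1) ^ height I j"
      using f by blast
    have par: "even (height ?X j) \<longleftrightarrow> even (height I j)" if "j \<in> {1..n} - I" for j
    proof -
      have "(- 1 :: real) ^ height ?X j = (- 1) ^ height I j"
        using I(3)[OF that] sign_seq_changes[OF \<alpha>, of 1 j] that by simp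
      then show ?thesis by (simp add: minus_one_power_iff split: if_splits)
    qed
    have "height ?X n \<le> height I (Suc n)" by (rule parity_bound[where m = n]) (use par in auto)
    moreover have "height ?X n = card ?X" using sign_changes_subset[of n 1 \<alpha>] by (intro height_top) auto
    moreover have "height I (Suc n) = card I" by (rule height_top) (use I(1) in auto)
    ultimately show "card ?X \<le> k" using I(2) by simp
  next
    assume "card ?X \<le> k"
    then have "\<exists>I\<subseteq>{1..n}. card I = k \<and> (\<forall>j\<in>{1..n} - I. \<alpha> j = 1 * (- 1) ^ height I j)"
      using kn by (intro ex_zero_set[OF \<alpha>]) auto
    then show "feasible n \<eta> \<alpha>" unfolding f by simp
  qed
qed

lemma region_ray:
  assumes "x \<in> region n \<eta> \<alpha>" "v \<in> V" "\<And>j. j \<in> {1..n} \<Longrightarrow> \<alpha> j * coord v j \<ge> 0" "t \<ge> 0"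
  shows "x + t *\<^sub>R v \<in> region n \<eta> \<alpha>"
proof -
  have "\<alpha> i * coord (x + t *\<^sub>R v) i \<ge> 0" if i: "i \<in> {1..n}" for i
  proof -
    have "\<alpha> i * coord x i \<ge> 0" using assms(1) i by (simp add: region_def)
    moreover have "t * (\<alpha> i * coord v i) \<ge> 0" using assms(3)[OF i] assms(4) by simp
    ultimately show ?thesis by (simp add: lookup_add algebra_simps)
  qed
  then show ?thesis using assms(1,2) \<eta>_add V_scale by (simp add: region_def)
qed

text \<open>A recession direction of the region along which \<xi> increases excludes an upper
  bound.\<close>

lemma not_bounded_sign:
  assumes \<xi>: "\<xi> \<in> dual_space V" and f: "feasible n \<eta> \<alpha>"
    and v: "v \<in> V" "\<And>j. j \<in> {1..n} \<Longrightarrow> \<alpha> j * coord v j \<ge> 0" "\<xi> v > 0"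
  shows "\<not> bounded_sign n \<eta> \<xi> \<alpha>"
proof
  assume "bounded_sign n \<eta> \<xi> \<alpha>"
  then obtain g where g: "\<And>x y. x \<in> \<eta> \<Longrightarrow> y \<in> \<eta> \<Longrightarrow> g x - g y = \<xi> (x - y)" "bdd_above (g ` region n \<eta> \<alpha>)"
    by (auto simp: bounded_sign_def)
  then obtain B where B: "\<And>x. x \<in> region n \<eta> \<alpha> \<Longrightarrow> g x \<le> B" by (auto simp: bdd_above_def)
  obtain x where x: "x \<in> region n \<eta> \<alpha>" using f by (auto simp: feasible_def)
  define t where "t = (\<bar>B - g x\<bar> + 1) / \<xi> v"
  have t: "t \<ge> 0" using v(3) by (simp add: t_def)
  have y: "x + t *\<^sub>R v \<in> region n \<eta> \<alpha>" by (rule region_ray[OF x v(1,2) t])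
  have "\<xi> (t *\<^sub>R v + 0 *\<^sub>R v) = t * \<xi> v + 0 * \<xi> v" using \<xi> v(1) unfolding dual_space_def by blast
  then have "\<xi> (t *\<^sub>R v) = t * \<xi> v" by simp
  moreover have "g (x + t *\<^sub>R v) - g x = \<xi> (t *\<^sub>R v)" using g(1)[of "x + t *\<^sub>R v" x] x y by (simp add: region_def)
  moreover have "t * \<xi> v = \<bar>B - g x\<bar> + 1" using v(3) by (simp add: t_def)
  ultimately have "g (x + t *\<^sub>R v) > B" by simp
  then show False using B[OF y] by simp
qed

text \<open>A Farkas certificate: on \<open>V\<close> the form \<xi> is minus a positive combination
  of signed coordinates. The same expression on \<eta> is an affine function with linear part \<xi>
  and values at most 0 on the region.\<close>

lemma bounded_signI:
  assumes I: "finite I" "I \<subseteq> {1..n}" and e: "e0 > 0" "\<And>i. i \<in> I \<Longrightarrow> e i > 0"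
    and rel: "\<And>v. v \<in> V \<Longrightarrow> e0 * \<xi> v + (\<Sum>i\<in>I. \<alpha> i * e i * coord v i) = 0"
  shows "bounded_sign n \<eta> \<xi> \<alpha>"
proof -
  define g where "g x = - (\<Sum>i\<in>I. \<alpha> i * e i * coord x i) / e0" for x
  have "g x - g y = \<xi> (x - y)" if "x \<in> \<eta>" "y \<in> \<eta>" for x y
  proof -
    have "g x - g y = - (\<Sum>i\<in>I. \<alpha> i * e i * coord (x - y) i) / e0"
      by (simp add: g_def lookup_minus right_diff_distrib sum_subtractf diff_divide_distrib[symmetric])
    also have "\<dots> = \<xi> (x - y)" using rel[OF \<eta>_diff[OF that]] e(1) by (simp add: field_simps)
    finally show ?thesis .
  qed
  moreover have "g x \<le> 0" if "x \<in> region n \<eta> \<alpha>" for x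
  proof -
    have "0 \<le> \<alpha> i * e i * coord x i" if i: "i \<in> I" for i
    proof -
      have "0 \<le> e i * (\<alpha> i * coord x i)" using \<open>x \<in> region n \<eta> \<alpha>\<close> i I e(2)[OF i] by (auto simp: region_def)
      then show ?thesis by (simp add: mult_ac)
    qed
    then have "0 \<le> (\<Sum>i\<in>I. \<alpha> i * e i * coord x i)" by (rule sum_nonneg)
    then show ?thesis using e(1) by (simp add: g_def)
  qed
  ultimately show ?thesis unfolding bounded_sign_def by (intro exI[of _ g]) (auto simp: bdd_above_def)
qed

lemma not_compact_region:
  assumes f: "feasible n \<eta> \<alpha>" and v: "v \<in> V" "v \<noteq> 0" "\<And>j. j \<in> {1..n} \<Longrightarrow> \<alpha> j * coord v j \<ge> 0"
  shows "\<not> compact (region n \<eta> \<alpha>)"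
proof
  assume "compact (region n \<eta> \<alpha>)"
  then obtain B where B: "\<And>x. x \<in> region n \<eta> \<alpha> \<Longrightarrow> norm x \<le> B"
    using compact_imp_bounded bounded_iff by metis
  obtain x where x: "x \<in> region n \<eta> \<alpha>" using f by (auto simp: feasible_def)
  define t where "t = (\<bar>B\<bar> + norm x + 1) / norm v"
  have t: "t \<ge> 0" by (simp add: t_def)
  have "norm (t *\<^sub>R v) = \<bar>B\<bar> + norm x + 1" using v(2) by (simp add: t_def)
  moreover have "norm (t *\<^sub>R v) \<le> norm (x + t *\<^sub>R v) + norm x"
    using norm_triangle_ineq4[of "x + t *\<^sub>R v" x] by simp
  ultimately show False using B[OF region_ray[OF x v(1,3) t]] by simp
qed

text \<open>The relation makes a positive combination of the absolute values of the
  \<open>k + 1\<close> coordinates in \<open>K\<close> constant on the region, which bounds them.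
  Any \<open>k\<close> of these determine the point, so the region is a closed subset of a
  zonotope.\<close>

lemma compact_regionI:
  assumes K: "K \<subseteq> {1..n}" "card K = Suc k" and e: "\<And>j. j \<in> K \<Longrightarrow> e j > 0"
    and rel: "\<And>v. v \<in> V \<Longrightarrow> (\<Sum>j\<in>K. \<alpha> j * e j * coord v j) = 0" and \<alpha>: "\<alpha> \<in> sign_seqs n"
  shows "compact (region n \<eta> \<alpha>)"
proof (cases "region n \<eta> \<alpha> = {}")
  case False
  then obtain y where y: "y \<in> region n \<eta> \<alpha>" by blast
  then have y\<eta>: "y \<in> \<eta>" by (simp add: region_def)
  have fK: "finite K" using K finite_subset by blast
  define C where "C = (\<Sum>j\<in>K. \<alpha> j * e j * coord y j)"
  define M where "M j = C / e j + \<bar>coord y j\<bar>" for j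
  have bound: "\<bar>coord (x - y) j\<bar> \<le> M j" if x: "x \<in> region n \<eta> \<alpha>" and j: "j \<in> K" for x j
  proof -
    have x\<eta>: "x \<in> \<eta>" using x by (simp add: region_def)
    have "(\<Sum>j\<in>K. \<alpha> j * e j * coord x j) = C"
      using rel[OF \<eta>_diff[OF x\<eta> y\<eta>]] by (simp add: C_def lookup_minus right_diff_distrib sum_subtractf)
    moreover have nonneg: "0 \<le> \<alpha> i * e i * coord x i" if i: "i \<in> K" for i
    proof -
      have "0 \<le> e i * (\<alpha> i * coord x i)" using x i K e[OF i] by (auto simp: region_def)
      then show ?thesis by (simp add: mult_ac)
    qed
    ultimately have le: "\<alpha> j * e j * coord x j \<le> C" using member_le_sum[OF j, of "\<lambda>j. \<alpha> j * e j * coord x j"] fK by auto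
    have jn: "j \<in> {1..n}" using j K by blast
    then have "\<alpha> j \<in> {1, -1}" using \<alpha> by (auto simp: sign_seqs_def)
    moreover have "0 \<le> \<alpha> j * coord x j" using x jn by (simp add: region_def)
    ultimately have "\<bar>coord x j\<bar> = \<alpha> j * coord x j" by auto
    then have "\<bar>coord x j\<bar> \<le> C / e j" using le e[OF j] by (simp add: field_simps)
    then show ?thesis by (simp add: M_def lookup_minus)
  qed
  obtain j0 where j0: "j0 \<in> K" using K(2) by fastforce
  define I where "I = K - {j0}"
  have I: "I \<subseteq> {1..n}" "card I = k" "finite I" "I \<subseteq> K" using K fK j0 by (auto simp: I_def)
  have "\<exists>u\<in>V. coord u i = 1 \<and> (\<forall>l\<in>I - {i}. coord u l = 0)" if i: "i \<in> I" for i
  proof -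
    have "I - {i} \<subseteq> {1..n}" "Suc (card (I - {i})) = k" using I i card_Suc_Diff1[OF I(3) i] by auto
    from V_vector[OF this] obtain v where v: "v \<in> V" "\<And>l. l \<in> I - {i} \<Longrightarrow> coord v l = 0"
      "\<And>j. j \<in> {1..n} - (I - {i}) \<Longrightarrow> (- 1) ^ height (I - {i}) j * coord v j > 0" by blast
    have "coord v i \<noteq> 0" using v(3)[of i] i I by auto
    then show ?thesis using v(2) V_scale[OF v(1)] by (intro bexI[of _ "(1 / coord v i) *\<^sub>R v"]) auto
  qed
  \<comment> \<open>The \<open>w i\<close> are dual to the coordinates in \<open>I\<close>, so the
    coordinates of \<open>x - y\<close> are its parameters in the zonotope.\<close>
  then obtain w where w: "\<And>i. i \<in> I \<Longrightarrow> w i \<in> V \<and> coord (w i) i = 1 \<and> (\<forall>l\<in>I - {i}. coord (w i) l = 0)" by metis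
  define Z where "Z = (\<lambda>z. y + z) ` {\<Sum>i\<in>I. t i *\<^sub>R w i | t. \<forall>i\<in>I. \<bar>t i\<bar> \<le> M i}"
  have "compact Z" unfolding Z_def by (intro compact_translation compact_zonotope I)
  have sV: "(\<Sum>i\<in>I. t i *\<^sub>R w i) \<in> V" for t
    using w V_scale by (intro Real_Vector_Spaces.subspace_sum[OF V_sub]) auto
  have "region n \<eta> \<alpha> = Z \<inter> (\<Inter>j\<in>{1..n}. {x. 0 \<le> \<alpha> j * coord x j})"
  proof (intro equalityI subsetI)
    fix x assume x: "x \<in> region n \<eta> \<alpha>"
    define t where "t i = coord (x - y) i" for i
    have d: "x - y \<in> V" using x y\<eta> \<eta>_diff by (simp add: region_def)
    have "(x - y) - (\<Sum>i\<in>I. t i *\<^sub>R w i) = 0"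
    proof (rule V_zero[OF Real_Vector_Spaces.subspace_diff[OF V_sub d sV] I(1,2)])
      fix l assume l: "l \<in> I"
      have "coord (\<Sum>i\<in>I. t i *\<^sub>R w i) l = (\<Sum>i\<in>I. if i = l then t l else 0)"
        unfolding lookup_sum using w l by (intro sum.cong refl) auto
      then show "coord ((x - y) - (\<Sum>i\<in>I. t i *\<^sub>R w i)) l = 0" using l I by (simp add: lookup_minus t_def)
    qed
    then have "x = y + (\<Sum>i\<in>I. t i *\<^sub>R w i)" by (simp add: algebra_simps)
    moreover have "\<forall>i\<in>I. \<bar>t i\<bar> \<le> M i" using bound[OF x] I(4) by (auto simp: t_def)
    ultimately have "x \<in> Z" unfolding Z_def by blast
    then show "x \<in> Z \<inter> (\<Inter>j\<in>{1..n}. {x. 0 \<le> \<alpha> j * coord x j})" using x by (auto simp: region_def)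
  next
    fix x assume x: "x \<in> Z \<inter> (\<Inter>j\<in>{1..n}. {x. 0 \<le> \<alpha> j * coord x j})"
    then have "x \<in> \<eta>" using \<eta>_add[OF y\<eta> sV] by (auto simp: Z_def)
    then show "x \<in> region n \<eta> \<alpha>" using x by (auto simp: region_def)
  qed
  moreover have "closed {x. 0 \<le> \<alpha> j * coord x j}" for j
    by (intro closed_Collect_le continuous_intros linear_continuous_on bounded_linear_coord)
  then have "closed (\<Inter>j\<in>{1..n}. {x. 0 \<le> \<alpha> j * coord x j})" by (intro closed_INT) auto
  ultimately show ?thesis using compact_Int_closed[OF \<open>compact Z\<close>] by simp
qed simp

text \<open>A direction in \<open>V\<close> with \<open>k - 1\<close> prescribed zeros changes sign
  exactly at them and may be negated, so a region with fewer than \<open>k\<close> changes from a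
  leading plus or from a leading minus is unbounded. Hence compactness needs \<open>k\<close>
  changes, none of them in front of the first coordinate.\<close>

lemma compact_feasible_signs_eq: "compact_feasible_signs n \<eta> = sign_vec n ` os_states {1..<n} k"
proof (intro equalityI subsetI)
  fix \<alpha> assume "\<alpha> \<in> compact_feasible_signs n \<eta>"
  then have \<alpha>: "\<alpha> \<in> sign_seqs n" and f: "feasible n \<eta> \<alpha>" and c: "compact (region n \<eta> \<alpha>)"
    by (auto simp: compact_feasible_signs_def)
  let ?X = "sign_changes n 1 \<alpha>"
  have no: False if s: "s \<in> {1, -1}" and lt: "card (sign_changes n s \<alpha>) < k" for s
  proof -
    have "\<exists>I\<subseteq>{1..n}. card I = k - 1 \<and> (\<forall>j\<in>{1..n} - I. \<alpha> j = s * (- 1) ^ height I j)"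
      by (rule ex_zero_set[OF \<alpha>]) (use s lt kn in auto)
    then obtain I where I: "I \<subseteq> {1..n}" "card I = k - 1" "\<And>j. j \<in> {1..n} - I \<Longrightarrow> \<alpha> j = s * (- 1) ^ height I j"
      by blast
    have "Suc (card I) = k" using I lt by simp
    then obtain v where v: "v \<in> V" "\<And>i. i \<in> I \<Longrightarrow> coord v i = 0"
      "\<And>j. j \<in> {1..n} - I \<Longrightarrow> (- 1) ^ height I j * coord v j > 0" using V_vector[OF I(1)] by blast
    have "\<not> {1..n} \<subseteq> I" using card_mono[of I "{1..n}"] I(1,2) kn finite_subset[OF I(1)] by auto
    then obtain j where j: "j \<in> {1..n} - I" by blast
    have "coord (s *\<^sub>R v) j \<noteq> 0" using v(3)[OF j] s by auto
    then have "s *\<^sub>R v \<noteq> 0" by auto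
    moreover have "\<alpha> j * coord (s *\<^sub>R v) j \<ge> 0" if "j \<in> {1..n}" for j
      using v(2)[of j] v(3)[of j] I(3)[of j] that s by (cases "j \<in> I") auto
    ultimately show False using not_compact_region[OF f V_scale[OF v(1)]] c by blast
  qed
  have "\<not> card ?X < k" using no[of 1] by auto
  then have Xk: "card ?X = k" using feasible_iff[OF \<alpha>] f by simp
  have "0 \<notin> ?X"
  proof
    assume 0: "0 \<in> ?X"
    have "card (?X - {0}) < card ?X" by (rule card_Diff1_less) (simp_all add: 0)
    then have "card (sign_changes n (- 1) \<alpha>) < k"
      using sign_changes_minus(1)[OF \<alpha> _ 0] kn Xk by simp
    then show False using no[of "-1"] by simp
  qed
  then have "?X \<subseteq> {1..<n}" using subset_from_one[OF sign_changes_subset] by blast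
  then show "\<alpha> \<in> sign_vec n ` os_states {1..<n} k"
    using Xk sign_vec_changes[OF \<alpha>] by (intro image_eqI[of _ _ ?X]) (auto simp: os_states_def)
next
  fix \<alpha> assume "\<alpha> \<in> sign_vec n ` os_states {1..<n} k"
  then obtain x where x: "\<alpha> = sign_vec n x" "x \<subseteq> {1..<n}" "card x = k" by (auto simp: os_states_def)
  have \<alpha>: "\<alpha> \<in> sign_seqs n" using sign_vec_seqs x by simp
  have fx: "finite x" using x finite_subset by blast
  have "sign_changes n 1 \<alpha> = x" using sign_changes_sign_vec[of n x] x by auto
  then have f: "feasible n \<eta> \<alpha>" using feasible_iff[OF \<alpha>] x by simp
  \<comment> \<open>The first coordinate and the coordinates right after the changes: along
    \<open>K\<close> the signs of \<alpha> alternate, as the relation demands.\<close>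
  define K where "K = insert 1 (Suc ` x)"
  have 1: "1 \<notin> Suc ` x" using x by auto
  have K: "K \<subseteq> {1..n}" "card K = Suc k" "finite K" using x fx kn 1 by (auto simp: K_def card_image)
  obtain e where e: "\<forall>j\<in>K. e j > 0"
    "\<forall>v\<in>combos k b. (\<Sum>j\<in>K. (- 1) ^ height K j * e j * coord v j) = 0"
    using pos_frame_relation[OF V_pos K(3,1,2)] by blast
  have sgn: "(- 1) ^ height K j = \<alpha> j" if j: "j \<in> K" for j
  proof (cases "j = 1")
    case True
    have "height K 1 = 0" by (auto simp: height_def K_def)
    moreover have "height x 1 = 0" using x by (auto simp: height_def)
    ultimately show ?thesis using True kn by (simp add: x(1) sign_vec_def)
  next
    case False
    then obtain a where a: "j = Suc a" "a \<in> x" using j by (auto simp: K_def)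
    have "{i \<in> K. i < j} = insert 1 {i \<in> Suc ` x. i < j}" using a x False by (auto simp: K_def)
    then have "height K j = Suc (height (Suc ` x) j)" using 1 fx by (simp add: height_def)
    moreover have "height (Suc ` x) j = height x a" by (simp only: a(1) height_Suc_image)
    ultimately have "height K j = height x j" using a by (simp add: height_Suc[of x])
    then show ?thesis using K(1) j by (auto simp: x(1) sign_vec_def)
  qed
  have "compact (region n \<eta> \<alpha>)"
    by (rule compact_regionI[OF K(1,2), of e]) (use e sgn \<alpha> V_combos in auto)
  then show "\<alpha> \<in> compact_feasible_signs n \<eta>" using f \<alpha> by (simp add: compact_feasible_signs_def)
qed

text \<open>With the value of \<xi> as coordinate 0, a direction with \<open>k - 1\<close> zeros
  that starts with a plus sign increases \<xi>. So fewer than \<open>k\<close> changes, counted from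
  a leading plus, mean unbounded; for \<open>k\<close> changes the relation on coordinate 0 and the
  coordinates after the changes is the certificate.\<close>

lemma left_bounded_signs_eq:
  assumes \<xi>: "\<xi> \<in> dual_space V"
    and U: "(\<lambda>v. Poly_Mapping.single 0 (\<xi> v) + v) ` V = combos k c" "pos_frame k {0..n} c"
  shows "bounded_feasible_signs n \<eta> \<xi> = sign_vec n ` os_states {0..<n} k"
proof (intro equalityI subsetI)
  fix \<alpha> assume "\<alpha> \<in> bounded_feasible_signs n \<eta> \<xi>"
  then have \<alpha>: "\<alpha> \<in> sign_seqs n" and f: "feasible n \<eta> \<alpha>" and bd: "bounded_sign n \<eta> \<xi> \<alpha>"
    by (auto simp: bounded_feasible_signs_def)
  let ?X = "sign_changes n 1 \<alpha>"
  have "\<not> card ?X < k"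
  proof
    assume lt: "card ?X < k"
    have "\<exists>I\<subseteq>{1..n}. card I = k - 1 \<and> (\<forall>j\<in>{1..n} - I. \<alpha> j = 1 * (- 1) ^ height I j)"
      by (rule ex_zero_set[OF \<alpha>]) (use lt kn in auto)
    then obtain I where I: "I \<subseteq> {1..n}" "card I = k - 1" "\<And>j. j \<in> {1..n} - I \<Longrightarrow> \<alpha> j = 1 * (- 1) ^ height I j"
      by blast
    have I0: "I \<subseteq> {0..n}" "Suc (card I) = k" "0 \<notin> I" using I lt by auto
    obtain u where u: "u \<in> combos k c" "\<forall>i\<in>I. coord u i = 0" "\<forall>j\<in>{0..n} - I. (- 1) ^ height I j * coord u j > 0"
      using pos_frame_vector[OF U(2) _ I0(1,2)] by auto
    obtain v where v: "v \<in> V" "u = Poly_Mapping.single 0 (\<xi> v) + v" using u(1) U(1) by blast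
    have "coord v 0 = 0" using V_outside[OF v(1), of 0] by simp
    then have "\<xi> v > 0" using u(3)[rule_format, of 0] I0 by (simp add: v(2) lookup_add lookup_single)
    moreover have uv: "coord u j = coord v j" if "j \<in> {1..n}" for j
      using that by (simp add: v(2) lookup_add lookup_single)
    have "\<alpha> j * coord v j \<ge> 0" if j: "j \<in> {1..n}" for j
    proof (cases "j \<in> I")
      case True
      then show ?thesis using u(2) uv[OF j] by simp
    next
      case False
      then show ?thesis using u(3)[rule_format, of j] uv[OF j] I(3)[of j] j by simp
    qed
    ultimately show False using not_bounded_sign[OF \<xi> f v(1)] bd by blast
  qed
  then have "card ?X = k" using feasible_iff[OF \<alpha>] f by simp
  then show "\<alpha> \<in> sign_vec n ` os_states {0..<n} k"
    using sign_vec_changes[OF \<alpha>] sign_changes_subset[of n 1 \<alpha>]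
    by (intro image_eqI[of _ _ ?X]) (auto simp: os_states_def)
next
  fix \<alpha> assume "\<alpha> \<in> sign_vec n ` os_states {0..<n} k"
  then obtain x where x: "\<alpha> = sign_vec n x" "x \<subseteq> {0..<n}" "card x = k" by (auto simp: os_states_def)
  have \<alpha>: "\<alpha> \<in> sign_seqs n" using sign_vec_seqs x by simp
  have fx: "finite x" using x finite_subset by blast
  have "sign_changes n 1 \<alpha> = x" using sign_changes_sign_vec[of n x] x by auto
  then have f: "feasible n \<eta> \<alpha>" using feasible_iff[OF \<alpha>] x by simp
  define I where "I = Suc ` x"
  have I: "I \<subseteq> {1..n}" "finite I" "card I = k" "0 \<notin> I" using x fx by (auto simp: I_def card_image)
  define K where "K = insert 0 I"
  have K: "finite K" "K \<subseteq> {0..n}" "card K = Suc k" using I by (auto simp: K_def)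
  obtain e where e: "\<forall>j\<in>K. e j > 0"
    "\<forall>v\<in>combos k c. (\<Sum>j\<in>K. (- 1) ^ height K j * e j * coord v j) = 0"
    using pos_frame_relation[OF U(2) K] by blast
  have sgn: "(- 1) ^ height K j = \<alpha> j" if j: "j \<in> I" for j
  proof -
    obtain a where a: "j = Suc a" "a \<in> x" using j by (auto simp: I_def)
    have "{i \<in> K. i < j} = insert 0 {i \<in> I. i < j}" using a by (auto simp: K_def)
    then have "height K j = Suc (height I j)" using I by (simp add: height_def)
    moreover have "height I j = height x a" by (simp only: a(1) I_def height_Suc_image)
    ultimately have "height K j = height x j" using a by (simp add: height_Suc[of x])
    then show ?thesis using I(1) j by (auto simp: x(1) sign_vec_def)
  qed
  have "bounded_sign n \<eta> \<xi> \<alpha>"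
  proof (rule bounded_signI[OF I(2,1), of "e 0" e])
    fix v assume v: "v \<in> V"
    have v0: "coord v 0 = 0" using V_outside[OF v, of 0] by simp
    have "(\<Sum>j\<in>K. (- 1) ^ height K j * e j * coord (Poly_Mapping.single 0 (\<xi> v) + v) j) = 0"
      using e(2) U(1) v by blast
    then have "e 0 * \<xi> v + (\<Sum>i\<in>I. (- 1) ^ height K i * e i * coord (Poly_Mapping.single 0 (\<xi> v) + v) i) = 0"
      using I v0 by (simp add: K_def lookup_add lookup_single)
    moreover have "(\<Sum>i\<in>I. (- 1) ^ height K i * e i * coord (Poly_Mapping.single 0 (\<xi> v) + v) i) = (\<Sum>i\<in>I. \<alpha> i * e i * coord v i)"
      using I(4) sgn by (intro sum.cong refl) (auto simp: lookup_add lookup_single when_def)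
    ultimately show "e 0 * \<xi> v + (\<Sum>i\<in>I. \<alpha> i * e i * coord v i) = 0" by simp
  qed (use e K_def in auto)
  then show "\<alpha> \<in> bounded_feasible_signs n \<eta> \<xi>" using f \<alpha> by (simp add: bounded_feasible_signs_def)
qed

text \<open>Here the value of \<xi>, with the sign \<open>(- 1) ^ k\<close>, is the last coordinate.
  A direction that starts with plus and has \<open>k - 1\<close> zeros ends with sign
  \<open>(- 1) ^ (k - 1)\<close>, hence decreases \<xi>. Its negative starts with minus and
  increases \<xi>, so boundedness needs at least \<open>k\<close> changes counted from a leading
  minus.\<close>

lemma right_bounded_signs_eq:
  assumes \<xi>: "\<xi> \<in> dual_space V"
    and U: "(\<lambda>v. v + Poly_Mapping.single (n + 1) ((- 1) ^ k * \<xi> v)) ` V = combos k c" "pos_frame k {1..n + 1} c"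
  shows "bounded_feasible_signs n \<eta> \<xi> = sign_vec n ` os_states {1..n} k"
proof (intro equalityI subsetI)
  fix \<alpha> assume "\<alpha> \<in> bounded_feasible_signs n \<eta> \<xi>"
  then have \<alpha>: "\<alpha> \<in> sign_seqs n" and f: "feasible n \<eta> \<alpha>" and bd: "bounded_sign n \<eta> \<xi> \<alpha>"
    by (auto simp: bounded_feasible_signs_def)
  let ?X = "sign_changes n 1 \<alpha>"
  have fX: "finite ?X" by simp
  have ge: "\<not> card (sign_changes n (- 1) \<alpha>) < k"
  proof
    assume lt: "card (sign_changes n (- 1) \<alpha>) < k"
    have "\<exists>I\<subseteq>{1..n}. card I = k - 1 \<and> (\<forall>j\<in>{1..n} - I. \<alpha> j = - 1 * (- 1) ^ height I j)"
      by (rule ex_zero_set[OF \<alpha>]) (use lt kn in auto)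
    then obtain I where I: "I \<subseteq> {1..n}" "card I = k - 1" "\<And>j. j \<in> {1..n} - I \<Longrightarrow> \<alpha> j = - 1 * (- 1) ^ height I j"
      by blast
    have I0: "I \<subseteq> {1..n + 1}" "Suc (card I) = k" "n + 1 \<notin> I" using I lt by auto
    obtain u where u: "u \<in> combos k c" "\<forall>i\<in>I. coord u i = 0" "\<forall>j\<in>{1..n + 1} - I. (- 1) ^ height I j * coord u j > 0"
      using pos_frame_vector[OF U(2) _ I0(1,2)] by auto
    obtain v where v: "v \<in> V" "u = v + Poly_Mapping.single (n + 1) ((- 1) ^ k * \<xi> v)" using u(1) U(1) by blast
    have "coord v (n + 1) = 0" using V_outside[OF v(1), of "n + 1"] by simp
    then have cu: "coord u (n + 1) = (- 1) ^ k * \<xi> v" by (simp add: v(2) lookup_add)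
    have "height I (n + 1) = card I" by (rule height_top) (use I(1) in auto)
    then have "height I (n + 1) = k - 1" using I(2) by simp
    then have "(- 1) ^ (k - 1) * ((- 1) ^ k * \<xi> v) > 0" using u(3)[rule_format, of "n + 1"] I0(3) cu by simp
    moreover have "(- 1 :: real) ^ (k - 1) * (- 1) ^ k = - 1"
      using lt by (cases k) (auto simp: power_add[symmetric] mult_2[symmetric])
    ultimately have "\<xi> v < 0" by (simp add: mult.assoc[symmetric])
    moreover have "\<xi> (- v) = - \<xi> v"
    proof -
      have "\<xi> ((- 1) *\<^sub>R v + 0 *\<^sub>R v) = (- 1) * \<xi> v + 0 * \<xi> v" using \<xi> v(1) unfolding dual_space_def by blast
      then show ?thesis by simp
    qed
    ultimately have pos: "\<xi> (- v) > 0" by simp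
    have uv: "coord u j = coord v j" if "j \<in> {1..n}" for j
      using that by (simp add: v(2) lookup_add lookup_single)
    have "\<alpha> j * coord (- v) j \<ge> 0" if j: "j \<in> {1..n}" for j
    proof (cases "j \<in> I")
      case True
      then show ?thesis using u(2) uv[OF j] by simp
    next
      case False
      then show ?thesis using u(3)[rule_format, of j] uv[OF j] I(3)[of j] j by simp
    qed
    moreover have "- v \<in> V" using V_scale[OF v(1), of "-1"] by simp
    ultimately show False using not_bounded_sign[OF \<xi> f] pos bd by blast
  qed
  have le: "card ?X \<le> k" using feasible_iff[OF \<alpha>] f by simp
  have n1: "n \<ge> 1" using kn by simp
  have X0: "0 \<notin> ?X"
  proof
    assume 0: "0 \<in> ?X"
    have "card (?X - {0}) < card ?X" using fX 0 by (rule card_Diff1_less)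
    then show False using ge le sign_changes_minus(1)[OF \<alpha> n1 0] by simp
  qed
  then have "k \<le> Suc (card ?X)" using ge sign_changes_minus(2)[OF \<alpha> n1] fX by simp
  have "?X \<subseteq> {1..<n}" using subset_from_one[OF sign_changes_subset] X0 by blast
  then have X1: "?X \<subseteq> {1..n}" "n \<notin> ?X" by auto
  show "\<alpha> \<in> sign_vec n ` os_states {1..n} k"
  proof (cases "card ?X = k")
    case True
    then show ?thesis using X1 sign_vec_changes[OF \<alpha>] by (intro image_eqI[of _ _ ?X]) (auto simp: os_states_def)
  next
    case False
    \<comment> \<open>Only \<open>k - 1\<close> changes are present; the missing point is
      \<open>n\<close>, which affects no sign.\<close>
    then have "card (insert n ?X) = k" using le \<open>k \<le> Suc (card ?X)\<close> X1(2) fX by simp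
    moreover have "insert n ?X \<inter> {0..<n} = ?X" using sign_changes_subset[of n 1 \<alpha>] by auto
    then have "sign_vec n (insert n ?X) = \<alpha>" using sign_vec_Int[of n "insert n ?X"] sign_vec_changes[OF \<alpha>] by simp
    ultimately show ?thesis using X1 n1 by (intro image_eqI[of _ _ "insert n ?X"]) (auto simp: os_states_def)
  qed
next
  fix \<alpha> assume "\<alpha> \<in> sign_vec n ` os_states {1..n} k"
  then obtain x where x: "\<alpha> = sign_vec n x" "x \<subseteq> {1..n}" "card x = k" by (auto simp: os_states_def)
  have \<alpha>: "\<alpha> \<in> sign_seqs n" using sign_vec_seqs x by simp
  have fx: "finite x" using x finite_subset by blast
  have "card (sign_changes n 1 \<alpha>) \<le> card x" using sign_changes_sign_vec[of n x] x fx by (auto intro: card_mono)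
  then have f: "feasible n \<eta> \<alpha>" using feasible_iff[OF \<alpha>] x by simp
  have nx: "n + 1 \<notin> x" using x by auto
  \<comment> \<open>Here the coordinates right before the changes are used, together with
    \<open>n + 1\<close>; the point \<open>n\<close> contributes coordinate
    \<open>n\<close>.\<close>
  define K where "K = insert (n + 1) x"
  have K: "finite K" "K \<subseteq> {1..n + 1}" "card K = Suc k" using x fx nx by (auto simp: K_def)
  obtain e where e: "\<forall>j\<in>K. e j > 0"
    "\<forall>v\<in>combos k c. (\<Sum>j\<in>K. (- 1) ^ height K j * e j * coord v j) = 0"
    using pos_frame_relation[OF U(2) K] by blast
  have hK: "height K j = height x j" if "j \<le> n + 1" for j
    unfolding height_def K_def using that by (intro arg_cong[where f = card]) auto
  have sgn: "(- 1) ^ height K j = \<alpha> j" if j: "j \<in> x" for j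
    using hK[of j] j x(2) by (auto simp: x(1) sign_vec_def)
  have "height x (n + 1) = card x" by (rule height_top) (use x in auto)
  then have top: "height K (n + 1) = k" using hK[of "n + 1"] x by simp
  have "bounded_sign n \<eta> \<xi> \<alpha>"
  proof (rule bounded_signI[OF fx x(2), of "e (n + 1)" e])
    fix v assume v: "v \<in> V"
    define u where "u = v + Poly_Mapping.single (n + 1) ((- 1) ^ k * \<xi> v)"
    have "coord v (n + 1) = 0" using V_outside[OF v, of "n + 1"] by simp
    then have u1: "coord u (n + 1) = (- 1) ^ k * \<xi> v" by (simp add: u_def lookup_add)
    have "u \<in> combos k c" using U(1) v by (auto simp: u_def)
    then have "(\<Sum>j\<in>K. (- 1) ^ height K j * e j * coord u j) = 0" using e(2) by blast
    then have "(- 1) ^ k * e (n + 1) * ((- 1) ^ k * \<xi> v) + (\<Sum>i\<in>x. (- 1) ^ height K i * e i * coord u i) = 0"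
      using fx nx top u1 by (simp add: K_def)
    moreover have "(- 1) ^ k * e (n + 1) * ((- 1) ^ k * \<xi> v) = e (n + 1) * \<xi> v"
    proof -
      have "(- 1) ^ k * e (n + 1) * ((- 1) ^ k * \<xi> v) = ((- 1) ^ k * (- 1) ^ k) * (e (n + 1) * \<xi> v)"
        by (simp only: mult_ac)
      also have "(- 1 :: real) ^ k * (- 1) ^ k = 1" by (simp add: power_mult_distrib[symmetric])
      finally show ?thesis by simp
    qed
    moreover have "(\<Sum>i\<in>x. (- 1) ^ height K i * e i * coord u i) = (\<Sum>i\<in>x. \<alpha> i * e i * coord v i)"
      using nx sgn by (intro sum.cong refl) (auto simp: u_def lookup_add lookup_single when_def)
    ultimately show "e (n + 1) * \<xi> v + (\<Sum>i\<in>x. \<alpha> i * e i * coord v i) = 0" by argo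
  qed (use e K_def in auto)
  then show "\<alpha> \<in> bounded_feasible_signs n \<eta> \<xi>" using f \<alpha> by (simp add: bounded_feasible_signs_def)
qed

text \<open>Off \<open>I\<close> both sign sequences follow the pattern of \<open>I\<close> exactly
  if \<open>I\<close> satisfies the parity condition for \<open>x\<close> and contains every gap
  separating \<open>x\<close> from \<open>y\<close>. This turns vertices into matchings.\<close>

lemma conv_algebra_iso:
  assumes W: "W \<subseteq> os_states {0..n} k"
  shows "conv_algebra n \<eta> (sign_vec n ` W) \<simeq> os_corner n k W"
proof (rule conv_algebra_iso_os_corner[OF _ W])
  show "k \<le> n" using kn by simp
  fix x y T assume "x \<in> W" "y \<in> W" and T: "T \<subseteq> {1..n}"
  then have xs: "x \<in> os_states {0..n} k" and ys: "y \<in> os_states {0..n} k" using W by auto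
  have pd: "parity_diff x y \<subseteq> {1..n}" by (rule parity_diff_subset[OF xs ys])
  have sv: "sign_vec n x j = (- 1) ^ height I j \<longleftrightarrow> (even (height x j) \<longleftrightarrow> even (height I j))" if "j \<in> {1..n}" for x I j
    using that by (auto simp: sign_vec_def minus_one_power_iff)
  have "(\<forall>j\<in>{1..n} - I. sign_vec n x j = (- 1) ^ height I j \<and> sign_vec n y j = (- 1) ^ height I j) \<longleftrightarrow>
      (\<forall>j\<in>{1..n} - I. even (height x j) \<longleftrightarrow> even (height I j)) \<and> parity_diff x y \<subseteq> I" for I
    using pd sv by (auto simp: parity_diff_def)
  then show "region n \<eta> (sign_vec n x) \<inter> region n \<eta> (sign_vec n y) \<inter> hyp_inter \<eta> T \<noteq> {} \<longleftrightarrow>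
      (\<exists>I. matching n x I \<and> T \<union> parity_diff x y \<subseteq> I)"
    unfolding region_inter_iff[OF sign_vec_seqs sign_vec_seqs T] matching_def
    using os_state_card[OF xs] by auto
qed

end

section \<open>Cyclic arrangements\<close>

lemma dot_sum: "finite A \<Longrightarrow> Poly_Mapping.keys x \<subseteq> A \<Longrightarrow> dot x y = (\<Sum>i\<in>A. coord x i * coord y i)"
  unfolding dot_def by (rule sum.mono_neutral_left) (auto simp: in_keys_iff)

lemma dot_commute: "dot x y = dot y x"
  using dot_sum[of "Poly_Mapping.keys x \<union> Poly_Mapping.keys y" x y]
    dot_sum[of "Poly_Mapping.keys x \<union> Poly_Mapping.keys y" y x] by (simp add: mult.commute)

lemma dot_right: "dot x (y + z) = dot x y + dot x z" "dot x (y - z) = dot x y - dot x z"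
  "dot x (a *\<^sub>R y) = a * dot x y"
  by (simp_all add: dot_def lookup_add lookup_minus distrib_left right_diff_distrib sum.distrib
      sum_subtractf sum_distrib_left mult_ac)

lemma dot_left: "dot (y + z) x = dot y x + dot z x" "dot (y - z) x = dot y x - dot z x"
  "dot (a *\<^sub>R y) x = a * dot y x"
  by (simp_all add: dot_commute[of _ x] dot_right)

lemma dot_zero [simp]: "dot x 0 = 0" "dot 0 x = 0"
  by (simp_all add: dot_def)

lemma dot_self: "dot x x = 0 \<Longrightarrow> x = 0"
proof -
  assume "dot x x = 0"
  then have "\<forall>i\<in>Poly_Mapping.keys x. coord x i * coord x i = 0"
    unfolding dot_def by (subst (asm) sum_nonneg_eq_0_iff) auto
  then have "coord x i = 0" for i by (cases "i \<in> Poly_Mapping.keys x") (auto simp: in_keys_iff)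
  then show "x = 0" by (intro poly_mapping_eqI) simp
qed

text \<open>Gram-Schmidt: \<open>d\<close> is the part of the new vector orthogonal to the span of
  \<open>B\<close>, and correcting along \<open>d\<close> does not disturb orthogonality to
  \<open>B\<close>.\<close>

lemma ex_orthogonal:
  assumes "finite B"
  shows "\<exists>v\<in>Real_Vector_Spaces.span B. \<forall>b\<in>B. dot (x - v) b = 0"
  using assms
proof (induct B arbitrary: x rule: finite_induct)
  case empty
  show ?case by (simp add: Real_Vector_Spaces.span_zero)
next
  case (insert b B)
  obtain u where u: "u \<in> Real_Vector_Spaces.span B" "\<forall>c\<in>B. dot (b - u) c = 0" using insert(3) by blast
  obtain v where v: "v \<in> Real_Vector_Spaces.span B" "\<forall>c\<in>B. dot (x - v) c = 0" using insert(3) by blast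
  define d where "d = b - u"
  have ud: "dot d w = 0" if "w \<in> Real_Vector_Spaces.span B" for w
    using that
  proof (induct rule: Real_Vector_Spaces.span_induct_alt)
    case (step c x y) then show ?case using u(2) by (simp add: dot_right d_def)
  qed simp
  have xv: "dot (x - v) w = 0" if "w \<in> Real_Vector_Spaces.span B" for w
    using that
  proof (induct rule: Real_Vector_Spaces.span_induct_alt)
    case (step c x y) then show ?case using v(2) by (simp add: dot_right)
  qed simp
  have mono: "w \<in> Real_Vector_Spaces.span (insert b B)" if "w \<in> Real_Vector_Spaces.span B" for w
    using Real_Vector_Spaces.span_mono[of B "insert b B"] that by blast
  have bs: "b \<in> Real_Vector_Spaces.span (insert b B)" by (rule Real_Vector_Spaces.span_base) simp
  have b: "b = d + u" by (simp add: d_def)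
  show ?case
  proof (cases "d = 0")
    case True
    then have "dot (x - v) b = 0" using xv u(1) b by simp
    then show ?thesis using v mono by auto
  next
    case False
    then have dd: "dot d d \<noteq> 0" using dot_self by blast
    define t where "t = dot (x - v) d / dot d d"
    let ?v = "v + t *\<^sub>R d"
    have "?v \<in> Real_Vector_Spaces.span (insert b B)"
      unfolding d_def using mono[OF u(1)] mono[OF v(1)] bs
      by (intro Real_Vector_Spaces.span_add Real_Vector_Spaces.span_scale Real_Vector_Spaces.span_diff)
    moreover have e: "dot (x - ?v) w = dot (x - v) w - t * dot d w" for w
      by (simp add: dot_left algebra_simps)
    have "dot (x - ?v) c = 0" if "c \<in> B" for c
      unfolding e using v(2) that ud[OF Real_Vector_Spaces.span_base[OF that]] by simp
    moreover have "dot (x - ?v) b = 0"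
      unfolding e b dot_right using xv[OF u(1)] ud[OF u(1)] dd by (simp add: t_def)
    ultimately show ?thesis by blast
  qed
qed

lemma coord_space_diff: "x \<in> coord_space J \<Longrightarrow> y \<in> coord_space J \<Longrightarrow> x - y \<in> coord_space J"
  using keys_diff[of x y] by (auto simp: coord_space_def)

lemma subspace_combos: "Real_Vector_Spaces.subspace (combos d b)"
  unfolding Real_Vector_Spaces.subspace_def
proof (intro conjI ballI allI)
  show "0 \<in> combos d b" using combosI[of "\<lambda>_. 0" b d] by simp
  fix x assume "x \<in> combos d b"
  then obtain a where a: "x = (\<Sum>i<d. a i *\<^sub>R b i)" by (auto simp: combos_def)
  show "c *\<^sub>R x \<in> combos d b" for c
    using combosI[of "\<lambda>i. c * a i" b d] by (simp add: a scaleR_sum_right)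
  fix y assume "y \<in> combos d b"
  then obtain a' where a': "y = (\<Sum>i<d. a' i *\<^sub>R b i)" by (auto simp: combos_def)
  show "x + y \<in> combos d b"
    using combosI[of "\<lambda>i. a i + a' i" b d] by (simp add: a a' scaleR_add_left sum.distrib)
qed

text \<open>The definite description requires uniqueness: two candidates differ by a vector that
  lies in the complement of \<open>V\<close> and in the complement of that complement, hence is
  orthogonal to itself.\<close>

lemma orth_proj_orth_compl:
  assumes V: "V = combos k b" "V \<subseteq> coord_space {1..n}" and x: "x \<in> coord_space {1..n}"
  shows "x - orth_proj n (orth_compl n V) x \<in> V" "v \<in> V \<Longrightarrow> dot (orth_proj n (orth_compl n V) x) v = 0"
proof -
  have sub: "Real_Vector_Spaces.subspace V" using subspace_combos V by simp
  obtain v where v: "v \<in> Real_Vector_Spaces.span (b ` {..<k})" "\<forall>c\<in>b ` {..<k}. dot (x - v) c = 0"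
    using ex_orthogonal[of "b ` {..<k}" x] by blast
  have "b ` {..<k} \<subseteq> V" using combos_basis[of _ k b] V by auto
  then have vV: "v \<in> V" using v(1) Real_Vector_Spaces.span_minimal[OF _ sub] by blast
  define p where "p = x - v"
  have orth: "dot p w = 0" if w: "w \<in> V" for w
  proof -
    obtain a where a: "w = (\<Sum>i<k. a i *\<^sub>R b i)" using w V by (auto simp: combos_def)
    have "dot p (\<Sum>i\<in>A. a i *\<^sub>R b i) = 0" if "finite A" "A \<subseteq> {..<k}" for A
      using that by (induct A rule: finite_induct) (use v(2) in \<open>auto simp: dot_right p_def\<close>)
    then show ?thesis unfolding a by blast
  qed
  have p: "p \<in> orth_compl n V" using orth coord_space_diff[OF x] vV V(2) by (auto simp: orth_compl_def p_def)
  have xp: "x - p = v" by (simp add: p_def)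
  have v2: "v \<in> orth_compl n (orth_compl n V)"
    unfolding orth_compl_def[of n "orth_compl n V"] using vV V(2)
    by (auto simp: orth_compl_def dot_commute[of v])
  have diff: "y - z \<in> orth_compl n W" if "y \<in> orth_compl n W" "z \<in> orth_compl n W" for y z W
    using that coord_space_diff by (auto simp: orth_compl_def dot_left)
  have "orth_proj n (orth_compl n V) x = p"
    unfolding orth_proj_def
  proof (rule the_equality)
    show "p \<in> orth_compl n V \<and> x - p \<in> orth_compl n (orth_compl n V)" using p v2 xp by simp
    fix q assume q: "q \<in> orth_compl n V \<and> x - q \<in> orth_compl n (orth_compl n V)"
    have "q - p \<in> orth_compl n V" using diff q p by blast
    moreover have "(x - p) - (x - q) \<in> orth_compl n (orth_compl n V)" using diff q v2 xp by blast
    then have "q - p \<in> orth_compl n (orth_compl n V)" by simp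
    ultimately have "dot (q - p) (q - p) = 0" by (auto simp: orth_compl_def)
    then show "q = p" using dot_self by force
  qed
  then show "x - orth_proj n (orth_compl n V) x \<in> V" "v \<in> V \<Longrightarrow> dot (orth_proj n (orth_compl n V) x) v = 0" for v
    using vV xp orth by auto
qed

text \<open>Applied to the span of \<open>V\<close> and \<eta>, of dimension \<open>k + 1\<close>,
  this yields \<open>k < n\<close>.\<close>

lemma Gr_pos_dim_le:
  assumes "W \<in> Gr_pos d {1..n}"
  shows "d \<le> n"
proof -
  obtain b where b: "inj_on b {..<d}" "Real_Vector_Spaces.independent (b ` {..<d})"
    "Real_Vector_Spaces.span (b ` {..<d}) = W" "W \<subseteq> coord_space {1..n}"
    using assms unfolding Gr_pos_def by blast
  let ?E = "(\<lambda>i. Poly_Mapping.single i (1 :: real)) ` {1..n}"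
  have "x \<in> Real_Vector_Spaces.span ?E" if x: "x \<in> coord_space {1..n}" for x
  proof -
    have "x = (\<Sum>i\<in>{1..n}. coord x i *\<^sub>R Poly_Mapping.single i 1)"
      using x by (intro poly_mapping_eqI)
        (auto simp: lookup_sum lookup_single when_def coord_space_def in_keys_iff if_distrib cong: if_cong)
    moreover have "(\<Sum>i\<in>{1..n}. coord x i *\<^sub>R Poly_Mapping.single i 1) \<in> Real_Vector_Spaces.span ?E"
      by (intro Real_Vector_Spaces.span_sum Real_Vector_Spaces.span_scale Real_Vector_Spaces.span_base) auto
    ultimately show ?thesis by simp
  qed
  then have "b ` {..<d} \<subseteq> Real_Vector_Spaces.span ?E"
    using b(3,4) Real_Vector_Spaces.span_superset[of "b ` {..<d}"] by blast
  then have "card (b ` {..<d}) \<le> card ?E"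
    using Real_Vector_Spaces.independent_span_bound[of ?E "b ` {..<d}"] b(2) by auto
  also have "card ?E \<le> n" using card_image_le[of "{1..n}" "\<lambda>i. Poly_Mapping.single i (1 :: real)"] by simp
  finally show ?thesis using b(1) by (simp add: card_image)
qed

text \<open>The positive frame given for the larger space is unrelated to \<open>b\<close>; a base
  change transfers positivity to \<open>b\<close> extended by \<open>r\<close>. The orthogonal
  projection of \<open>r\<close> stays in \<eta>, as it differs from \<open>r\<close> by a vector of
  \<open>V\<close>.\<close>

lemma pos_arrangementI:
  assumes arr: "arrangement n k V \<eta>" and W: "Real_Vector_Spaces.span (V \<union> \<eta>) \<in> Gr_pos (k + 1) {1..n}"
    and po: "positively_oriented n V \<eta>" and V: "V = combos k b" "pos_frame k {1..n} b"
  shows "\<exists>r. pos_arrangement n k V \<eta> b r"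
proof -
  obtain r where r: "r \<in> coord_space {1..n}" "\<eta> = (\<lambda>v. r + v) ` V"
    and Vc: "V \<subseteq> coord_space {1..n}" and sub: "Real_Vector_Spaces.subspace V"
    using arr by (auto simp: arrangement_def)
  let ?b = "b(k := r)"
  have kn: "k < n" using Gr_pos_dim_le[OF W] by simp
  obtain c where c: "Real_Vector_Spaces.span (V \<union> \<eta>) = combos (Suc k) c" "pos_frame (Suc k) {1..n} c"
    using Gr_pos_frame[OF W] by (metis Suc_eq_plus1)
  have "V \<union> \<eta> \<subseteq> combos (Suc k) ?b"
  proof -
    have "v \<in> combos (Suc k) ?b \<and> r + v \<in> combos (Suc k) ?b" if v: "v \<in> V" for v
    proof -
      obtain a where a: "v = (\<Sum>i<k. a i *\<^sub>R b i)" using v V by (auto simp: combos_def)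
      have "t *\<^sub>R r + v \<in> combos (Suc k) ?b" for t
        using combosI[of "a(k := t)" ?b "Suc k"] by (simp add: a add.commute)
      from this[of 0] this[of 1] show ?thesis by simp
    qed
    then show ?thesis using r(2) by blast
  qed
  then have "combos (Suc k) c \<subseteq> combos (Suc k) ?b"
    unfolding c(1)[symmetric] by (rule Real_Vector_Spaces.span_minimal[OF _ subspace_combos])
  then have pos: "pos_frame (Suc k) {1..n} ?b"
    using combos_basis by (intro pos_frame_change[OF c(2)]) auto
  have rV: "r \<in> \<eta>" using r(2) Real_Vector_Spaces.subspace_0[OF sub] by force
  define p where "p = orth_proj n (orth_compl n V) r"
  have "r - p \<in> V" and po': "\<And>v. v \<in> V \<Longrightarrow> dot p v = 0"
    using orth_proj_orth_compl[OF V(1) Vc r(1)] by (simp_all add: p_def)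
  then have "r + - (r - p) \<in> \<eta>" using r(2) Real_Vector_Spaces.subspace_neg[OF sub] by blast
  then have "p \<in> \<eta>" by simp
  moreover have "coord p 1 > 0" using po rV by (simp add: positively_oriented_def p_def)
  ultimately have "pos_arrangement n k V \<eta> b r"
    using kn V Vc sub r pos po' by unfold_locales auto
  then show ?thesis by blast
qed

text \<open>Minors that avoid the additional column \<open>z\<close> do not see the value of the
  form, so deleting that column keeps positivity. This covers an additional coordinate at the front
  as well as at the end.\<close>

lemma pos_frame_of_graph:
  assumes V: "V \<subseteq> coord_space {1..n}" "Real_Vector_Spaces.subspace V" and z: "z \<notin> {1..n}"
    and U: "(\<lambda>v. Poly_Mapping.single z (g v) + v) ` V = combos k c" "pos_frame k J c" and J: "{1..n} \<subseteq> J"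
  shows "\<exists>b. V = combos k b \<and> pos_frame k {1..n} b"
proof -
  have "\<exists>v. v \<in> V \<and> c i = Poly_Mapping.single z (g v) + v" if "i < k" for i
    using combos_basis[OF that, of c] U(1) by blast
  then obtain b where b: "\<And>i. i < k \<Longrightarrow> b i \<in> V \<and> c i = Poly_Mapping.single z (g (b i)) + b i" by metis
  have Vz: "coord v z = 0" if "v \<in> V" for v
  proof -
    have "Poly_Mapping.keys v \<subseteq> {1..n}" using that V(1) by (auto simp: coord_space_def)
    then show ?thesis using z by (auto simp: not_in_keys_iff_lookup_eq_zero[symmetric])
  qed
  have bc: "coord (c i) j = coord (b i) j" if "i < k" "j \<noteq> z" for i j
    using b[OF that(1)] that(2) by (simp add: lookup_add lookup_single)
  have "V = combos k b"
  proof (intro equalityI subsetI)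
    fix v assume v: "v \<in> V"
    then obtain a where a: "Poly_Mapping.single z (g v) + v = (\<Sum>i<k. a i *\<^sub>R c i)" using U(1) by (auto simp: combos_def)
    have "v = (\<Sum>i<k. a i *\<^sub>R b i)"
    proof (rule poly_mapping_eqI)
      fix j
      show "coord v j = coord (\<Sum>i<k. a i *\<^sub>R b i) j"
      proof (cases "j = z")
        case True
        then show ?thesis using Vz[OF v] Vz b by (simp add: lookup_sum)
      next
        case False
        then have "coord v j = coord (\<Sum>i<k. a i *\<^sub>R c i) j" by (simp add: a[symmetric] lookup_add lookup_single)
        then show ?thesis using bc False by (simp add: lookup_sum)
      qed
    qed
    then show "v \<in> combos k b" by (auto simp: combos_def)
  next
    fix v assume "v \<in> combos k b"
    then obtain a where "v = (\<Sum>i<k. a i *\<^sub>R b i)" by (auto simp: combos_def)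
    then show "v \<in> V" using b V(2)
      by (auto intro!: Real_Vector_Spaces.subspace_sum Real_Vector_Spaces.subspace_scale)
  qed
  moreover have "pos_frame k {1..n} b"
  proof -
    have "plucker k b I = plucker k c I" if I: "I \<subseteq> {1..n}" "card I = k" for I
    proof -
      have fI: "finite I" using I finite_subset by blast
      have "sorted_list_of_set I ! j \<noteq> z" if "j < k" for j
      proof -
        have "sorted_list_of_set I ! j \<in> set (sorted_list_of_set I)" using that I by (intro nth_mem) simp
        then show ?thesis using fI I z by auto
      qed
      then show ?thesis unfolding plucker_def
        by (intro arg_cong[where f = Determinant.det] eq_matI) (auto simp: bc)
    qed
    then show ?thesis using pos_frame_mono[OF U(2) J] unfolding pos_frame_def by metis
  qed
  ultimately show ?thesis by blast
qed

lemma os_states_mono: "J \<subseteq> J' \<Longrightarrow> os_states J k \<subseteq> os_states J' k"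
  by (auto simp: os_states_def)

theorem theorem1p2:
  fixes n k :: nat
  assumes "n \<ge> 1"
  shows "(\<forall>V \<eta> \<xi>. left_cyclic n k V \<eta> \<xi> \<longrightarrow> hypertoric_B n \<eta> \<xi> \<simeq> os_algebra_l n k) \<and>
         (\<forall>V \<eta> \<xi>. right_cyclic n k V \<eta> \<xi> \<longrightarrow> hypertoric_B n \<eta> \<xi> \<simeq> os_algebra_r n k) \<and>
         (\<forall>V \<eta>. cyclic_arrangement n k V \<eta> \<longrightarrow> hypertoric_B' n \<eta> \<simeq> os_algebra' n k)"
proof (intro conjI allI impI)
  fix V \<eta> \<xi> assume L: "left_cyclic n k V \<eta> \<xi>"
  then have arr: "arrangement n k V \<eta>" and \<xi>: "\<xi> \<in> dual_space V"
    by (simp_all add: left_cyclic_def polarized_arrangement_def)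
  have V: "V \<subseteq> coord_space {1..n}" "Real_Vector_Spaces.subspace V" using arr by (simp_all add: arrangement_def)
  obtain c where c: "(\<lambda>v. Poly_Mapping.single 0 (\<xi> v) + v) ` V = combos k c" "pos_frame k {0..n} c"
    using L Gr_pos_frame[of "(\<lambda>v. Poly_Mapping.single 0 (\<xi> v) + v) ` V" k "{0..n}"]
    unfolding left_cyclic_def by blast
  obtain b where b: "V = combos k b" "pos_frame k {1..n} b"
    using pos_frame_of_graph[OF V _ c] by auto
  obtain r where "pos_arrangement n k V \<eta> b r"
    using pos_arrangementI[OF arr _ _ b] L by (auto simp: left_cyclic_def)
  then interpret pos_arrangement n k V \<eta> b r .
  show "hypertoric_B n \<eta> \<xi> \<simeq> os_algebra_l n k"
    unfolding hypertoric_B_def os_algebra_l_def left_bounded_signs_eq[OF \<xi> c]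
    by (intro conv_algebra_iso os_states_mono) auto
next
  fix V \<eta> \<xi> assume R: "right_cyclic n k V \<eta> \<xi>"
  then have arr: "arrangement n k V \<eta>" and \<xi>: "\<xi> \<in> dual_space V"
    by (simp_all add: right_cyclic_def polarized_arrangement_def)
  have V: "V \<subseteq> coord_space {1..n}" "Real_Vector_Spaces.subspace V" using arr by (simp_all add: arrangement_def)
  obtain c where c: "(\<lambda>v. v + Poly_Mapping.single (n + 1) ((- 1) ^ k * \<xi> v)) ` V = combos k c" "pos_frame k {1..n + 1} c"
    using R Gr_pos_frame[of "(\<lambda>v. v + Poly_Mapping.single (n + 1) ((- 1) ^ k * \<xi> v)) ` V" k "{1..n + 1}"]
    unfolding right_cyclic_def by blast
  have c': "(\<lambda>v. Poly_Mapping.single (n + 1) ((- 1) ^ k * \<xi> v) + v) ` V = combos k c"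
    using c(1) by (simp add: add.commute)
  obtain b where b: "V = combos k b" "pos_frame k {1..n} b"
    using pos_frame_of_graph[OF V _ c' c(2)] by auto
  obtain r where "pos_arrangement n k V \<eta> b r"
    using pos_arrangementI[OF arr _ _ b] R by (auto simp: right_cyclic_def)
  then interpret pos_arrangement n k V \<eta> b r .
  show "hypertoric_B n \<eta> \<xi> \<simeq> os_algebra_r n k"
    unfolding hypertoric_B_def os_algebra_r_def right_bounded_signs_eq[OF \<xi> c]
    by (intro conv_algebra_iso os_states_mono) auto
next
  fix V \<eta> assume C: "cyclic_arrangement n k V \<eta>"
  then have arr: "arrangement n k V \<eta>" by (simp add: cyclic_arrangement_def)
  obtain b where b: "V = combos k b" "pos_frame k {1..n} b"
    using C Gr_pos_frame unfolding cyclic_arrangement_def by metis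
  obtain r where "pos_arrangement n k V \<eta> b r"
    using pos_arrangementI[OF arr _ _ b] C by (auto simp: cyclic_arrangement_def)
  then interpret pos_arrangement n k V \<eta> b r .
  show "hypertoric_B' n \<eta> \<simeq> os_algebra' n k"
    unfolding hypertoric_B'_def os_algebra'_def compact_feasible_signs_eq
    by (intro conv_algebra_iso os_states_mono) auto
qed

end
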